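(* Let $G$ be a nonsingular even integral symmetric $n\times n$ matrix ($n\ge1$) with $D=\det(G)$ and level $N$, and set $G^\perp=NG^{-1}$. Let $c$ be a positive integer, $a$ a nonzero integer with $\gcd(a,c)=1$, $c_0$ the odd part of $c$, and $\mathbf{w}\in\mathbb{Q}^n$ with $G\mathbf{w}\in\mathbb{Z}^n$. Let $H$ be a subgroup of $\mathbb{Z}^n/c\mathbb{Z}^n$. If $\gcd(N,c)=1$, then $$\frac{1}{\sqrt{|H|}}\,\mathfrak{G}^{H}_{G}(a/c;\mathbf{w})=\gamma\cdot\frac{1}{\sqrt{|H^\perp|}}\,\mathfrak{G}^{H^\perp}_{G^\perp}(a^\perp/c;-aG\mathbf{w}),$$ where $a^\perp$ is any integer with $a^\perp aN\equiv-1\pmod c$ and $$\gamma=\left(\frac{|a|}{c}\right)_K^n\left(\frac{D}{c}\right)_K e\!\left(\frac{n\,\mathrm{sgn}(a)(1-c_0)}{8}\right)e\!\left(\frac{a}{2c}\mathbf{w}^{T}G\mathbf{w}\right).$$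
   Context: $e(z)=\exp(2\pi i z)$. Even integral: integer entries, even diagonal. Level of nonsingular even integral symmetric $G$: least positive integer $N$ with $NG^{-1}$ even integral. For an even integral symmetric matrix $M$, a rational $r$ with denominator $c$, a vector $\mathbf{u}\in\mathbb{Q}^n$ with $M\mathbf{u}\in\mathbb{Z}^n$ and a subset $S\subseteq\mathbb{Z}^n/c\mathbb{Z}^n$, $\mathfrak{G}^S_M(r;\mathbf{u})=\sum_{\mathbf{v}\in S}e\big(r\cdot\tfrac12(\mathbf{v}+\mathbf{u})^TM(\mathbf{v}+\mathbf{u})\big)$, where $\mathbf{v}$ runs over integer representatives (the value is independent of the choice). $H^\perp=\{\mathbf{v}\in\mathbb{Z}^n/c\mathbb{Z}^n:\mathbf{v}^T\mathbf{h}\equiv0\pmod c\ \forall\mathbf{h}\in H\}$. $(\frac{\cdot}{\cdot})_K$ is the Kronecker–Jacobi symbol; $c_0$ is defined by $c=2^ec_0$, $c_0$ odd. *)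

theory Defs
  imports "HOL-Analysis.Analysis" "HOL-Number_Theory.Number_Theory" "HOL-Algebra.Coset"
begin

definition ee :: "complex \<Rightarrow> complex" where
  "ee z = exp (2 * of_real pi * \<i> * z)"

definition even_integral :: "real^'n^'n \<Rightarrow> bool" where
  "even_integral M \<longleftrightarrow>
     (\<forall>i j. M $ i $ j \<in> \<int>) \<and> (\<forall>i. \<exists>k::int. M $ i $ i = 2 * of_int k)"

definition level :: "real^'n^'n \<Rightarrow> nat" where
  "level G = (LEAST N. N > 0 \<and> even_integral (real N *\<^sub>R matrix_inv G))"

definition int_vec_group :: "(int^'n) monoid" where
  "int_vec_group = \<lparr>carrier = UNIV, monoid.mult = (+), one = 0\<rparr>"

definition multiples_lattice :: "nat \<Rightarrow> (int^'n) set" where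
  "multiples_lattice c = {v. \<forall>i. int c dvd v $ i}"

text \<open>The group \<open>Z^n / c Z^n\<close>; its elements are residue classes, i.e. sets of integer vectors.\<close>

definition residue_group :: "nat \<Rightarrow> (int^'n) set monoid" where
  "residue_group c = int_vec_group Mod multiples_lattice c"

definition real_vec :: "int^'n \<Rightarrow> real^'n" where
  "real_vec v = (\<chi> i. of_int (v $ i))"

text \<open>\<open>S\<close> is a set of residue classes modulo the denominator of \<open>r\<close>, and each class contributes
  through one integer representative. Lemma \<open>gauss_sum_eq_representatives\<close> shows that the
  choice is irrelevant.\<close>

definition gauss_sum :: "real^'n^'n \<Rightarrow> (int^'n) set set \<Rightarrow> real \<Rightarrow> real^'n \<Rightarrow> complex" where
  "gauss_sum M S r u =
     (\<Sum>V\<in>S. let x = real_vec (SOME v. v \<in> V) + u in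
        ee (of_real (r * (1/2 * (x \<bullet> (M *v x))))))"

definition perp :: "nat \<Rightarrow> (int^'n) set set \<Rightarrow> (int^'n) set set" where
  "perp c H = {V \<in> carrier (residue_group c).
     \<forall>U\<in>H. \<forall>v\<in>V. \<forall>h\<in>U. [(\<Sum>i\<in>UNIV. v $ i * h $ i) = 0] (mod int c)}"

definition kronecker_prime :: "int \<Rightarrow> int \<Rightarrow> int" where
  "kronecker_prime a p =
     (if p = 2 then (if even a then 0 else if a mod 8 = 1 \<or> a mod 8 = 7 then 1 else -1)
      else Legendre a p)"

text \<open>The first factor in the case \<open>b \<noteq> 0\<close> is the symbol of \<open>a\<close> over the unit \<open>sgn b\<close>.\<close>

definition kronecker :: "int \<Rightarrow> int \<Rightarrow> int" where
  "kronecker a b =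
     (if b = 0 then (if \<bar>a\<bar> = 1 then 1 else 0)
      else (if b < 0 \<and> a < 0 then -1 else 1) *
           (\<Prod>p\<in>prime_factors b. kronecker_prime a p ^ multiplicity p b))"

lemma residue_class_diff:
  fixes v v' :: "int^'n"
  assumes "V \<in> carrier (residue_group c)" "v \<in> V" "v' \<in> V"
  obtains k :: "int^'n" where "v' = v + int c *s k"
proof -
  obtain x :: "int^'n" where "V = (\<Union>h\<in>multiples_lattice c. {h + x})"
    using assms(1) unfolding residue_group_def FactGroup_def RCOSETS_def r_coset_def
    by (auto simp: int_vec_group_def)
  then obtain h h' :: "int^'n" where
    hh: "h \<in> multiples_lattice c" "h' \<in> multiples_lattice c" "v = h + x" "v' = h' + x"
    using assms by auto
  then have "int c dvd (v' - v) $ i" for i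
    by (simp add: multiples_lattice_def dvd_diff)
  then have "(v' - v) $ i = int c * ((v' - v) $ i div int c)" for i
    by (metis dvd_mult_div_cancel)
  then have "v' - v = int c *s (\<chi> i. (v' - v) $ i div int c)"
    unfolding vec_eq_iff by (simp only: vector_smult_component vec_lambda_beta) simp
  then have "v' = v + int c *s (\<chi> i. (v' - v) $ i div int c)"
    by (simp only: diff_eq_eq add.commute)
  then show ?thesis by (rule that)
qed

lemma even_integral_quadratic_even:
  fixes k :: "int^'n"
  assumes "even_integral M" "transpose M = M"
  shows "1/2 * (real_vec k \<bullet> (M *v real_vec k)) \<in> \<int>"
proof -
  define A where "A i j = \<lfloor>M $ i $ j\<rfloor>" for i j
  have A: "M $ i $ j = of_int (A i j)" for i j
    using assms(1) by (auto simp: A_def even_integral_def)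
  have sym: "A i j = A j i" for i j
  proof -
    have "M $ i $ j = transpose M $ i $ j" by (simp only: assms(2))
    also have "\<dots> = M $ j $ i" by (simp add: transpose_def)
    finally show ?thesis by (simp add: A_def)
  qed
  have diag: "even (A i i)" for i
  proof -
    obtain m :: int where "M $ i $ i = 2 * of_int m"
      using assms(1) unfolding even_integral_def by blast
    then have "real_of_int (A i i) = real_of_int (2 * m)" by (simp add: A[symmetric])
    then have "A i i = 2 * m" by (simp only: of_int_eq_iff)
    then show ?thesis by simp
  qed
  have "even (\<Sum>i\<in>S. \<Sum>j\<in>S. k $ i * A i j * k $ j)" if "finite S" for S
    using that
  proof (induction S rule: finite_induct)
    case (insert x S)
    have "(\<Sum>i\<in>insert x S. \<Sum>j\<in>insert x S. k $ i * A i j * k $ j)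
        = k $ x * A x x * k $ x + (\<Sum>j\<in>S. k $ x * A x j * k $ j)
          + ((\<Sum>i\<in>S. k $ i * A i x * k $ x) + (\<Sum>i\<in>S. \<Sum>j\<in>S. k $ i * A i j * k $ j))"
      using insert by (simp add: sum.distrib)
    also have "(\<Sum>i\<in>S. k $ i * A i x * k $ x) = (\<Sum>j\<in>S. k $ x * A x j * k $ j)"
      by (rule sum.cong) (auto simp: sym[of _ x])
    finally show ?case using insert diag[of x] by simp
  qed simp
  then have "even (\<Sum>i\<in>UNIV. \<Sum>j\<in>UNIV. k $ i * A i j * k $ j)" by simp
  then obtain m where m: "(\<Sum>i\<in>UNIV. \<Sum>j\<in>UNIV. k $ i * A i j * k $ j) = 2 * m" by blast
  have "real_vec k \<bullet> (M *v real_vec k)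
      = of_int (\<Sum>i\<in>UNIV. \<Sum>j\<in>UNIV. k $ i * A i j * k $ j)"
    by (simp add: inner_vec_def matrix_vector_mult_def real_vec_def A sum_distrib_left mult_ac)
  then show ?thesis by (simp add: m)
qed

lemma ee_add_Ints: "x \<in> \<int> \<Longrightarrow> ee (of_real (y + x)) = ee (of_real y)"
proof -
  assume "x \<in> \<int>"
  then obtain m where "x = of_int m" by (auto elim: Ints_cases)
  then have "2 * of_real pi * \<i> * of_real (y + x)
      = 2 * of_real pi * \<i> * of_real y + (2 * of_int m * of_real pi) * \<i>"
    by (simp add: algebra_simps)
  then have "ee (of_real (y + x)) = exp (2 * of_real pi * \<i> * of_real y) *
      exp ((2 * of_int m * of_real pi) * \<i>)"
    unfolding ee_def by (simp only: exp_add)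
  also have "exp ((2 * of_int m * of_real pi) * \<i>) = (1::complex)"
    using exp_integer_2pi[of "of_int m"] by (simp add: mult_ac)
  finally show ?thesis by (simp add: ee_def)
qed

lemma gauss_sum_eq_representatives:
  fixes M :: "real^'n^'n"
  assumes M: "even_integral M" "transpose M = M" and Mu: "\<And>i. (M *v u) $ i \<in> \<int>"
    and c: "c > 0" and S: "S \<subseteq> carrier (residue_group c)" and s: "\<And>V. V \<in> S \<Longrightarrow> s V \<in> V"
  shows "gauss_sum M S (of_int a / real c) u =
    (\<Sum>V\<in>S. ee (of_real (of_int a / real c *
       (1/2 * ((real_vec (s V) + u) \<bullet> (M *v (real_vec (s V) + u)))))))"
  unfolding gauss_sum_def Let_def
proof (rule sum.cong[OF refl])
  fix V assume V: "V \<in> S"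
  define v where "v = s V"
  have "(SOME v. v \<in> V) \<in> V" using s[OF V] by (metis someI)
  then obtain k where k: "(SOME v. v \<in> V) = v + int c *s k"
    using residue_class_diff S V s[OF V] unfolding v_def by blast
  define x where "x = real_vec v + u"
  define y where "y = real_vec k"
  have xy: "real_vec (SOME v. v \<in> V) + u = x + real c *\<^sub>R y"
    by (simp add: k x_def y_def real_vec_def vec_eq_iff)
  have sym: "x \<bullet> (M *v y) = y \<bullet> (M *v x)"
  proof -
    have "x \<bullet> (M *v y) = (x v* M) \<bullet> y" by (simp only: dot_lmul_matrix)
    also have "x v* M = transpose M *v x" by (simp only: transpose_matrix_vector)
    finally show ?thesis by (simp only: M(2) inner_commute)
  qed
  have Mx: "(M *v x) $ i \<in> \<int>" for i
  proof -
    have "(M *v real_vec v) $ i \<in> \<int>"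
      using M(1) by (auto simp: even_integral_def matrix_vector_mult_def real_vec_def)
    then show ?thesis using Mu[of i] by (simp add: x_def matrix_vector_right_distrib)
  qed
  have lin: "y \<bullet> (M *v x) \<in> \<int>"
    unfolding inner_vec_def using Mx by (auto simp: y_def real_vec_def)
  have quad: "1/2 * (y \<bullet> (M *v y)) \<in> \<int>"
    unfolding y_def by (rule even_integral_quadratic_even[OF M])
  have exp: "(x + real c *\<^sub>R y) \<bullet> (M *v (x + real c *\<^sub>R y))
      = x \<bullet> (M *v x) + 2 * real c * (y \<bullet> (M *v x)) + (real c)\<^sup>2 * (y \<bullet> (M *v y))"
    by (simp add: matrix_vector_right_distrib matrix_vector_mult_scaleR inner_add_left
        inner_add_right sym power2_eq_square algebra_simps)
  have "of_int a / real c * (1/2 * ((x + real c *\<^sub>R y) \<bullet> (M *v (x + real c *\<^sub>R y))))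
      = of_int a / real c * (1/2 * (x \<bullet> (M *v x)))
        + (of_int a * (y \<bullet> (M *v x)) + of_int a * real c * (1/2 * (y \<bullet> (M *v y))))"
    unfolding exp using c by (simp add: field_simps power2_eq_square)
  moreover have "of_int a * (y \<bullet> (M *v x)) + of_int a * real c * (1/2 * (y \<bullet> (M *v y))) \<in> \<int>"
    by (intro Ints_add Ints_mult lin quad Ints_of_int Ints_of_nat)
  ultimately show "ee (of_real (of_int a / real c * (1/2 *
        ((real_vec (SOME v. v \<in> V) + u) \<bullet> (M *v (real_vec (SOME v. v \<in> V) + u)))))) =
      ee (of_real (of_int a / real c * (1/2 * ((real_vec (s V) + u) \<bullet> (M *v (real_vec (s V) + u))))))"
    unfolding xy v_def[symmetric] x_def[symmetric] by (simp only: ee_add_Ints)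
qed

end

theory Submission
  imports Defs
begin

text \<open>Summing the characters \<open>e(u \<cdot> h / c)\<close> over \<open>h \<in> H\<close> and \<open>u \<in> H\<^sup>\<perp>\<close> gives Poisson summation:
  the sum of \<open>f\<close> over \<open>H\<close> is, up to normalisation, the sum over \<open>H\<^sup>\<perp>\<close> of its discrete Fourier
  transform, and \<open>|H| |H\<^sup>\<perp>| = c\<^sup>n\<close>. For the Gaussian attached to \<open>G\<close>, completing the square
  (possible because \<open>NG\<^sup>-\<^sup>1\<close> inverts \<open>G\<close> modulo \<open>c\<close> up to the unit \<open>N\<close>) turns the transform into the
  Gaussian attached to \<open>NG\<^sup>-\<^sup>1\<close> times the complete Gauss sum of \<open>aG\<close> over \<open>(Z/c)\<^sup>n\<close>.
  The complete sum is multiplicative in \<open>c\<close> and reduces to prime modulus. Modulo an odd prime the form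
  is diagonalised; modulo 2 it splits into binary blocks, kept track of modulo 8. For odd \<open>c\<close> it
  therefore depends, up to the Kronecker symbol of the determinant, on \<open>c\<close> only, and the remaining
  sum with \<open>(c + 1) / 2\<close> in place of \<open>1 / 2\<close> is evaluated with Gauss' alternating sum of
  \<open>q\<close>-binomial coefficients.\<close>

subsection \<open>Sums over residue boxes\<close>

text \<open>A phase has the form \<open>vdot v (A *v v) / (2 * c)\<close>, so congruences are wanted
  modulo \<open>2 * c\<close> although vectors live modulo \<open>c\<close>; evenness of the form
  supplies the missing factor 2. The dimension is a type, so splitting off variables cannot produce
  smaller matrices: a block keeps the full size and vanishes off an index set, its determinant is
  taken after ones are put on the remaining diagonal, and every free coordinate contributes a factor
  \<open>c\<close>. At the prime 2 the Kronecker symbol reads the determinant modulo 8 whereas the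
  form is summed modulo 2, hence the finer modulus there. An even form of odd determinant has even
  dimension, so for even \<open>c\<close> the twists arising between the odd part and the power of 2
  have trivial symbol. The sign of \<open>a\<close> acts by complex conjugation on a value whose
  only possibly non-real factor is the eighth root of unity. The shift \<open>w\<close> enters
  through the integer vector \<open>G *v w\<close> and one common phase.\<close>

definition unit_e :: "real \<Rightarrow> complex" where
  "unit_e x = ee (of_real x)"

lemma unit_e_cis: "unit_e x = cis (2 * pi * x)"
  by (simp add: unit_e_def ee_def cis_conv_exp mult_ac)

lemma unit_e_add: "unit_e (x + y) = unit_e x * unit_e y"
  by (simp add: unit_e_cis cis_mult distrib_left)

lemma unit_e_zero [simp]: "unit_e 0 = 1"
  by (simp add: unit_e_cis)

lemma unit_e_Ints: "x \<in> \<int> \<Longrightarrow> unit_e x = 1"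
  using ee_add_Ints[of x 0] by (simp add: unit_e_def ee_def)

lemma unit_e_diff_Ints: "x - y \<in> \<int> \<Longrightarrow> unit_e x = unit_e y"
  using ee_add_Ints[of "x - y" y] by (simp add: unit_e_def)

lemma unit_e_minus: "unit_e (- x) = cnj (unit_e x)"
  by (simp add: unit_e_cis cis_cnj)

lemma unit_e_of_nat_mult: "unit_e (real n * x) = unit_e x ^ n"
  by (simp only: unit_e_cis Complex.DeMoivre mult.left_commute)

lemma unit_e_sum: "finite S \<Longrightarrow> unit_e (\<Sum>i\<in>S. f i) = (\<Prod>i\<in>S. unit_e (f i))"
  by (induction S rule: finite_induct) (auto simp: unit_e_add)

lemma unit_e_eq_1_iff: "unit_e x = 1 \<longleftrightarrow> x \<in> \<int>"
proof
  assume "unit_e x = 1"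
  then have "cos (2 * pi * x) = 1" by (simp add: unit_e_cis complex_eq_iff)
  then obtain m :: int where "2 * pi * x = of_int m * 2 * pi"
    by (auto simp: cos_one_2pi_int)
  then have "x = of_int m" by simp
  then show "x \<in> \<int>" by simp
qed (rule unit_e_Ints)

lemma unit_e_cong:
  assumes "[x = y] (mod int c)"
  shows "unit_e (of_int x / real c) = unit_e (of_int y / real c)"
proof (cases "c = 0")
  case False
  obtain k where "x = y + int c * k"
    using assms by (metis cong_iff_lin cong_sym)
  then have "of_int x / real c - of_int y / real c = of_int k"
    using False by (simp add: field_simps)
  then show ?thesis
    by (intro unit_e_diff_Ints) simp
qed simp

lemma unit_e_cong_half:
  assumes "2 * int c dvd x - y"
  shows "unit_e (of_int x / (2 * real c)) = unit_e (of_int y / (2 * real c))"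
  using unit_e_cong[of x y "2 * c"] assms by (simp add: cong_iff_dvd_diff)

section \<open>Dot products of integer vectors and even forms\<close>

text \<open>Bilinear over any commutative semiring, so that integer vectors are paired and reduced
  modulo \<open>c\<close> without passing to the reals.\<close>

definition vdot :: "'a::comm_semiring_1^'n \<Rightarrow> 'a^'n \<Rightarrow> 'a" where
  "vdot u v = (\<Sum>i\<in>UNIV. u $ i * v $ i)"

lemma vdot_commute: "vdot u v = vdot v u"
  by (simp add: vdot_def mult.commute)

lemma vdot_add_left: "vdot (u + v) w = vdot u w + vdot v w"
  by (simp add: vdot_def distrib_right sum.distrib)

lemma vdot_add_right: "vdot u (v + w) = vdot u v + vdot u w"
  by (simp add: vdot_def distrib_left sum.distrib)

lemma vdot_scale_left: "vdot (k *s u) v = k * vdot u v"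
  by (simp add: vdot_def sum_distrib_left mult.assoc)

lemma vdot_scale_right: "vdot u (k *s v) = k * vdot u v"
  by (simp add: vdot_def sum_distrib_left mult_ac)

lemma vdot_minus_left: "vdot (- u) v = - vdot u (v :: 'a::comm_ring_1^'n)"
  by (simp add: vdot_def sum_negf)

lemma vdot_minus_right: "vdot u (- v) = - vdot u (v :: 'a::comm_ring_1^'n)"
  by (simp add: vdot_def sum_negf)

lemma vdot_zero [simp]: "vdot 0 v = 0" "vdot v 0 = 0"
  by (simp_all add: vdot_def)

lemma vdot_axis: "vdot (axis i x) v = x * v $ i"
proof -
  have "vdot (axis i x) v = (\<Sum>j\<in>UNIV. if j = i then x * v $ i else 0)"
    unfolding vdot_def by (rule sum.cong) (auto simp: axis_def)
  then show ?thesis by simp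
qed

lemma vdot_matrix: "vdot u (A *v v) = (\<Sum>i\<in>UNIV. \<Sum>j\<in>UNIV. A $ i $ j * u $ i * v $ j)"
  by (simp add: vdot_def matrix_vector_mult_def sum_distrib_left mult_ac)

lemma vdot_transpose: "vdot u (A *v v) = vdot (transpose A *v u) v"
  unfolding vdot_matrix vdot_commute[of _ v]
  by (subst sum.swap) (simp add: transpose_def mult_ac)

lemma matrix_scale_vector: "A *v (k *s v) = k *s (A *v (v :: 'a::comm_semiring_1^'n))"
  by (simp add: matrix_vector_mult_def vec_eq_iff sum_distrib_left mult_ac)

lemma vdot_quadratic_add:
  assumes "transpose A = A"
  shows "vdot (u + v) (A *v (u + v)) = vdot u (A *v u) + 2 * vdot v (A *v u) + vdot v (A *v v)"
  using vdot_transpose[of u A v]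
  by (simp add: assms matrix_vector_right_distrib vdot_add_left vdot_add_right
      vdot_commute[of "A *v u"] mult_2 add_ac)

text \<open>The integer counterpart of a symmetric \<open>even_integral\<close> matrix; integrality
  is carried by the type.\<close>

definition even_form :: "int^'n^'n \<Rightarrow> bool" where
  "even_form A \<longleftrightarrow> transpose A = A \<and> (\<forall>i. even (A $ i $ i))"

lemma even_formD: "even_form A \<Longrightarrow> transpose A = A" "even_form A \<Longrightarrow> even (A $ i $ i)"
  by (simp_all add: even_form_def)

lemma transpose_eq_iff: "transpose A = A \<longleftrightarrow> (\<forall>i j. A $ i $ j = A $ j $ i)"
  by (auto simp: transpose_def vec_eq_iff)

lemma even_form_sym: "even_form A \<Longrightarrow> A $ i $ j = A $ j $ i"
  by (simp add: even_form_def transpose_eq_iff)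

definition real_mat :: "int^'n^'n \<Rightarrow> real^'n^'n" where
  "real_mat A = (\<chi> i j. of_int (A $ i $ j))"

lemma inner_real_vec: "real_vec u \<bullet> real_vec v = of_int (vdot u v)"
  by (simp add: real_vec_def inner_vec_def vdot_def)

lemma real_mat_mult_vec: "real_mat A *v real_vec v = real_vec (A *v v)"
  by (simp add: real_mat_def real_vec_def matrix_vector_mult_def vec_eq_iff)

lemma even_integral_real_mat: "even_form A \<Longrightarrow> even_integral (real_mat A)"
proof -
  assume A: "even_form A"
  have "\<exists>k. real_mat A $ i $ i = 2 * of_int k" for i
  proof -
    obtain k where "A $ i $ i = 2 * k"
      using even_formD(2)[OF A] by blast
    then show ?thesis by (auto simp: real_mat_def)
  qed
  then show ?thesis by (auto simp: even_integral_def real_mat_def)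
qed

lemma transpose_real_mat: "transpose (real_mat A) = real_mat (transpose A)"
  by (simp add: real_mat_def transpose_def vec_eq_iff)

lemma even_quadratic:
  assumes "even_form A"
  shows "even (vdot v (A *v v))"
proof -
  have "1/2 * (real_vec v \<bullet> (real_mat A *v real_vec v)) \<in> \<int>"
    using assms
    by (intro even_integral_quadratic_even even_integral_real_mat)
      (simp_all add: transpose_real_mat even_formD)
  then have "of_int (vdot v (A *v v)) / 2 \<in> (\<int> :: real set)"
    by (simp add: real_mat_mult_vec inner_real_vec)
  then obtain m :: int where "of_int (vdot v (A *v v)) / 2 = (of_int m :: real)"
    by (auto elim: Ints_cases)
  then have "of_int (vdot v (A *v v)) = (of_int (2 * m) :: real)" by simp
  then have "vdot v (A *v v) = 2 * m" by (simp only: of_int_eq_iff)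
  then show ?thesis by simp
qed

section \<open>Vectors modulo c and sums over a box of representatives\<close>

definition vec_cong :: "nat \<Rightarrow> int^'n \<Rightarrow> int^'n \<Rightarrow> bool" where
  "vec_cong c u v \<longleftrightarrow> (\<forall>i. [u $ i = v $ i] (mod int c))"

definition vec_mod :: "nat \<Rightarrow> int^'n \<Rightarrow> int^'n" where
  "vec_mod c v = (\<chi> i. v $ i mod int c)"

definition residue_box :: "nat \<Rightarrow> (int^'n) set" where
  "residue_box c = {v. \<forall>i. v $ i \<in> {0..<int c}}"

definition periodic :: "nat \<Rightarrow> (int^'n \<Rightarrow> 'a) \<Rightarrow> bool" where
  "periodic c f \<longleftrightarrow> (\<forall>u v. vec_cong c u v \<longrightarrow> f u = f v)"

lemma vec_cong_refl [simp]: "vec_cong c u u"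
  by (simp add: vec_cong_def)

lemma vec_cong_sym: "vec_cong c u v \<Longrightarrow> vec_cong c v u"
  by (simp add: vec_cong_def cong_sym)

lemma vec_cong_trans [trans]: "vec_cong c u v \<Longrightarrow> vec_cong c v w \<Longrightarrow> vec_cong c u w"
  by (auto simp: vec_cong_def intro: cong_trans)

lemma vec_cong_add: "vec_cong c u v \<Longrightarrow> vec_cong c u' v' \<Longrightarrow> vec_cong c (u + u') (v + v')"
  by (simp add: vec_cong_def cong_add)

lemma vec_cong_scale: "vec_cong c u v \<Longrightarrow> vec_cong c (k *s u) (k *s v)"
  by (simp add: vec_cong_def cong_scalar_left)

lemma vec_cong_matrix: "vec_cong c u v \<Longrightarrow> vec_cong c (A *v u) (A *v v)"
  by (auto simp: vec_cong_def matrix_vector_mult_def intro!: cong_sum cong_scalar_left)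

lemma vec_cong_vdot: "vec_cong c u v \<Longrightarrow> [vdot w u = vdot w v] (mod int c)"
  by (auto simp: vec_cong_def vdot_def intro!: cong_sum cong_scalar_left)

lemma vec_cong_mod [simp]: "vec_cong c (vec_mod c v) v" "vec_cong c v (vec_mod c v)"
  by (simp_all add: vec_cong_def vec_mod_def)

lemma vec_mod_in_box [simp]: "c > 0 \<Longrightarrow> vec_mod c v \<in> residue_box c"
  by (simp add: residue_box_def vec_mod_def)

lemma vec_mod_box: "v \<in> residue_box c \<Longrightarrow> vec_mod c v = v"
  by (simp add: residue_box_def vec_mod_def vec_eq_iff)

lemma vec_mod_eq_iff: "vec_mod c u = vec_mod c v \<longleftrightarrow> vec_cong c u v"
  by (simp add: vec_mod_def vec_cong_def vec_eq_iff cong_def)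

lemma box_vec_cong_eq: "u \<in> residue_box c \<Longrightarrow> v \<in> residue_box c \<Longrightarrow> vec_cong c u v \<Longrightarrow> u = v"
  by (metis vec_mod_box vec_mod_eq_iff)

lemma vec_cong_lin:
  assumes "vec_cong c u v"
  obtains k :: "int^'n" where "u = v + int c *s (k :: int^'n)"
proof -
  have "\<exists>k. u $ i = v $ i + int c * k" for i
    using assms by (metis cong_iff_lin cong_sym vec_cong_def)
  then obtain k where k: "\<And>i. u $ i = v $ i + int c * k i" by metis
  have "u = v + int c *s (\<chi> i. k i)"
    by (simp add: vec_eq_iff k)
  then show ?thesis by (rule that)
qed

lemma bij_betw_box_PiE:
  "bij_betw (\<lambda>v i. v $ i) (residue_box c :: (int^'n) set) (PiE UNIV (\<lambda>_. {0..<int c}))"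
  by (rule bij_betwI[where g = "\<lambda>f. \<chi> i. f i"]) (auto simp: residue_box_def PiE_def)

lemma finite_box [simp]: "finite (residue_box c :: (int^'n) set)"
  using bij_betw_finite[OF bij_betw_box_PiE[of c]] by (simp add: finite_PiE)

lemma card_box: "card (residue_box c :: (int^'n) set) = c ^ CARD('n)"
  using bij_betw_same_card[OF bij_betw_box_PiE[of c]] by (simp add: card_PiE)

lemma sum_box_prod:
  fixes f :: "'n::finite \<Rightarrow> int \<Rightarrow> complex"
  shows "(\<Sum>v\<in>residue_box c. \<Prod>i\<in>UNIV. f i (v $ i)) = (\<Prod>i\<in>UNIV. \<Sum>x\<in>{0..<int c}. f i x)"
  by (subst prod_sum_PiE) (auto simp: sum.reindex_bij_betw[OF bij_betw_box_PiE, symmetric])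

lemma periodicD: "periodic c f \<Longrightarrow> vec_cong c u v \<Longrightarrow> f u = f v"
  by (simp add: periodic_def)

lemma periodic_vec_mod: "periodic c f \<Longrightarrow> f (vec_mod c v) = f v"
  by (rule periodicD) (assumption, simp)

text \<open>The maps \<open>g\<close> and \<open>h\<close> need to be inverse to each other only up
  to congruence: \<open>vec_mod\<close> carries their values back into the box, and periodicity of
  \<open>f\<close> hides the reduction.\<close>

lemma sum_box_reindex:
  fixes f :: "int^'n \<Rightarrow> complex" and g h :: "int^'n \<Rightarrow> int^'n"
  assumes c: "c > 0" and f: "periodic c f"
    and g: "\<And>u v. vec_cong c u v \<Longrightarrow> vec_cong c (g u) (g v)"
    and h: "\<And>u v. vec_cong c u v \<Longrightarrow> vec_cong c (h u) (h v)"
    and gh: "\<And>v. vec_cong c (g (h v)) v" and hg: "\<And>v. vec_cong c (h (g v)) v"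
  shows "(\<Sum>v\<in>residue_box c. f (g v)) = (\<Sum>v\<in>residue_box c. f v)"
proof (rule sum.reindex_bij_witness[of _ "\<lambda>v. vec_mod c (h v)" "\<lambda>v. vec_mod c (g v)"])
  fix v :: "int^'n" assume v: "v \<in> residue_box c"
  have "vec_cong c (h (vec_mod c (g v))) v"
    using h[OF vec_cong_mod(1)] hg by (rule vec_cong_trans)
  then show "vec_mod c (h (vec_mod c (g v))) = v"
    using v by (metis vec_mod_box vec_mod_eq_iff)
  have "vec_cong c (g (vec_mod c (h v))) v"
    using g[OF vec_cong_mod(1)] gh by (rule vec_cong_trans)
  then show "vec_mod c (g (vec_mod c (h v))) = v"
    using v by (metis vec_mod_box vec_mod_eq_iff)
qed (use c f in \<open>auto simp: periodic_vec_mod\<close>)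

lemma sum_box_translate:
  fixes f :: "int^'n \<Rightarrow> complex"
  assumes "c > 0" "periodic c f"
  shows "(\<Sum>v\<in>residue_box c. f (v + t)) = (\<Sum>v\<in>residue_box c. f v)"
  by (rule sum_box_reindex[where h = "\<lambda>v. v - t"])
    (use assms in \<open>auto simp: vec_cong_def cong_add cong_diff\<close>)

definition merge :: "'n set \<Rightarrow> 'a^'n \<Rightarrow> 'a^'n \<Rightarrow> 'a^'n" where
  "merge K u v = (\<chi> i. if i \<in> K then u $ i else v $ i)"

text \<open>Exchanging the coordinates off \<open>K\<close> between two vectors is an involution on
  pairs. It turns \<open>f u * h v\<close> into a product at one and the same vector; the other
  vector then ranges freely, which is the factor \<open>c ^ CARD('n)\<close>.\<close>

lemma sum_box_merge:
  fixes f h :: "int^'n \<Rightarrow> complex"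
  assumes f: "\<And>u v. (\<And>i. i \<in> K \<Longrightarrow> u $ i = v $ i) \<Longrightarrow> f u = f v"
    and h: "\<And>u v. (\<And>i. i \<notin> K \<Longrightarrow> u $ i = v $ i) \<Longrightarrow> h u = h v"
  shows "(\<Sum>v\<in>residue_box c. f v) * (\<Sum>v\<in>residue_box c. h v)
      = of_nat (c ^ CARD('n)) * (\<Sum>v\<in>residue_box c. f v * h v)"
proof -
  define \<phi> where "\<phi> = (\<lambda>(u, v :: int^'n). (merge K u v, merge K v u))"
  have inv: "\<phi> (\<phi> z) = z" for z
    by (auto simp: \<phi>_def merge_def vec_eq_iff split: prod.split)
  have residue_box: "\<phi> z \<in> residue_box c \<times> residue_box c" if "z \<in> residue_box c \<times> residue_box c" for z
    using that by (auto simp: \<phi>_def merge_def residue_box_def split: prod.split)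
  have "(\<Sum>v\<in>residue_box c. f v) * (\<Sum>v\<in>residue_box c. h v)
      = (\<Sum>z\<in>residue_box c \<times> residue_box c. f (fst z) * h (snd z))"
    by (simp add: sum_product sum.cartesian_product case_prod_beta)
  also have "\<dots> = (\<Sum>z\<in>residue_box c \<times> (residue_box c :: (int^'n) set). f (fst z) * h (fst z))"
  proof (rule sum.reindex_bij_witness[where i = \<phi> and j = \<phi>])
    fix z :: "(int^'n) \<times> (int^'n)"
    have "f (fst (\<phi> z)) = f (fst z)" "h (fst (\<phi> z)) = h (snd z)"
      by (auto simp: \<phi>_def merge_def split: prod.split intro!: f h)
    then show "f (fst (\<phi> z)) * h (fst (\<phi> z)) = f (fst z) * h (snd z)" by simp
  qed (simp_all only: inv residue_box)
  also have "\<dots> = (\<Sum>u\<in>residue_box c. \<Sum>v\<in>(residue_box c :: (int^'n) set). f u * h u)"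
    by (subst sum.cartesian_product) (auto intro!: sum.cong)
  finally show ?thesis by (simp add: card_box sum_distrib_left)
qed

text \<open>Expansion to base \<open>d\<close> in every coordinate. The quotient \<open>u\<close> is
  the top digit, over which the descent along prime powers sums.\<close>

lemma sum_box_mult:
  fixes f :: "int^'n \<Rightarrow> complex"
  assumes "d > 0"
  shows "(\<Sum>v\<in>residue_box (d * e). f v) = (\<Sum>v\<in>residue_box d. \<Sum>u\<in>residue_box e. f (v + int d *s u))"
proof -
  have "(\<Sum>v\<in>residue_box d. \<Sum>u\<in>residue_box e. f (v + int d *s u))
      = (\<Sum>z\<in>residue_box d \<times> residue_box e. f (fst z + int d *s snd z))"
    by (simp add: sum.cartesian_product case_prod_beta)
  also have "\<dots> = (\<Sum>v\<in>residue_box (d * e). f v)"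
  proof (rule sum.reindex_bij_witness[of _
        "\<lambda>v. (vec_mod d v, \<chi> i. v $ i div int d)" "\<lambda>z. fst z + int d *s snd z"])
    fix z :: "(int^'n) \<times> (int^'n)" assume z: "z \<in> residue_box d \<times> residue_box e"
    then have r: "0 \<le> fst z $ i" "fst z $ i < int d" "0 \<le> snd z $ i" "snd z $ i < int e" for i
      by (auto simp: residue_box_def)
    then have "(int d * snd z $ i + fst z $ i) div int d = snd z $ i"
        "(int d * snd z $ i + fst z $ i) mod int d = fst z $ i" for i
      using assms by simp_all
    then show "(vec_mod d (fst z + int d *s snd z), \<chi> i. (fst z + int d *s snd z) $ i div int d) = z"
      by (cases z) (simp add: vec_mod_def vec_eq_iff add.commute)
    have "fst z $ i + int d * snd z $ i < int d * int e" for i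
    proof -
      have "int d * (snd z $ i + 1) \<le> int d * int e"
        using r[of i] by (intro mult_left_mono) auto
      then show ?thesis using r[of i] by (simp add: algebra_simps)
    qed
    then show "fst z + int d *s snd z \<in> residue_box (d * e)"
      using r by (simp add: residue_box_def)
  next
    fix v :: "int^'n" assume v: "v \<in> residue_box (d * e)"
    show "fst (vec_mod d v, \<chi> i. v $ i div int d) + int d *s snd (vec_mod d v, \<chi> i. v $ i div int d) = v"
      by (simp add: vec_mod_def vec_eq_iff)
    have "v $ i div int d < int e" for i
    proof (rule ccontr)
      assume "\<not> v $ i div int d < int e"
      then have "int d * int e \<le> int d * (v $ i div int d)"
        by (intro mult_left_mono) auto
      also have "\<dots> \<le> v $ i"
        using assms mult_div_mod_eq[of "int d" "v $ i"] pos_mod_sign[of "int d" "v $ i"] by linarith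
      finally show False using v by (auto simp: residue_box_def not_less[symmetric])
    qed
    then show "(vec_mod d v, \<chi> i. v $ i div int d) \<in> residue_box d \<times> residue_box e"
      using v assms by (auto simp: residue_box_def vec_mod_def pos_imp_zdiv_nonneg_iff)
  qed auto
  finally show ?thesis by simp
qed

text \<open>Translation by a basis vector, in a coordinate where \<open>a\<close> is not divisible
  by \<open>c\<close>, permutes the box modulo \<open>c\<close> but multiplies the sum by a number
  different from 1.\<close>

lemma sum_box_character:
  fixes a :: "int^'n"
  assumes c: "c > 0"
  shows "(\<Sum>u\<in>residue_box c. unit_e (of_int (vdot u a) / real c)) =
    (if vec_cong c a 0 then of_nat (c ^ CARD('n)) else 0)"
proof (cases "vec_cong c a 0")
  case True
  have "unit_e (of_int (vdot u a) / real c) = 1" for u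
    using unit_e_cong[OF vec_cong_vdot[OF True]] by simp
  then show ?thesis using True by (simp add: card_box)
next
  case False
  then obtain i where i: "\<not> int c dvd a $ i"
    by (auto simp: vec_cong_def cong_0_iff)
  let ?f = "\<lambda>u. unit_e (of_int (vdot u a) / real c)"
  have per: "periodic c ?f"
    unfolding periodic_def using vec_cong_vdot unit_e_cong by (metis vdot_commute)
  have "(\<Sum>u\<in>residue_box c. ?f u) = (\<Sum>u\<in>residue_box c. ?f (u + axis i 1))"
    by (rule sum_box_translate[symmetric, OF c per])
  also have "\<dots> = (\<Sum>u\<in>residue_box c. ?f u * unit_e (of_int (a $ i) / real c))"
    by (simp add: vdot_add_left vdot_axis add_divide_distrib unit_e_add)
  also have "\<dots> = (\<Sum>u\<in>residue_box c. ?f u) * unit_e (of_int (a $ i) / real c)"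
    by (rule sum_distrib_right[symmetric])
  finally have "(\<Sum>u\<in>residue_box c. ?f u) * (1 - unit_e (of_int (a $ i) / real c)) = 0"
    by (simp add: right_diff_distrib)
  moreover have "unit_e (of_int (a $ i) / real c) \<noteq> 1"
  proof
    assume "unit_e (of_int (a $ i) / real c) = 1"
    then obtain m :: int where "of_int (a $ i) / real c = of_int m"
      by (auto simp only: unit_e_eq_1_iff elim: Ints_cases)
    then have "of_int (a $ i) = (of_int (m * int c) :: real)"
      using c by (simp add: field_simps)
    then have "a $ i = m * int c" by (simp only: of_int_eq_iff)
    then show False using i by simp
  qed
  ultimately show ?thesis using False by simp
qed

subsection \<open>The quadratic Gauss sum of odd modulus\<close>

text \<open>The one-element index type makes reindexing and orthogonality for boxes available in one
  variable.\<close>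

lemma sum_residues_eq_box:
  fixes f :: "int \<Rightarrow> complex"
  shows "(\<Sum>x\<in>{0..<int c}. f x) = (\<Sum>v\<in>(residue_box c :: (int^1) set). f (v $ 1))"
  using sum_box_prod[of "\<lambda>_::1. f" c] by (simp add: UNIV_1)

lemma sum_residues_reindex:
  fixes f :: "int \<Rightarrow> complex" and g h :: "int \<Rightarrow> int"
  assumes c: "c > 0" and f: "\<And>x y. [x = y] (mod int c) \<Longrightarrow> f x = f y"
    and g: "\<And>x y. [x = y] (mod int c) \<Longrightarrow> [g x = g y] (mod int c)"
    and h: "\<And>x y. [x = y] (mod int c) \<Longrightarrow> [h x = h y] (mod int c)"
    and gh: "\<And>x. [g (h x) = x] (mod int c)" and hg: "\<And>x. [h (g x) = x] (mod int c)"
  shows "(\<Sum>x\<in>{0..<int c}. f (g x)) = (\<Sum>x\<in>{0..<int c}. f x)"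
proof -
  let ?g = "\<lambda>v :: int^1. (\<chi> i. g (v $ i)) :: int^1"
  have "(\<Sum>v\<in>residue_box c. f (?g v $ 1)) = (\<Sum>v\<in>(residue_box c :: (int^1) set). f (v $ 1))"
    by (rule sum_box_reindex[where f = "\<lambda>v. f (v $ 1)" and g = ?g and h
        = "\<lambda>v :: int^1. (\<chi> i. h (v $ i)) :: int^1"])
      (auto simp: vec_cong_def periodic_def c intro!: f g h gh hg)
  then show ?thesis by (simp add: sum_residues_eq_box)
qed

lemma sum_residues_character:
  assumes "c > 0"
  shows "(\<Sum>x\<in>{0..<int c}. unit_e (of_int (x * a) / real c)) =
    (if int c dvd a then of_nat c else 0)"
proof -
  have "(\<Sum>x\<in>{0..<int c}. unit_e (of_int (x * a) / real c))
      = (\<Sum>v\<in>residue_box c. unit_e (of_int (vdot v (\<chi> i::1. a)) / real c))"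
    by (simp add: sum_residues_eq_box vdot_def UNIV_1)
  also have "\<dots> = (if int c dvd a then of_nat c else 0)"
    by (subst sum_box_character) (use assms in \<open>auto simp: vec_cong_def cong_0_iff\<close>)
  finally show ?thesis .
qed

section \<open>Gaussian binomial coefficients and their alternating sum\<close>

text \<open>The Gaussian binomial coefficient of \<open>m\<close> over \<open>j\<close> at
  \<open>x\<close> in product form. For \<open>m < j\<close> the factor with \<open>i = m\<close> is
  zero, so the coefficient vanishes as it should.\<close>

definition qbinom :: "complex \<Rightarrow> nat \<Rightarrow> nat \<Rightarrow> complex" where
  "qbinom x m j = (\<Prod>i<j. (1 - x ^ (m - i)) / (1 - x ^ Suc i))"

lemma qbinom_absorb:
  "qbinom x (Suc m) (Suc j) = (1 - x ^ Suc m) / (1 - x ^ Suc j) * qbinom x m j"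
proof -
  have "(\<Prod>i<Suc j. 1 - x ^ (Suc m - i)) = (1 - x ^ Suc m) * (\<Prod>i<j. 1 - x ^ (m - i))"
    by (subst prod.lessThan_Suc_shift) simp
  then show ?thesis
    unfolding qbinom_def prod_dividef by (simp add: mult_ac)
qed

lemma qbinom_Suc: "qbinom x m (Suc j) = qbinom x m j * ((1 - x ^ (m - j)) / (1 - x ^ Suc j))"
  by (simp add: qbinom_def)

lemma qbinom_eq_0: "m < j \<Longrightarrow> qbinom x m j = 0"
  unfolding qbinom_def by (rule prod_zero) (auto intro!: bexI[of _ m])

lemma qbinom_0 [simp]: "qbinom x m 0 = 1"
  by (simp add: qbinom_def)

text \<open>All three coefficients are multiples of \<open>qbinom x m j\<close>; what remains is 1 -
  x^(m+1) = (1 - x^(j+1)) + x^(j+1) (1 - x^(m-j)), divided by 1 - x^(j+1).\<close>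

lemma qbinom_pascal:
  assumes "x ^ Suc j \<noteq> 1" "j \<le> m"
  shows "qbinom x (Suc m) (Suc j) = qbinom x m j + x ^ Suc j * qbinom x m (Suc j)"
proof -
  have "x ^ Suc j * x ^ (m - j) = x ^ Suc m"
    using assms(2) by (simp add: power_add[symmetric])
  then have "1 - x ^ Suc m = (1 - x ^ Suc j) + x ^ Suc j * (1 - x ^ (m - j))"
    by (simp add: algebra_simps)
  then have "(1 - x ^ Suc m) / (1 - x ^ Suc j)
      = 1 + x ^ Suc j * ((1 - x ^ (m - j)) / (1 - x ^ Suc j))"
    using assms(1) by (simp only: add_divide_distrib times_divide_eq_right) simp
  then show ?thesis
    by (simp only: qbinom_absorb qbinom_Suc[of x m j]) (simp only: distrib_left mult_1
        mult_1_right mult_ac)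
qed

text \<open>Pascal's rule makes the sum telescope except for a factor \<open>1 - x ^ Suc j\<close>
  at each term, and absorption trades this factor for the constant \<open>1 - x ^ (m + 1)\<close>
  while lowering both indices by one.\<close>

lemma alternating_qbinom_step:
  assumes "\<And>i. 0 < i \<Longrightarrow> i \<le> m + 2 \<Longrightarrow> x ^ i \<noteq> 1"
  shows "(\<Sum>j\<le>m + 2. (- 1) ^ j * qbinom x (m + 2) j)
    = (1 - x ^ (m + 1)) * (\<Sum>j\<le>m. (- 1) ^ j * qbinom x m j)"
proof -
  let ?q = "qbinom x (m + 1)"
  have "(\<Sum>j\<le>m + 2. (- 1) ^ j * qbinom x (m + 2) j)
      = 1 - (\<Sum>j\<le>m + 1. (- 1) ^ j * qbinom x (Suc (m + 1)) (Suc j))"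
    using sum.atMost_Suc_shift[of "\<lambda>j. (- 1) ^ j * qbinom x (m + 2) j" "m + 1"]
    by (simp add: sum_negf)
  also have "(\<Sum>j\<le>m + 1. (- 1) ^ j * qbinom x (Suc (m + 1)) (Suc j))
      = (\<Sum>j\<le>m + 1. (- 1) ^ j * ?q j + (- 1) ^ j * x ^ Suc j * ?q (Suc j))"
    by (rule sum.cong[OF refl], subst qbinom_pascal) (use assms[of "Suc _"] in \<open>auto simp: distrib_left\<close>)
  also have "\<dots> = (\<Sum>j\<le>m + 1. (- 1) ^ j * ?q j)
      + (\<Sum>j\<le>m + 1. (- 1) ^ j * x ^ Suc j * ?q (Suc j))"
    by (rule sum.distrib)
  also have "(\<Sum>j\<le>m + 1. (- 1) ^ j * ?q j) = 1 - (\<Sum>j\<le>m. (- 1) ^ j * ?q (Suc j))"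
    using sum.atMost_Suc_shift[of "\<lambda>j. (- 1) ^ j * ?q j" m] by (simp add: sum_negf)
  also have "(\<Sum>j\<le>m + 1. (- 1) ^ j * x ^ Suc j * ?q (Suc j))
      = (\<Sum>j\<le>m. (- 1) ^ j * x ^ Suc j * ?q (Suc j))"
    by (simp add: qbinom_eq_0)
  also have "1 - (1 - (\<Sum>j\<le>m. (- 1) ^ j * ?q (Suc j))
        + (\<Sum>j\<le>m. (- 1) ^ j * x ^ Suc j * ?q (Suc j)))
      = (\<Sum>j\<le>m. (- 1) ^ j * ?q (Suc j) - (- 1) ^ j * x ^ Suc j * ?q (Suc j))"
    by (simp add: sum_subtractf del: power_Suc)
  also have "\<dots> = (\<Sum>j\<le>m. (1 - x ^ (m + 1)) * ((- 1) ^ j * qbinom x m j))"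
  proof (rule sum.cong[OF refl])
    fix j assume "j \<in> {..m}"
    then have "x ^ Suc j \<noteq> 1" using assms[of "Suc j"] by simp
    then have "(1 - x ^ Suc j) * ?q (Suc j) = (1 - x ^ (m + 1)) * qbinom x m j"
      using qbinom_absorb[of x m j] by simp
    then have "(- 1) ^ j * ((1 - x ^ Suc j) * ?q (Suc j))
        = (- 1) ^ j * ((1 - x ^ (m + 1)) * qbinom x m j)" by simp
    then show "(- 1) ^ j * ?q (Suc j) - (- 1) ^ j * x ^ Suc j * ?q (Suc j)
        = (1 - x ^ (m + 1)) * ((- 1) ^ j * qbinom x m j)"
      by (simp only: left_diff_distrib right_diff_distrib mult_1 mult_ac)
  qed
  finally show ?thesis by (simp only: sum_distrib_left)
qed

lemma alternating_qbinom:
  assumes "\<And>i. 0 < i \<Longrightarrow> i \<le> 2 * k \<Longrightarrow> x ^ i \<noteq> 1"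
  shows "(\<Sum>j\<le>2 * k. (- 1) ^ j * qbinom x (2 * k) j) = (\<Prod>i<k. 1 - x ^ (2 * i + 1))"
  using assms
proof (induction k)
  case (Suc k)
  have "(\<Sum>j\<le>2 * Suc k. (- 1) ^ j * qbinom x (2 * Suc k) j)
      = (1 - x ^ (2 * k + 1)) * (\<Sum>j\<le>2 * k. (- 1) ^ j * qbinom x (2 * k) j)"
    using alternating_qbinom_step[of "2 * k" x] Suc.prems by simp
  also have "(\<Sum>j\<le>2 * k. (- 1) ^ j * qbinom x (2 * k) j) = (\<Prod>i<k. 1 - x ^ (2 * i + 1))"
    using Suc.prems by (intro Suc.IH) auto
  finally show ?case by (simp only: prod.lessThan_Suc mult.commute)
qed (simp add: qbinom_def)

text \<open>Factoring out e(-t/2) leaves e(t/2) - e(-t/2), which is 2 i sin(pi t); the i is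
  \<open>unit_e (1 / 4)\<close>.\<close>

lemma one_minus_unit_e: "1 - unit_e (- t) = of_real (2 * sin (pi * t)) * unit_e (1 / 4 - t / 2)"
proof -
  have 1: "2 * pi * (1 / 4 - t / 2) = pi / 2 - pi * t"
    by (simp add: field_simps)
  have 2: "2 * pi * (- t) = - (2 * (pi * t))" by simp
  show ?thesis
    unfolding unit_e_cis 1 2
    by (simp add: complex_eq_iff cos_diff sin_diff cos_double_sin sin_double power2_eq_square
        del: mult_minus_right)
qed

text \<open>Put x = e(-1/n). Since (2k - j) + (j + 1) = n, the power x^(2k-j) is the inverse of y =
  x^(j+1), and (1 - 1/y) / (1 - y) = -1/y. Hence consecutive signed coefficients differ by the
  factor e((j+1)/n), and their alternating sum is the sum of triangular phases. On the other side
  each factor 1 - x^(2i+1) contributes a sine and a phase, and the odd numbers below 2k add up to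
  k^2.\<close>

lemma sum_unit_e_triangular:
  fixes k n :: nat
  assumes n: "n = 2 * k + 1"
  shows "(\<Sum>j\<le>2 * k. unit_e (real j * (real j + 1) / (2 * real n)))
    = of_real (\<Prod>i<k. 2 * sin (pi * (real (2 * i + 1) / real n)))
      * unit_e (real k / 4 - (real k)\<^sup>2 / (2 * real n))"
proof -
  define x where "x = unit_e (- (1 / real n))"
  have n0: "n > 0" using n by simp
  have pow: "x ^ i = unit_e (- (real i / real n))" for i
    unfolding x_def unit_e_of_nat_mult[symmetric] by simp
  have ne: "x ^ i \<noteq> 1" if "0 < i" "i \<le> 2 * k" for i
  proof
    assume "x ^ i = 1"
    then have "- (real i / real n) \<in> \<int>" by (simp only: pow unit_e_eq_1_iff)
    then have "real i / real n \<in> \<int>" by simp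
    then obtain m :: int where m: "real i / real n = of_int m" by (auto elim: Ints_cases)
    moreover have "0 < real i / real n" "real i / real n < 1"
      using that n by simp_all
    ultimately show False by simp
  qed
  have qb: "(- 1) ^ j * qbinom x (2 * k) j = unit_e (real j * (real j + 1) / (2 * real n))"
    if "j \<le> 2 * k" for j
    using that
  proof (induction j)
    case (Suc j)
    have "x ^ (2 * k - j) = unit_e ((real j + 1) / real n)"
    proof -
      have "- (real (2 * k - j) / real n) - (real j + 1) / real n = - 1"
      proof -
        have "real (2 * k - j) = real n - (real j + 1)"
          using Suc.prems n by (simp add: of_nat_diff)
        then show ?thesis using n0 by (simp only: diff_divide_distrib) simp
      qed
      then have "unit_e (- (real (2 * k - j) / real n)) = unit_e ((real j + 1) / real n)"
        by (intro unit_e_diff_Ints) simp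
      then show ?thesis by (simp only: pow)
    qed
    moreover have "x ^ Suc j * unit_e ((real j + 1) / real n) = 1"
      by (simp add: pow unit_e_add[symmetric] add.commute del: power_Suc)
    ultimately have "1 - x ^ (2 * k - j) = - unit_e ((real j + 1) / real n) * (1 - x ^ Suc j)"
      by (simp add: right_diff_distrib mult.commute[of "unit_e _"] del: power_Suc)
    then have *: "(1 - x ^ (2 * k - j)) / (1 - x ^ Suc j) = - unit_e ((real j + 1) / real n)"
      using ne[of "Suc j"] Suc.prems by (simp del: power_Suc)
    have "(- 1) ^ Suc j * qbinom x (2 * k) (Suc j)
        = ((- 1) ^ j * qbinom x (2 * k) j) * unit_e ((real j + 1) / real n)"
      by (simp only: qbinom_Suc *) simp
    also have "\<dots> = unit_e (real j * (real j + 1) / (2 * real n) + (real j + 1) / real n)"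
      using Suc by (simp add: unit_e_add)
    also have "real j * (real j + 1) / (2 * real n) + (real j + 1) / real n
        = real (Suc j) * (real (Suc j) + 1) / (2 * real n)"
      using n0 by (simp add: field_simps)
    finally show ?case .
  qed (simp add: qbinom_def)
  have sq: "(\<Sum>i<k. real (2 * i + 1)) = (real k)\<^sup>2"
    by (induction k) (simp_all add: power2_eq_square algebra_simps)
  have "(\<Sum>j\<le>2 * k. unit_e (real j * (real j + 1) / (2 * real n)))
      = (\<Sum>j\<le>2 * k. (- 1) ^ j * qbinom x (2 * k) j)"
    by (rule sum.cong) (auto simp: qb)
  also have "\<dots> = (\<Prod>i<k. 1 - x ^ (2 * i + 1))"
    by (rule alternating_qbinom) (rule ne)
  also have "\<dots> = (\<Prod>i<k. of_real (2 * sin (pi * (real (2 * i + 1) / real n)))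
        * unit_e (1 / 4 - real (2 * i + 1) / real n / 2))"
    by (simp only: pow one_minus_unit_e)
  also have "\<dots> = of_real (\<Prod>i<k. 2 * sin (pi * (real (2 * i + 1) / real n)))
        * unit_e (\<Sum>i<k. 1 / 4 - real (2 * i + 1) / real n / 2)"
    by (simp only: unit_e_sum[OF finite_lessThan] of_real_prod) (rule prod.distrib)
  also have "(\<Sum>i<k. 1 / 4 - real (2 * i + 1) / real n / 2) = real k / 4 - (real k)\<^sup>2 / (2 * real n)"
    by (simp only: sum_subtractf sum_divide_distrib[symmetric] sq) simp
  finally show ?thesis .
qed

text \<open>For odd \<open>n\<close> the number \<open>(n + 1) div 2\<close> inverts 2 modulo
  \<open>n\<close>. With this coefficient the sum belongs to the even form (n + 1) x^2, and its
  value is given by one formula for all odd \<open>n\<close> instead of depending on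
  \<open>n\<close> modulo 4.\<close>

definition half_gauss :: "nat \<Rightarrow> complex" where
  "half_gauss n = (\<Sum>x\<in>{0..<int n}. unit_e (of_int (int ((n + 1) div 2) * x\<^sup>2) / real n))"

text \<open>After the substitution x = d + y the phase is linear in \<open>y\<close> with
  coefficient 2 h d, which is \<open>d\<close> modulo \<open>n\<close>, so orthogonality leaves only
  d = 0.\<close>

lemma norm_half_gauss:
  assumes n: "odd n"
  shows "half_gauss n * cnj (half_gauss n) = of_nat n"
proof -
  define h where "h = int ((n + 1) div 2)"
  have n0: "n > 0" using n by (cases n) auto
  have h2: "2 * h = int n + 1"
    using n unfolding h_def by presburger
  let ?R = "{0..<int n}"
  let ?e = "\<lambda>z. unit_e (of_int z / real n)"
  have T: "half_gauss n = (\<Sum>x\<in>?R. ?e (h * x\<^sup>2))"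
    by (simp add: half_gauss_def h_def)
  have mul: "?e z * cnj (?e z') = ?e (z - z')" for z z'
    by (simp add: unit_e_minus[symmetric] unit_e_add[symmetric] diff_divide_distrib)
  have "half_gauss n * cnj (half_gauss n) = (\<Sum>y\<in>?R. \<Sum>x\<in>?R. ?e (h * x\<^sup>2 - h * y\<^sup>2))"
    unfolding T by (simp only: cnj_sum sum_product mul) (rule sum.swap)
  also have "\<dots> = (\<Sum>y\<in>?R. \<Sum>d\<in>?R. ?e (h * (d + y)\<^sup>2 - h * y\<^sup>2))"
  proof (rule sum.cong[OF refl])
    fix y
    show "(\<Sum>x\<in>?R. ?e (h * x\<^sup>2 - h * y\<^sup>2)) = (\<Sum>d\<in>?R. ?e (h * (d + y)\<^sup>2 - h * y\<^sup>2))"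
    proof (rule sum_residues_reindex[where h = "\<lambda>x. x - y" and g = "\<lambda>d. d + y", symmetric])
      fix a b assume "[a = b] (mod int n)"
      then show "?e (h * a\<^sup>2 - h * y\<^sup>2) = ?e (h * b\<^sup>2 - h * y\<^sup>2)"
        by (intro unit_e_cong cong_diff cong_mult cong_pow cong_refl)
    qed (use n0 in \<open>auto intro: cong_add cong_diff\<close>)
  qed
  also have "\<dots> = (\<Sum>y\<in>?R. \<Sum>d\<in>?R. ?e (h * d\<^sup>2) * ?e (y * (2 * h * d)))"
    by (simp add: unit_e_add[symmetric] add_divide_distrib[symmetric] power2_eq_square algebra_simps)
  also have "\<dots> = (\<Sum>d\<in>?R. ?e (h * d\<^sup>2) * (\<Sum>y\<in>?R. ?e (y * (2 * h * d))))"
    by (subst sum.swap) (simp only: sum_distrib_left)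
  also have "\<dots> = (\<Sum>d\<in>?R. if d = 0 then of_nat n else 0)"
  proof (rule sum.cong[OF refl])
    fix d assume d: "d \<in> ?R"
    have "int n dvd 2 * h * d \<longleftrightarrow> d = 0"
    proof
      assume "int n dvd 2 * h * d"
      then have "int n dvd int n * d + d" by (simp add: h2 distrib_right)
      then have "int n dvd d" by (metis dvd_add_right_iff dvd_triv_left)
      then show "d = 0" using d by (auto dest: zdvd_imp_le)
    qed simp
    then show "?e (h * d\<^sup>2) * (\<Sum>y\<in>?R. ?e (y * (2 * h * d))) = (if d = 0 then of_nat n else 0)"
      by (simp only: sum_residues_character[OF n0]) simp
  qed
  also have "\<dots> = of_nat n" using n0 by simp
  finally show ?thesis .
qed

text \<open>The value of the sum is known up to a positive real factor from Gauss' product formula, because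
  all sines in it are positive; the factor is then read off the absolute value.\<close>

lemma half_gauss_eq:
  assumes n: "odd n"
  shows "half_gauss n = of_real (sqrt (real n)) * unit_e ((1 - real n) / 8)"
proof -
  obtain k where k: "n = 2 * k + 1" using n by (elim oddE)
  have n0: "n > 0" using k by simp
  let ?R = "{0..<int n}"
  define P where "P = (\<Prod>i<k. 2 * sin (pi * (real (2 * i + 1) / real n)))"
  define F where "F = (\<lambda>j :: int. unit_e (of_int (j * (j + 1)) / (2 * real n)))"
  have P: "P > 0"
    unfolding P_def
  proof (rule prod_pos)
    fix i assume "i \<in> {..<k}"
    then have t: "0 < real (2 * i + 1) / real n" "real (2 * i + 1) / real n < 1"
      using k by (auto simp: field_simps)
    have "0 < sin (pi * t)" if "0 < t" "t < 1" for t
      using that by (intro sin_gt_zero) auto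
    from this[OF t] show "0 < 2 * sin (pi * (real (2 * i + 1) / real n))"
      by (rule mult_pos_pos[OF zero_less_numeral])
  qed
  \<comment> \<open>The denominator is \<open>2 * n\<close>, yet \<open>n\<close> is already a
    period because \<open>n\<close> is odd: m (n m + 1) is always even.\<close>
  have Fper: "F x = F y" if "[x = y] (mod int n)" for x y
  proof -
    obtain m where m: "x = y + int n * m"
      using \<open>[x = y] (mod int n)\<close> by (metis cong_iff_lin cong_sym)
    have "even (m * (int n * m + 1))" using n by (cases "even m") auto
    then obtain r where r: "m * (int n * m + 1) = 2 * r" by blast
    have "x * (x + 1) - y * (y + 1) = int n * (2 * y * m + m * (int n * m + 1))"
      by (simp add: m algebra_simps)
    also have "\<dots> = 2 * int n * (y * m + r)" unfolding r by (simp add: algebra_simps)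
    finally have "2 * int n dvd x * (x + 1) - y * (y + 1)" by simp
    then show ?thesis unfolding F_def by (rule unit_e_cong_half)
  qed
  \<comment> \<open>As n = 2k + 1, translation by \<open>k\<close> gives (x + k)(x + k + 1) = x^2 +
    n x + k (k + 1). Since \<open>x\<close> and x^2 have the same parity, n x may be replaced by n
    x^2 modulo 2n, and x^2 + n x^2 is the phase of \<open>half_gauss\<close>.\<close>
  have shift: "F (x + int k)
      = unit_e (of_int (int ((n + 1) div 2) * x\<^sup>2) / real n) * unit_e (real k * (real k + 1) / (2
          * real n))" for x
  proof -
    have "even (x - x\<^sup>2)" by simp
    then obtain m where "x - x\<^sup>2 = 2 * m" by blast
    then have "x = x\<^sup>2 + 2 * m" by simp
    then have m: "real_of_int x = (of_int x)\<^sup>2 + 2 * of_int m"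
      by (metis of_int_add of_int_mult of_int_numeral of_int_power)
    have nn: "real n = 2 * real k + 1" using k by simp
    have "(of_int x + real k) * (of_int x + real k + 1)
        = (of_int x)\<^sup>2 + real n * of_int x + real k * (real k + 1)"
      unfolding nn by (simp add: power2_eq_square algebra_simps)
    also have "\<dots> = (of_int x)\<^sup>2 + real n * ((of_int x)\<^sup>2 + 2 * of_int m) + real k * (real k + 1)"
      by (simp only: m[symmetric])
    finally have A: "of_int ((x + int k) * (x + int k + 1))
        = (of_int x)\<^sup>2 + real n * ((of_int x)\<^sup>2 + 2 * of_int m) + real k * (real k + 1)"
      by simp
    have B: "of_int (int ((n + 1) div 2) * x\<^sup>2) = (real n + 1) / 2 * (of_int x)\<^sup>2"
      using k by simp
    have "of_int ((x + int k) * (x + int k + 1)) / (2 * real n)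
        - (of_int (int ((n + 1) div 2) * x\<^sup>2) / real n + real k * (real k + 1) / (2 * real n))
            = of_int m"
      unfolding A B using n0 by (simp add: divide_simps) (simp add: algebra_simps)
    then show ?thesis
      unfolding F_def unit_e_add[symmetric] by (intro unit_e_diff_Ints) simp
  qed
  have "half_gauss n * unit_e (real k * (real k + 1) / (2 * real n)) = (\<Sum>x\<in>?R. F (x + int k))"
    by (simp add: shift half_gauss_def sum_distrib_right)
  also have "\<dots> = (\<Sum>x\<in>?R. F x)"
    by (rule sum_residues_reindex[where h = "\<lambda>x. x - int k"])
      (auto intro!: n0 Fper cong_add cong_diff simp: cong_refl)
  also have "\<dots> = (\<Sum>j\<le>2 * k. unit_e (real j * (real j + 1) / (2 * real n)))"
    by (rule sum.reindex_bij_witness[of _ int nat]) (auto simp: F_def k)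
  also have "\<dots> = of_real P * unit_e (real k / 4 - (real k)\<^sup>2 / (2 * real n))"
    unfolding P_def by (rule sum_unit_e_triangular[OF k])
  finally have "half_gauss n * unit_e (real k * (real k + 1) / (2 * real n))
        * unit_e (- (real k * (real k + 1) / (2 * real n)))
      = of_real P * unit_e (real k / 4 - (real k)\<^sup>2 / (2 * real n))
        * unit_e (- (real k * (real k + 1) / (2 * real n)))" by simp
  then have "half_gauss n = of_real P * unit_e (real k / 4 - (real k)\<^sup>2 / (2 * real n)
        + - (real k * (real k + 1) / (2 * real n)))"
    by (simp add: mult.assoc unit_e_add[symmetric])
  \<comment> \<open>The two terms with denominator 2n add up to k (2k + 1) / (2n) = k/2, leaving
    -k/4.\<close>
  also have "real k / 4 - (real k)\<^sup>2 / (2 * real n) + - (real k * (real k + 1) / (2 * real n))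
      = (1 - real n) / 8"
    by (simp add: k divide_simps) (simp add: power2_eq_square algebra_simps)
  finally have eq: "half_gauss n = of_real P * unit_e ((1 - real n) / 8)" .
  have "complex_of_real (P\<^sup>2) = of_real (real n)"
    using norm_half_gauss[OF n] unfolding eq
    by (simp add: unit_e_cis cis_cnj cis_mult power2_eq_square mult_ac)
  then have "P\<^sup>2 = real n" by (simp only: of_real_eq_iff)
  then have "P = sqrt (real n)" using P by (simp add: real_sqrt_unique)
  then show ?thesis using eq by simp
qed

subsection \<open>Kronecker symbols\<close>

lemma Legendre_cong: "[a = b] (mod p) \<Longrightarrow> Legendre a p = Legendre b p"
  by (simp add: Legendre_def QuadRes_def cong_def)

text \<open>Euler's criterion gives the equation modulo \<open>p\<close>; the two sides differ by at
  most 2 in absolute value, which is less than \<open>p\<close>.\<close>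

lemma Legendre_mult:
  fixes p :: nat
  assumes "prime p" "p > 2"
  shows "Legendre (a * b) (int p) = Legendre a (int p) * Legendre b (int p)"
proof -
  have "[Legendre (a * b) (int p) = (a * b) ^ ((p - 1) div 2)] (mod int p)"
    by (rule euler_criterion[OF assms])
  also have "(a * b) ^ ((p - 1) div 2) = a ^ ((p - 1) div 2) * b ^ ((p - 1) div 2)"
    by (rule power_mult_distrib)
  also have "[\<dots> = Legendre a (int p) * Legendre b (int p)] (mod int p)"
    by (intro cong_mult cong_sym[OF euler_criterion] assms)
  finally have *: "int p dvd Legendre (a * b) (int p) - Legendre a (int p) * Legendre b (int p)"
    by (simp add: cong_iff_dvd_diff)
  have "\<bar>Legendre (a * b) (int p) - Legendre a (int p) * Legendre b (int p)\<bar> \<le> 2"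
    by (auto simp: Legendre_def)
  then have "\<bar>Legendre (a * b) (int p) - Legendre a (int p) * Legendre b (int p)\<bar> < int p"
    using assms(2) by linarith
  then have "Legendre (a * b) (int p) - Legendre a (int p) * Legendre b (int p) = 0"
    using dvd_imp_le_int[OF _ *] by (simp only: abs_of_nat) linarith
  then show ?thesis by simp
qed

lemma Legendre_eq_0_iff: "Legendre a (int p) = 0 \<longleftrightarrow> int p dvd a"
  by (simp add: Legendre_def cong_0_iff)

lemma Legendre_square:
  assumes "\<not> int p dvd a"
  shows "Legendre a (int p) * Legendre a (int p) = 1"
  using assms by (auto simp: Legendre_def cong_0_iff)

text \<open>The counts 1, 0 and 2 match the values 0, -1 and 1. For a nonzero square the roots are
  \<open>y\<close> and \<open>p - y\<close>, which differ because \<open>p\<close> is odd.\<close>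

lemma card_square_roots:
  fixes p :: nat
  assumes p: "prime p" "p > 2"
  shows "int (card {x\<in>{0..<int p}. [x\<^sup>2 = t] (mod int p)}) = 1 + Legendre t (int p)"
proof -
  have pp: "prime (int p)" using p by simp
  let ?S = "{x\<in>{0..<int p}. [x\<^sup>2 = t] (mod int p)}"
  consider "int p dvd t" | "\<not> int p dvd t" "\<not> QuadRes (int p) t" | "\<not> int p dvd t" "QuadRes (int p) t"
    by blast
  then show ?thesis
  proof cases
    case 1
    have "?S = {0}"
    proof (intro equalityI subsetI)
      fix x assume x: "x \<in> ?S"
      then have "int p dvd x\<^sup>2" using 1 by (auto simp: cong_dvd_iff)
      then have "int p dvd x" using pp by (simp add: prime_dvd_power_iff)
      then show "x \<in> {0}" using x by (auto dest: zdvd_imp_le)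
    next
      have "[0 = t] (mod int p)" using 1 by (simp add: cong_sym_eq[of 0] cong_0_iff)
      then show "x \<in> ?S" if "x \<in> {0}" for x using that p by simp
    qed
    then show ?thesis using 1 by (simp add: Legendre_eq_0_iff)
  next
    case 2
    then have "?S = {}" by (auto simp: QuadRes_def)
    then have "card ?S = 0" by (simp only: card.empty)
    then show ?thesis using 2 by (simp add: Legendre_def cong_0_iff)
  next
    case 3
    then obtain y0 where y0: "[y0\<^sup>2 = t] (mod int p)" by (auto simp: QuadRes_def)
    define y where "y = y0 mod int p"
    have y: "[y\<^sup>2 = t] (mod int p)" "y \<in> {0..<int p}"
      using y0 p by (auto simp: y_def cong_def power_mod)
    have y_nz: "y \<noteq> 0" using y 3 by (auto simp: cong_def dvd_eq_mod_eq_0)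
    have "?S = {y, int p - y}"
    proof (intro equalityI subsetI)
      fix x assume x: "x \<in> ?S"
      then have "[x\<^sup>2 = t] (mod int p)" by simp
      then have "[x\<^sup>2 = y\<^sup>2] (mod int p)" by (rule cong_trans[OF _ cong_sym[OF y(1)]])
      then have "int p dvd (x - y) * (x + y)"
        by (simp add: cong_iff_dvd_diff power2_eq_square algebra_simps)
      then have "int p dvd x - y \<or> int p dvd x + y" using pp by (simp add: prime_dvd_mult_iff)
      then show "x \<in> {y, int p - y}"
      proof
        assume "int p dvd x - y"
        then have "[x = y] (mod int p)" by (simp add: cong_iff_dvd_diff)
        then have "x = y" using x y by (intro cong_less_imp_eq_int[of x "int p" y]) auto
        then show ?thesis by simp
      next
        assume "int p dvd x + y"
        then have "int p dvd x + y - int p" by (rule dvd_diff) simp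
        then have "[x = int p - y] (mod int p)" by (simp add: cong_iff_dvd_diff algebra_simps)
        then have "x = int p - y"
          using x y y_nz by (intro cong_less_imp_eq_int[of x "int p" "int p - y"]) auto
        then show ?thesis by simp
      qed
    next
      fix x assume "x \<in> {y, int p - y}"
      moreover have "[(int p - y)\<^sup>2 = y\<^sup>2] (mod int p)"
        by (simp add: cong_iff_dvd_diff power2_eq_square algebra_simps)
      ultimately show "x \<in> ?S" using y(2) y_nz y(1) cong_trans[OF _ y(1)] by auto
    qed
    moreover have "y \<noteq> int p - y"
    proof
      assume "y = int p - y"
      then have "int p = 2 * y" by simp
      then have "even (int p)" by simp
      then show False using p prime_odd_nat[of p] by simp
    qed
    ultimately have "card ?S = 2" by simp
    then show ?thesis using 3 by (simp add: Legendre_def cong_0_iff)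
  qed
qed

text \<open>Grouping by the value \<open>t\<close> of x^2 weights e(t d / p) with the number 1 +
  (t/p) of square roots. The constant part cancels by orthogonality, so both sums become character
  sums with weight (t/p), and replacing \<open>t\<close> by \<open>t\<close> times the inverse of
  \<open>b\<close> pulls out the symbol of \<open>b\<close>.\<close>

lemma quadratic_gauss_sum_twist:
  fixes p :: nat
  assumes p: "prime p" "p > 2" and b: "\<not> int p dvd b"
  shows "(\<Sum>x\<in>{0..<int p}. unit_e (of_int (b * x\<^sup>2) / real p)) =
    of_int (Legendre b (int p)) * (\<Sum>x\<in>{0..<int p}. unit_e (of_int (x\<^sup>2) / real p))"
proof -
  let ?R = "{0..<int p}"
  let ?e = "\<lambda>z. unit_e (of_int z / real p)"
  let ?L = "\<lambda>t. complex_of_int (Legendre t (int p))"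
  have p0: "p > 0" using p by simp
  have squares: "(\<Sum>x\<in>?R. ?e (d * x\<^sup>2)) = (\<Sum>t\<in>?R. ?L t * ?e (t * d))" if d: "\<not> int p dvd d" for d
  proof -
    have "(\<Sum>x\<in>?R. ?e (d * x\<^sup>2))
        = (\<Sum>t\<in>?R. \<Sum>x\<in>{x\<in>?R. x\<^sup>2 mod int p = t}. ?e (d * x\<^sup>2))"
      by (rule sum.group[symmetric]) (use p0 in auto)
    also have "\<dots> = (\<Sum>t\<in>?R. of_int (1 + Legendre t (int p)) * ?e (t * d))"
    proof (rule sum.cong[OF refl])
      fix t assume t: "t \<in> ?R"
      have eq: "{x\<in>?R. x\<^sup>2 mod int p = t} = {x\<in>?R. [x\<^sup>2 = t] (mod int p)}"
        using t by (auto simp: cong_def)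
      have "(\<Sum>x\<in>{x\<in>?R. x\<^sup>2 mod int p = t}. ?e (d * x\<^sup>2))
          = (\<Sum>x\<in>{x\<in>?R. x\<^sup>2 mod int p = t}. ?e (t * d))"
      proof (rule sum.cong[OF refl])
        fix x assume "x \<in> {x\<in>?R. x\<^sup>2 mod int p = t}"
        then have "[d * x\<^sup>2 = t * d] (mod int p)"
          using eq by (metis (no_types, lifting) cong_scalar_left mem_Collect_eq mult.commute)
        then show "?e (d * x\<^sup>2) = ?e (t * d)" by (rule unit_e_cong)
      qed
      also have "\<dots> = of_int (int (card {x\<in>?R. [x\<^sup>2 = t] (mod int p)})) * ?e (t * d)"
        unfolding eq by simp
      finally show "(\<Sum>x\<in>{x\<in>?R. x\<^sup>2 mod int p = t}. ?e (d * x\<^sup>2))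
          = of_int (1 + Legendre t (int p)) * ?e (t * d)"
        unfolding card_square_roots[OF p] .
    qed
    also have "\<dots> = (\<Sum>t\<in>?R. ?e (t * d)) + (\<Sum>t\<in>?R. ?L t * ?e (t * d))"
      by (simp add: distrib_right sum.distrib)
    also have "(\<Sum>t\<in>?R. ?e (t * d)) = 0"
      by (subst sum_residues_character[OF p0]) (use d in simp)
    finally show ?thesis by simp
  qed
  have "coprime b (int p)"
    using p b by (metis coprime_commute prime_imp_coprime prime_nat_int_transfer)
  then obtain b' where b': "[b * b' = 1] (mod int p)"
    using cong_solve_coprime_int by blast
  have L1: "Legendre b (int p) * Legendre b' (int p) = 1"
  proof -
    have "Legendre b (int p) * Legendre b' (int p) = Legendre 1 (int p)"
      using Legendre_cong[OF b'] Legendre_mult[OF p] by simp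
    also have "\<dots> = 1"
      using p by (auto simp: Legendre_def QuadRes_def cong_def intro: exI[of _ 1])
    finally show ?thesis .
  qed
  then have Lb': "Legendre b' (int p) = Legendre b (int p)"
    using Legendre_square[OF b] by (metis mult.commute mult.left_neutral mult.assoc)
  have "(\<Sum>x\<in>?R. ?e (b * x\<^sup>2)) = (\<Sum>t\<in>?R. ?L t * ?e (t * b))"
    by (rule squares[OF b])
  also have "\<dots> = (\<Sum>t\<in>?R. ?L (b' * t) * ?e (b' * t * b))"
  proof (rule sum_residues_reindex[OF p0, where h = "\<lambda>t. b * t", symmetric])
    fix x y assume xy: "[x = y] (mod int p)"
    then show "?L x * ?e (x * b) = ?L y * ?e (y * b)"
      using Legendre_cong unit_e_cong[OF cong_scalar_right[OF xy]] by metis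
  next
    fix x show "[b' * (b * x) = x] (mod int p)" "[b * (b' * x) = x] (mod int p)"
      using cong_scalar_right[OF b', of x] by (simp_all add: mult_ac)
  qed (auto intro: cong_scalar_left)
  also have "\<dots> = (\<Sum>t\<in>?R. ?L b * (?L t * ?e (t * 1)))"
  proof (rule sum.cong[OF refl])
    fix t
    have "?e (b' * t * b) = ?e (t * 1)"
      using cong_scalar_left[OF b', of t] by (intro unit_e_cong) (simp add: mult_ac)
    then show "?L (b' * t) * ?e (b' * t * b) = ?L b * (?L t * ?e (t * 1))"
      by (simp add: Legendre_mult[OF p] Lb')
  qed
  also have "\<dots> = ?L b * (\<Sum>x\<in>?R. ?e (1 * x\<^sup>2))"
    using p by (subst squares) (auto simp: sum_distrib_left)
  finally show ?thesis by simp
qed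

lemma kronecker_prime_2_mod: "kronecker_prime a 2 = kronecker_prime (a mod 8) 2"
proof -
  have "even (a mod 8) = even a" by presburger
  then show ?thesis by (simp add: kronecker_prime_def)
qed

lemma kronecker_prime_2_cong: "[a = b] (mod 8) \<Longrightarrow> kronecker_prime a 2 = kronecker_prime b 2"
  by (subst (1 2) kronecker_prime_2_mod) (simp add: cong_def)

text \<open>At 2 the symbol depends on its argument modulo 8 only, which leaves a check of 64 pairs
  of residues.\<close>

lemma kronecker_prime_mult:
  assumes "prime (p :: nat)"
  shows "kronecker_prime (a * b) (int p) = kronecker_prime a (int p) * kronecker_prime b (int p)"
proof (cases "p = 2")
  case True
  have cases: "x mod 8 \<in> {0, 1, 2, 3, 4, 5, 6, 7}" for x :: int
  proof -
    have "x mod 8 \<in> {0..7}" by auto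
    also have "{0..7} = {0, 1, 2, 3, 4, 5, 6, 7 :: int}" by auto
    finally show ?thesis .
  qed
  have "kronecker_prime (r * s) 2 = kronecker_prime r 2 * kronecker_prime s 2"
    if "r \<in> {0, 1, 2, 3, 4, 5, 6, 7}" "s \<in> {0, 1, 2, 3, 4, 5, 6, 7}" for r s
    using that by (elim insertE emptyE; hypsubst; simp add: kronecker_prime_def)
  from this[OF cases[of a] cases[of b]]
  show ?thesis
    using True kronecker_prime_2_mod[of a] kronecker_prime_2_mod[of b] kronecker_prime_2_mod[of "a * b"]
      kronecker_prime_2_mod[of "a mod 8 * (b mod 8)"] by (simp add: mod_mult_eq)
next
  case False
  then show ?thesis
    using assms Legendre_mult[of p] prime_ge_2_nat[of p] by (simp add: kronecker_prime_def)
qed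

lemma kronecker_prime_nz:
  assumes "prime (p :: nat)" "coprime a (int p)"
  shows "kronecker_prime a (int p) * kronecker_prime a (int p) = 1"
proof -
  have "\<not> int p dvd a"
    using assms by (metis coprime_absorb_left coprime_commute not_prime_unit prime_nat_int_transfer)
  then show ?thesis
    using Legendre_square[of p a] by (auto simp: kronecker_prime_def)
qed

text \<open>For a positive modulus the unit factor is 1, and the primes can be taken among the
  natural numbers, where the modulus lives.\<close>

lemma kronecker_eq_prod:
  assumes "c > 0"
  shows "kronecker a (int c) = (\<Prod>p\<in>prime_factors c. kronecker_prime a (int p) ^ multiplicity p c)"
proof -
  have "prime_factors (int c) = int ` prime_factors c"
  proof (intro equalityI subsetI)
    fix q assume q: "q \<in> prime_factors (int c)"
    then obtain p where "q = int p"
      by (metis in_prime_factors_iff nonneg_int_cases prime_ge_0_int)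
    then show "q \<in> int ` prime_factors c"
      using q assms by (auto simp: in_prime_factors_iff)
  qed (use assms in \<open>auto simp: in_prime_factors_iff\<close>)
  moreover have "multiplicity (int p) (int c) = multiplicity p c" for p
  proof -
    have "int p ^ n dvd int c \<longleftrightarrow> p ^ n dvd c" for n
      by (metis int_dvd_int_iff of_nat_power)
    then show ?thesis by (simp add: multiplicity_def)
  qed
  ultimately show ?thesis
    using assms by (simp add: kronecker_def prod.reindex)
qed

lemma kronecker_1 [simp]: "kronecker a 1 = 1"
  by (simp add: kronecker_def)

lemma kronecker_prime_power:
  assumes "prime p"
  shows "kronecker a (int (p ^ k)) = kronecker_prime a (int p) ^ k"
proof (cases "k = 0")
  case False
  then show ?thesis
    using assms by (subst kronecker_eq_prod)
      (auto simp: prime_gt_0_nat prime_factors_power prime_prime_factors multiplicity_same_power)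
qed simp

lemma kronecker_mult_right:
  assumes "c > 0" "d > 0" "coprime c d"
  shows "kronecker a (int (c * d)) = kronecker a (int c) * kronecker a (int d)"
proof -
  let ?f = "\<lambda>m p. kronecker_prime a (int p) ^ multiplicity p m"
  have disj: "prime_factors c \<inter> prime_factors d = {}"
    using assms(3) by (auto simp: in_prime_factors_iff dest: coprime_common_divisor)
  have "kronecker a (int (c * d)) = (\<Prod>p\<in>prime_factors c \<union> prime_factors d. ?f (c * d) p)"
    using assms by (subst kronecker_eq_prod) (auto simp: prime_factors_product)
  also have "\<dots> = (\<Prod>p\<in>prime_factors c \<union> prime_factors d. ?f c p * ?f d p)"
    using assms
    by (intro prod.cong refl) (auto simp: prime_elem_multiplicity_mult_distrib
        in_prime_factors_iff power_add)
  also have "\<dots> = (\<Prod>p\<in>prime_factors c \<union> prime_factors d. ?f c p) * (\<Prod>p\<in>prime_factors c \<union>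
      prime_factors d. ?f d p)"
    by (rule prod.distrib)
  also have "(\<Prod>p\<in>prime_factors c \<union> prime_factors d. ?f c p) = (\<Prod>p\<in>prime_factors c. ?f c p)"
    by (rule prod.mono_neutral_right) (auto simp: in_prime_factors_iff not_dvd_imp_multiplicity_0 assms)
  also have "(\<Prod>p\<in>prime_factors c \<union> prime_factors d. ?f d p) = (\<Prod>p\<in>prime_factors d. ?f d p)"
    by (rule prod.mono_neutral_right) (auto simp: in_prime_factors_iff not_dvd_imp_multiplicity_0 assms)
  finally show ?thesis using assms by (simp only: kronecker_eq_prod)
qed

lemma kronecker_mult_left:
  assumes "c > 0"
  shows "kronecker (a * b) (int c) = kronecker a (int c) * kronecker b (int c)"
  using assms
  by (simp add: kronecker_eq_prod kronecker_prime_mult in_prime_factors_iff power_mult_distrib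
      prod.distrib[symmetric])

lemma kronecker_one_left: "c > 0 \<Longrightarrow> kronecker 1 (int c) = 1"
proof -
  have "Legendre 1 (int p) = 1" if "prime p" for p
    using that by (auto simp: Legendre_def QuadRes_def cong_def intro: exI[of _ 1] dest: prime_gt_1_nat)
  then show ?thesis if "c > 0"
    using that by (auto simp: kronecker_eq_prod kronecker_prime_def in_prime_factors_iff intro!:
        prod.neutral)
qed

lemma kronecker_power_left:
  assumes "c > 0"
  shows "kronecker (a ^ n) (int c) = kronecker a (int c) ^ n"
  using assms by (induction n) (simp_all add: kronecker_one_left kronecker_mult_left)

lemma kronecker_square:
  assumes "c > 0" "coprime a (int c)"
  shows "kronecker a (int c) * kronecker a (int c) = 1"
proof -
  have "kronecker_prime a (int p) * kronecker_prime a (int p) = 1" if "p \<in> prime_factors c" for p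
    using that assms
    by (intro kronecker_prime_nz) (auto simp: in_prime_factors_iff intro: coprime_divisors[OF dvd_refl])
  then show ?thesis
    using assms by (simp add: kronecker_eq_prod prod.distrib[symmetric] power_mult_distrib[symmetric])
qed

subsection \<open>Gauss sums of even forms\<close>

text \<open>The Gauss sum of \<open>A\<close> at \<open>1 / c\<close> with zero shift over the whole
  group. The sum at \<open>a / c\<close> is that of \<open>smat a A\<close>.\<close>

definition form_sum :: "int^'n^'n \<Rightarrow> nat \<Rightarrow> complex" where
  "form_sum A c = (\<Sum>v\<in>residue_box c. unit_e (of_int (vdot v (A *v v)) / (2 * real c)))"

definition smat :: "int \<Rightarrow> int^'n^'n \<Rightarrow> int^'n^'n" where
  "smat k A = (\<chi> i j. k * A $ i $ j)"

definition mat_cong :: "int \<Rightarrow> int^'n^'n \<Rightarrow> int^'n^'n \<Rightarrow> bool" where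
  "mat_cong m A B \<longleftrightarrow> (\<forall>i j. [A $ i $ j = B $ i $ j] (mod m))"

lemma smat_mult_vec: "smat k A *v v = k *s (A *v v)"
  by (simp add: smat_def matrix_vector_mult_def vec_eq_iff sum_distrib_left mult.assoc)

lemma smat_mult_left: "smat k A ** B = smat k (A ** B)"
  by (simp add: smat_def matrix_matrix_mult_def vec_eq_iff sum_distrib_left mult.assoc)

lemma smat_one_mult_vec: "smat k (mat 1) *v v = k *s v"
  by (simp add: smat_mult_vec)

lemma det_smat: "det (smat k (A :: int^'n^'n)) = k ^ CARD('n) * det A"
proof -
  have "smat k A = (\<chi> i. k *s A $ i)"
    by (simp add: smat_def vec_eq_iff)
  then show ?thesis
    using det_rows_mul[of "\<lambda>_. k" "\<lambda>i. A $ i"] by simp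
qed

lemma even_form_smat: "even_form A \<Longrightarrow> even_form (smat k A)"
  by (simp add: even_form_def transpose_eq_iff smat_def)

lemma mat_cong_det:
  assumes "mat_cong m A B"
  shows "[det A = det B] (mod m)"
  unfolding det_def
  by (intro cong_sum cong_mult cong_refl cong_prod) (use assms in \<open>auto simp: mat_cong_def\<close>)

lemma det_real_mat: "det (real_mat A) = of_int (det A)"
  by (simp add: det_def real_mat_def)

text \<open>\<open>B\<close> is the adjugate, with entries given by Cramer's rule: a column of
  \<open>A\<close> is replaced by a basis vector, so the entries are integers. Over the reals
  \<open>B\<close> divided by the determinant is a right inverse, hence a two-sided one, and both
  identities come back along the embedding of the integers.\<close>

lemma int_adjugate:
  fixes A :: "int^'n^'n"
  assumes D: "det A \<noteq> 0"
  obtains B :: "int^'n^'n" where "A ** B = smat (det A) (mat 1)" "B ** A = smat (det A) (mat 1)"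
proof -
  define B :: "int^'n^'n" where
    "B = (\<chi> k j. det (\<chi> i l. if l = k then (axis j 1 :: int^'n) $ i else A $ i $ l))"
  define d where "d = real_of_int (det A)"
  have d: "d \<noteq> 0" "det (real_mat A) = d" using D by (simp_all add: d_def det_real_mat)
  have real_axis: "real_of_int ((axis j 1 :: int^'n) $ i) = (axis j 1 :: real^'n) $ i" for i j
    by (simp add: axis_def)
  have "real_mat A *v (\<chi> k. of_int (B $ k $ j) / d) = axis j 1" for j
  proof -
    have "of_int (B $ k $ j) = det (\<chi> i l. if l
        = k then (axis j 1 :: real^'n) $ i else real_mat A $ i $ l)" for k
    proof -
      have "real_mat (\<chi> i l. if l = k then (axis j 1 :: int^'n) $ i else A $ i $ l)
          = (\<chi> i l. if l = k then (axis j 1 :: real^'n) $ i else real_mat A $ i $ l)"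
        by (simp add: real_mat_def vec_eq_iff real_axis)
      then show ?thesis by (simp add: B_def det_real_mat[symmetric])
    qed
    then show ?thesis
      using cramer[of "real_mat A"] d by simp
  qed
  then have AB: "real_mat A ** (\<chi> k j. of_int (B $ k $ j) / d) = mat 1"
    by (simp add: vec_eq_iff matrix_matrix_mult_def matrix_vector_mult_def mat_def axis_def)
  then have BA: "(\<chi> k j. of_int (B $ k $ j) / d) ** real_mat A = mat 1"
    by (simp add: matrix_left_right_inverse)
  have "A ** B = smat (det A) (mat 1)"
  proof -
    have "real_of_int ((A ** B) $ i $ j) = real_of_int (smat (det A) (mat 1) $ i $ j)" for i j
    proof -
      have "(\<Sum>k\<in>UNIV. of_int (A $ i $ k) * (of_int (B $ k $ j) / d)) = (mat 1 :: real^'n^'n) $ i $ j"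
        using AB[unfolded vec_eq_iff, rule_format, of i j]
        by (simp add: matrix_matrix_mult_def real_mat_def)
      then have "(\<Sum>k\<in>UNIV. of_int (A $ i $ k) * of_int (B $ k $ j)) = d * (mat 1 :: real^'n^'n) $ i $ j"
        using d(1) by (simp add: sum_divide_distrib[symmetric] field_simps)
      then show ?thesis
        by (simp add: matrix_matrix_mult_def smat_def d_def mat_def)
    qed
    then show ?thesis unfolding vec_eq_iff of_int_eq_iff by blast
  qed
  moreover have "B ** A = smat (det A) (mat 1)"
  proof -
    have "real_of_int ((B ** A) $ i $ j) = real_of_int (smat (det A) (mat 1) $ i $ j)" for i j
    proof -
      have "(\<Sum>k\<in>UNIV. of_int (B $ i $ k) / d * of_int (A $ k $ j)) = (mat 1 :: real^'n^'n) $ i $ j"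
        using BA[unfolded vec_eq_iff, rule_format, of i j]
        by (simp add: matrix_matrix_mult_def real_mat_def)
      then have "(\<Sum>k\<in>UNIV. of_int (B $ i $ k) * of_int (A $ k $ j)) = d * (mat 1 :: real^'n^'n) $ i $ j"
        using d(1) by (simp add: sum_divide_distrib[symmetric] field_simps)
      then show ?thesis
        by (simp add: matrix_matrix_mult_def smat_def d_def mat_def)
    qed
    then show ?thesis unfolding vec_eq_iff of_int_eq_iff by blast
  qed
  ultimately show ?thesis by (rule that)
qed

text \<open>Applying the adjugate turns \<open>A *v v\<close> into \<open>det A\<close> times
  \<open>v\<close>, and \<open>det A\<close> is a unit modulo \<open>c\<close>. The condition
  \<open>c > 1\<close> excludes a zero determinant.\<close>

lemma kernel_mod:
  fixes A :: "int^'n^'n"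
  assumes cop: "coprime (det A) (int c)" and c: "c > 1" and v: "vec_cong c (A *v v) 0"
  shows "vec_cong c v 0"
proof -
  have "det A \<noteq> 0" using cop c by auto
  then obtain B where B: "B ** A = smat (det A) (mat 1)" by (rule int_adjugate)
  have "vec_cong c (B *v (A *v v)) 0"
    using vec_cong_matrix[OF v, of B] by simp
  then have "vec_cong c (det A *s v) 0"
    by (simp add: matrix_vector_mul_assoc B smat_one_mult_vec)
  then show ?thesis
    using cop by (simp add: vec_cong_def cong_0_iff coprime_commute coprime_dvd_mult_right_iff)
qed

text \<open>Under v + c k the cross term changes by a multiple of 2c, and c^2 times the value at
  \<open>k\<close> is divisible by 2c because that value is even.\<close>

lemma periodic_form:
  fixes A :: "int^'n^'n"
  assumes A: "even_form A"
  shows "periodic c (\<lambda>v. unit_e (of_int (vdot v (A *v v)) / (2 * real c)))"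
  unfolding periodic_def
proof (intro allI impI)
  fix u v :: "int^'n" assume "vec_cong c u v"
  then obtain k :: "int^'n" where u: "u = v + int c *s k" by (rule vec_cong_lin)
  obtain m where m: "vdot k (A *v k) = 2 * m"
    using even_quadratic[OF A] by blast
  have "vdot u (A *v u) - vdot v (A *v v) = 2 * int c * (vdot k (A *v v) + int c * m)"
    unfolding u vdot_quadratic_add[OF even_formD(1)[OF A]] matrix_scale_vector
      vdot_scale_left vdot_scale_right m
    by (simp add: algebra_simps)
  then show "unit_e (of_int (vdot u (A *v u)) / (2 * real c))
      = unit_e (of_int (vdot v (A *v v)) / (2 * real c))"
    by (intro unit_e_cong_half) simp
qed

text \<open>The condition on \<open>m\<close> covers the two situations in which blocks are split
  off: \<open>m = c\<close> for an odd prime, where evenness contributes the factor 2, and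
  \<open>m = 8\<close> for \<open>c = 2\<close>, where the finer congruence also controls the symbol
  of the determinant.\<close>

lemma form_sum_cong:
  assumes "even_form A" "even_form B" and AB: "mat_cong m A B"
    and m: "\<And>x. even x \<Longrightarrow> m dvd x \<Longrightarrow> 2 * int c dvd x"
  shows "form_sum A c = form_sum B c"
  unfolding form_sum_def
proof (intro sum.cong refl unit_e_cong_half m)
  fix v
  show "even (vdot v (A *v v) - vdot v (B *v v))"
    using assms by (simp add: even_quadratic)
  have "[vdot v (A *v v) = vdot v (B *v v)] (mod m)"
    unfolding vdot_matrix
    by (intro cong_sum cong_mult cong_refl) (use AB in \<open>auto simp: mat_cong_def\<close>)
  then show "m dvd vdot v (A *v v) - vdot v (B *v v)"
    by (simp add: cong_iff_dvd_diff)
qed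

lemma vdot_congruent: "vdot v ((transpose P ** A ** P) *v v) = vdot (P *v v) (A *v (P *v v))"
  by (simp only: matrix_vector_mul_assoc[symmetric] vdot_transpose[of v "transpose P"]
      transpose_transpose)

lemma even_form_congruent:
  assumes A: "even_form A"
  shows "even_form (transpose P ** A ** P)"
proof -
  have "transpose (transpose P ** A ** P) = transpose P ** A ** P"
    by (simp only: matrix_transpose_mul transpose_transpose even_formD(1)[OF A] matrix_mul_assoc)
  moreover have "even ((transpose P ** A ** P) $ i $ i)" for i
  proof -
    have "(transpose P ** A ** P) $ i $ i
        = vdot (axis i 1) ((transpose P ** A ** P) *v axis i 1)"
      unfolding vdot_axis by (simp add: matrix_vector_mult_def axis_def if_distrib cong: if_cong)
    then show ?thesis using even_quadratic[OF A] by (simp only: vdot_congruent)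
  qed
  ultimately show ?thesis by (simp add: even_form_def)
qed

lemma form_sum_congruent:
  fixes A P P' :: "int^'n^'n"
  assumes "even_form A" "c > 0" "P ** P' = mat 1" "P' ** P = mat 1"
  shows "form_sum (transpose P ** A ** P) c = form_sum A c"
proof -
  have "form_sum (transpose P ** A ** P) c
      = (\<Sum>v\<in>residue_box c. (\<lambda>v. unit_e (of_int (vdot v (A *v v)) / (2 * real c))) (P *v v))"
    unfolding form_sum_def vdot_congruent ..
  also have "\<dots> = form_sum A c"
    unfolding form_sum_def
    by (rule sum_box_reindex[where h = "\<lambda>v. P' *v v"])
      (simp_all add: assms periodic_form vec_cong_matrix matrix_vector_mul_assoc)
  finally show ?thesis .
qed

text \<open>An integer matrix with an integer inverse has determinant 1 or -1, and it enters
  squared.\<close>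

lemma det_congruent:
  fixes A P P' :: "int^'n^'n"
  assumes "P ** P' = mat 1"
  shows "det (transpose P ** A ** P) = det A"
proof -
  have "det P * det P' = 1"
    using arg_cong[OF assms, of det] by (simp add: det_mul)
  then have "det P * det P = 1"
    by (auto simp: zmult_eq_1_iff)
  then show ?thesis by (simp add: det_mul)
qed

lemma form_sum_1: "form_sum (A :: int^'n^'n) (Suc 0) = 1"
proof -
  have zero: "v $ i = 0" if "v \<in> residue_box (Suc 0)" for v :: "int^'n" and i
  proof -
    have "0 \<le> v $ i" "v $ i < 1" using that by (simp_all add: residue_box_def)
    then show ?thesis by simp
  qed
  have "residue_box (Suc 0) = {0 :: int^'n}"
  proof (intro equalityI subsetI)
    fix v :: "int^'n" assume "v \<in> residue_box (Suc 0)"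
    from zero[OF this] show "v \<in> {0}" by (simp add: vec_eq_iff)
  qed (simp add: residue_box_def)
  then show ?thesis by (simp add: form_sum_def)
qed

text \<open>Chinese remainder theorem in the form d u + c v. The cross term is a multiple of 2cd and
  disappears from the phase, while d^2 over 2cd leaves the twist by \<open>d\<close> at the modulus
  \<open>c\<close>, and vice versa.\<close>

lemma form_sum_coprime:
  fixes A :: "int^'n^'n"
  assumes A: "even_form A" and c: "c > 0" "d > 0" "coprime c d"
  shows "form_sum A (c * d) = form_sum (smat (int d) A) c * form_sum (smat (int c) A) d"
proof -
  let ?q = "\<lambda>v. vdot v (A *v v)"
  obtain d' where d': "[int d * d' = 1] (mod int c)"
    using cong_solve_coprime_int[of "int d" "int c"] c by (auto simp: coprime_commute)
  obtain c' where c': "[int c * c' = 1] (mod int d)"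
    using cong_solve_coprime_int[of "int c" "int d"] c by auto
  have both: "vec_cong (c * d) u v" if "vec_cong c u v" "vec_cong d u v" for u v :: "int^'n"
    using that c by (simp add: vec_cong_def coprime_cong_mult)
  have left: "vec_cong c u v" and right: "vec_cong d u v" if "vec_cong (c * d) u v" for u v :: "int^'n"
    using that by (auto simp: vec_cong_def intro: cong_dvd_modulus)
  define f where "f = (\<lambda>u v. int d *s u + int c *s v :: int^'n)"
  have f1: "vec_cong c (d' *s f u v) u" for u v
  proof -
    have "[d' * (int d * u $ i + int c * v $ i) = (int d * d') * u $ i] (mod int c)" for i
      by (simp add: cong_iff_dvd_diff algebra_simps)
    then have "[d' * (int d * u $ i + int c * v $ i) = 1 * u $ i] (mod int c)" for i
      using cong_scalar_right[OF d', of "u $ i"] cong_trans by blast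
    then show ?thesis by (simp add: f_def vec_cong_def distrib_left mult.assoc)
  qed
  have f2: "vec_cong d (c' *s f u v) v" for u v
  proof -
    have "[c' * (int d * u $ i + int c * v $ i) = (int c * c') * v $ i] (mod int d)" for i
      by (simp add: cong_iff_dvd_diff algebra_simps)
    then have "[c' * (int d * u $ i + int c * v $ i) = 1 * v $ i] (mod int d)" for i
      using cong_scalar_right[OF c', of "v $ i"] cong_trans by blast
    then show ?thesis by (simp add: f_def vec_cong_def distrib_left mult.assoc)
  qed
  have f3: "vec_cong (c * d) (f u v) w" if "vec_cong c u (d' *s w)" "vec_cong d v (c' *s w)" for u v w
  proof (rule both)
    have "[int d * u $ i + int c * v $ i = (int d * d') * w $ i] (mod int c)" for i
    proof -
      have "[int d * u $ i + int c * v $ i = int d * u $ i] (mod int c)"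
        by (simp add: cong_iff_dvd_diff)
      also have "[int d * u $ i = int d * (d' * w $ i)] (mod int c)"
        using that(1) by (intro cong_scalar_left) (simp add: vec_cong_def)
      finally show ?thesis by (simp add: mult.assoc)
    qed
    then have "[int d * u $ i + int c * v $ i = 1 * w $ i] (mod int c)" for i
      using cong_scalar_right[OF d', of "w $ i"] cong_trans by blast
    then show "vec_cong c (f u v) w" by (simp add: f_def vec_cong_def)
    have "[int d * u $ i + int c * v $ i = (int c * c') * w $ i] (mod int d)" for i
    proof -
      have "[int d * u $ i + int c * v $ i = int c * v $ i] (mod int d)"
        by (simp add: cong_iff_dvd_diff)
      also have "[int c * v $ i = int c * (c' * w $ i)] (mod int d)"
        using that(2) by (intro cong_scalar_left) (simp add: vec_cong_def)
      finally show ?thesis by (simp add: mult.assoc)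
    qed
    then have "[int d * u $ i + int c * v $ i = 1 * w $ i] (mod int d)" for i
      using cong_scalar_right[OF c', of "w $ i"] cong_trans by blast
    then show "vec_cong d (f u v) w" by (simp add: f_def vec_cong_def)
  qed
  let ?F = "\<lambda>v. unit_e (of_int (?q v) / (2 * real (c * d)))"
  have F: "?F (f u v) = unit_e (of_int (vdot u (smat (int d) A *v u)) / (2 * real c))
      * unit_e (of_int (vdot v (smat (int c) A *v v)) / (2 * real d))" for u v
  proof -
    have "?q (f u v) = (int d)\<^sup>2 * ?q u + 2 * (int c * int d) * vdot v (A *v u) + (int c)\<^sup>2 * ?q v"
      unfolding f_def
      by (simp add: vdot_quadratic_add even_formD(1)[OF A] matrix_scale_vector
          vdot_scale_left vdot_scale_right power2_eq_square)
    then have "of_int (?q (f u v)) / (2 * real (c * d))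
        = of_int (vdot u (smat (int d) A *v u)) / (2 * real c)
          + of_int (vdot v (smat (int c) A *v v)) / (2 * real d) + of_int (vdot v (A *v u))"
      using c by (simp add: smat_mult_vec vdot_scale_right power2_eq_square divide_simps)
    then show ?thesis
      by (simp only: unit_e_add unit_e_Ints[OF Ints_of_int] mult_1_right)
  qed
  have "form_sum (smat (int d) A) c * form_sum (smat (int c) A) d
      = (\<Sum>z\<in>residue_box c \<times> residue_box d. ?F (f (fst z) (snd z)))"
    unfolding F form_sum_def by (simp add: sum_product sum.cartesian_product case_prod_beta)
  also have "\<dots> = (\<Sum>v\<in>residue_box (c * d). ?F v)"
  proof (rule sum.reindex_bij_witness[where j = "\<lambda>z. vec_mod (c * d) (f (fst z) (snd z))"
        and i = "\<lambda>v. (vec_mod c (d' *s v), vec_mod d (c' *s v))"])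
    fix z :: "(int^'n) \<times> (int^'n)" assume z: "z \<in> residue_box c \<times> residue_box d"
    let ?w = "vec_mod (c * d) (f (fst z) (snd z))"
    have w: "vec_cong (c * d) ?w (f (fst z) (snd z))" by simp
    have "vec_cong c (d' *s ?w) (fst z)"
      using vec_cong_scale[OF left[OF w]] f1 by (rule vec_cong_trans)
    moreover have "vec_cong d (c' *s ?w) (snd z)"
      using vec_cong_scale[OF right[OF w]] f2 by (rule vec_cong_trans)
    ultimately have "vec_mod c (d' *s ?w) = fst z" "vec_mod d (c' *s ?w) = snd z"
      using z vec_mod_eq_iff vec_mod_box by (metis mem_Times_iff)+
    then show "(vec_mod c (d' *s ?w), vec_mod d (c' *s ?w)) = z" by simp
    show "?F ?w = ?F (f (fst z) (snd z))"
      by (rule periodicD[OF periodic_form[OF A] w])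
    show "?w \<in> residue_box (c * d)" using c by simp
  next
    fix v :: "int^'n" assume v: "v \<in> residue_box (c * d)"
    have "vec_cong (c * d) (f (vec_mod c (d' *s v)) (vec_mod d (c' *s v))) v"
      by (rule f3) simp_all
    then show "vec_mod (c * d) (f (fst (vec_mod c (d' *s v), vec_mod d (c' *s v)))
        (snd (vec_mod c (d' *s v), vec_mod d (c' *s v)))) = v"
      using v vec_mod_eq_iff vec_mod_box by (metis fst_conv snd_conv)
    show "(vec_mod c (d' *s v), vec_mod d (c' *s v)) \<in> residue_box c \<times> residue_box d"
      using c by simp
  qed
  finally show ?thesis by (simp add: form_sum_def)
qed

text \<open>Let d = p^(k+1). Changing the top digit, v + d u, multiplies the term by e(u^T A v / p),
  so the sum over \<open>u\<close> keeps only those \<open>v\<close> with A v divisible by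
  \<open>p\<close>, that is, \<open>v\<close> itself divisible by \<open>p\<close>. Writing v = p v'
  takes p^2 out of the form, which is why the exponent drops by two. The evenness of the form makes
  this valid for p = 2 as well.\<close>

lemma form_sum_prime_power:
  fixes A :: "int^'n^'n"
  assumes A: "even_form A" and p: "prime p" and cop: "coprime (det A) (int p)"
  shows "form_sum A (p ^ (k + 2)) = of_nat (p ^ CARD('n)) * form_sum A (p ^ k)"
proof -
  let ?q = "\<lambda>v. vdot v (A *v v)"
  have p0: "p > 0" "p > 1" using prime_gt_0_nat[OF p] prime_gt_1_nat[OF p] by simp_all
  define d where "d = p ^ (k + 1)"
  have d0: "d > 0" using p0 by (simp add: d_def)
  have dp: "p ^ (k + 2) = d * p" by (simp add: d_def)
  let ?F = "\<lambda>v. unit_e (of_int (?q v) / (2 * real (d * p)))"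
  have F: "?F (v + int d *s u) = ?F v * unit_e (of_int (vdot u (A *v v)) / real p)" for u v
  proof -
    obtain m where m: "?q u = 2 * m" using even_quadratic[OF A] by blast
    have "?q (v + int d *s u) - (?q v + 2 * int d * vdot u (A *v v))
        = 2 * int (d * p) * (int (p ^ k) * m)"
      by (simp add: vdot_quadratic_add even_formD(1)[OF A] matrix_scale_vector
          vdot_scale_left vdot_scale_right m d_def)
    then have "?F (v + int d *s u)
        = unit_e (of_int (?q v + 2 * int d * vdot u (A *v v)) / (2 * real (d * p)))"
      by (intro unit_e_cong_half) (metis dvd_triv_left)
    also have "of_int (?q v + 2 * int d * vdot u (A *v v)) / (2 * real (d * p))
        = of_int (?q v) / (2 * real (d * p)) + of_int (vdot u (A *v v)) / real p"
      using d0 p0 by (simp add: add_divide_distrib)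
    finally show ?thesis by (simp only: unit_e_add)
  qed
  have "form_sum A (p ^ (k + 2))
      = (\<Sum>v\<in>residue_box d. ?F v * (\<Sum>u\<in>residue_box p. unit_e (of_int (vdot u (A *v v)) / real p)))"
    unfolding form_sum_def dp sum_box_mult[OF d0] F by (simp only: sum_distrib_left)
  also have "\<dots> = (\<Sum>v\<in>residue_box d. if vec_cong p v 0 then of_nat (p ^ CARD('n)) * ?F v else 0)"
  proof (rule sum.cong[OF refl])
    fix v :: "int^'n"
    have "vec_cong p (A *v v) 0 \<longleftrightarrow> vec_cong p v 0"
      using kernel_mod[OF cop p0(2)] vec_cong_matrix[of p v 0 A] by auto
    then show "?F v * (\<Sum>u\<in>residue_box p. unit_e (of_int (vdot u (A *v v)) / real p))
        = (if vec_cong p v 0 then of_nat (p ^ CARD('n)) * ?F v else 0)"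
      by (simp only: sum_box_character[OF p0(1)]) simp
  qed
  also have "\<dots> = of_nat (p ^ CARD('n)) * (\<Sum>v\<in>{v \<in> residue_box d. vec_cong p v 0}. ?F v)"
    by (subst sum.inter_filter[symmetric]) (simp_all add: sum_distrib_left)
  also have "(\<Sum>v\<in>{v \<in> residue_box d. vec_cong p v 0}. ?F v)
      = (\<Sum>v\<in>residue_box (p ^ k). ?F (int p *s v))"
  proof (rule sum.reindex_bij_witness[where i = "\<lambda>v. int p *s v" and j = "\<lambda>v. \<chi> i. v $ i div int p"])
    fix v :: "int^'n" assume v: "v \<in> {v \<in> residue_box d. vec_cong p v 0}"
    then have dvd: "int p dvd v $ i" for i by (simp add: vec_cong_def cong_0_iff)
    then show "int p *s (\<chi> i. v $ i div int p) = v"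
      by (simp add: vec_eq_iff)
    have "v $ i div int p \<in> {0..<int (p ^ k)}" for i
    proof -
      obtain m where m: "v $ i = int p * m" using dvd by blast
      have "0 \<le> v $ i" "v $ i < int p * int (p ^ k)"
        using v by (auto simp: residue_box_def d_def)
      then have "0 \<le> int p * m" "int p * m < int p * int (p ^ k)"
        unfolding m .
      then show ?thesis using p0 m by (simp add: zero_le_mult_iff)
    qed
    then show "(\<chi> i. v $ i div int p) \<in> residue_box (p ^ k)"
      by (simp add: residue_box_def)
  next
    fix v :: "int^'n" assume v: "v \<in> residue_box (p ^ k)"
    then show "int p *s v \<in> {v \<in> residue_box d. vec_cong p v 0}"
      using p0 by (simp add: residue_box_def d_def vec_cong_def cong_0_iff)
    show "(\<chi> i. (int p *s v) $ i div int p) = v"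
      using p0 by (simp add: vec_eq_iff)
  next
    fix v :: "int^'n" assume v: "v \<in> {v \<in> residue_box d. vec_cong p v 0}"
    then have "int p dvd v $ i" for i by (simp add: vec_cong_def cong_0_iff)
    then have "int p *s (\<chi> i. v $ i div int p) = v"
      by (simp add: vec_eq_iff)
    then show "?F (int p *s (\<chi> i. v $ i div int p)) = ?F v" by simp
  qed
  also have "\<dots> = form_sum A (p ^ k)"
    unfolding form_sum_def
  proof (rule sum.cong[OF refl])
    fix v :: "int^'n"
    have "of_int (?q (int p *s v)) / (2 * real (d * p)) = of_int (?q v) / (2 * real (p ^ k))"
      using p0 by (simp add: matrix_scale_vector vdot_scale_left vdot_scale_right d_def)
    then show "?F (int p *s v) = unit_e (of_int (?q v) / (2 * real (p ^ k)))" by simp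
  qed
  finally show ?thesis .
qed

subsection \<open>Splitting off blocks\<close>

definition supp_on :: "'n set \<Rightarrow> int^'n^'n \<Rightarrow> bool" where
  "supp_on I A \<longleftrightarrow> (\<forall>k l. k \<notin> I \<or> l \<notin> I \<longrightarrow> A $ k $ l = 0)"

lemma supp_onD: "supp_on I A \<Longrightarrow> k \<notin> I \<Longrightarrow> A $ k $ l = 0" "supp_on I A \<Longrightarrow> l \<notin> I \<Longrightarrow> A $ k $ l = 0"
  by (simp_all add: supp_on_def)

lemma matrix_add_rdistrib: "(B + C) ** A = B ** A + C ** (A :: int^'n^'n)"
  by (simp add: matrix_matrix_mult_def vec_eq_iff distrib_right sum.distrib)

lemma matrix_mult_eq_0:
  fixes A B :: "int^'n^'n"
  assumes "\<And>k x l. A $ k $ x * B $ x $ l = 0"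
  shows "A ** B = 0"
  by (simp add: matrix_matrix_mult_def vec_eq_iff assms del: mult_eq_0_iff)

definition id_off :: "'n set \<Rightarrow> int^'n^'n" where
  "id_off I = (\<chi> k l. if k = l \<and> k \<notin> I then 1 else 0)"

text \<open>For \<open>A\<close> supported on \<open>I\<close> this is the principal minor on
  \<open>I\<close>: the completion by ones replaces the passage to a smaller matrix.\<close>

definition minor_det :: "'n set \<Rightarrow> int^'n^'n \<Rightarrow> int" where
  "minor_det I A = det (A + id_off I)"

lemma minor_det_UNIV: "minor_det UNIV A = det A"
proof -
  have "A + id_off UNIV = A" by (simp add: id_off_def vec_eq_iff)
  then show ?thesis by (simp add: minor_det_def)
qed

lemma minor_det_empty:
  assumes "supp_on {} A"
  shows "A = 0" "minor_det {} A = 1"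
proof -
  show A: "A = 0" using assms by (simp add: supp_on_def vec_eq_iff)
  have "A + id_off {} = mat 1" by (simp add: A id_off_def mat_def vec_eq_iff)
  then show "minor_det {} A = 1" by (simp add: minor_det_def)
qed

lemma even_form_add: "even_form A \<Longrightarrow> even_form B \<Longrightarrow> even_form (A + B)"
  by (simp add: even_form_def transpose_eq_iff)

lemma even_form_restrict:
  assumes "even_form A"
  shows "even_form (\<chi> k l. if k \<in> K \<and> l \<in> K then A $ k $ l else 0)"
  using assms by (auto simp: even_form_def transpose_eq_iff)

lemma transvection_component:
  fixes A T :: "int^'n^'n"
  shows "(transpose (mat 1 + T) ** A ** (mat 1 + T)) $ k $ l = A $ k $ l
    + (\<Sum>y\<in>UNIV. A $ k $ y * T $ y $ l) + (\<Sum>x\<in>UNIV. T $ x $ k * A $ x $ l)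
    + (\<Sum>x\<in>UNIV. T $ x $ k * (\<Sum>y\<in>UNIV. A $ x $ y * T $ y $ l))"
proof -
  have "transpose (mat 1 + T) = mat 1 + transpose T"
    by (auto simp: transpose_def mat_def vec_eq_iff)
  then have "transpose (mat 1 + T) ** A ** (mat 1 + T)
      = A + A ** T + (transpose T ** A + transpose T ** (A ** T))"
    by (simp add: matrix_add_ldistrib matrix_add_rdistrib matrix_mul_assoc)
  then show ?thesis
    by (simp add: matrix_matrix_mult_def transpose_def)
qed

text \<open>Because \<open>T ** T = 0\<close>, the matrix 1 + T has the inverse 1 - T and is
  unimodular. Since \<open>T\<close> is supported on \<open>I\<close>, the congruence leaves
  \<open>id_off I\<close> unchanged, so the minor is preserved along with the sum.\<close>

lemma transvection:
  fixes A T :: "int^'n^'n"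
  assumes A: "even_form A" and I: "supp_on I A" "supp_on I T" and T: "T ** T = 0" and c: "c > 0"
  defines "A' \<equiv> transpose (mat 1 + T) ** A ** (mat 1 + T)"
  shows "even_form A'" "supp_on I A'" "minor_det I A' = minor_det I A" "form_sum A' c = form_sum A c"
proof -
  define P P' where "P = mat 1 + T" and "P' = mat 1 + - T"
  have neg: "T ** (- T) = - (T ** T)" "(- T) ** T = - (T ** T)"
    by (simp_all add: matrix_matrix_mult_def vec_eq_iff sum_negf)
  have inv: "P ** P' = mat 1" "P' ** P = mat 1"
    unfolding P_def P'_def
    by (simp_all add: matrix_add_ldistrib matrix_add_rdistrib neg T del: add_uminus_conv_diff)
  have A': "A' = transpose P ** A ** P" by (simp add: A'_def P_def)
  show even: "even_form A'" unfolding A' by (rule even_form_congruent[OF A])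
  have "A' $ k $ l = 0" if "k \<notin> I" for k l
    using that I unfolding A'_def transvection_component by (simp add: supp_on_def)
  then show "supp_on I A'"
    using even_form_sym[OF even] by (metis supp_on_def)
  show "form_sum A' c = form_sum A c"
    unfolding A' by (rule form_sum_congruent[OF A c inv])
  have JT: "id_off I ** T = 0"
  proof -
    have "id_off I $ k $ x * T $ x $ l = 0" for k x l
      using I(2) by (auto simp: id_off_def supp_on_def)
    then show ?thesis by (rule matrix_mult_eq_0)
  qed
  have J: "id_off I ** P = id_off I"
    unfolding P_def by (simp add: matrix_add_ldistrib JT)
  have Jt: "transpose (id_off I) = (id_off I :: int^'n^'n)"
    by (simp add: transpose_eq_iff id_off_def)
  have "transpose P ** id_off I ** P = transpose P ** transpose (id_off I)"
    by (simp add: matrix_mul_assoc[symmetric] J Jt)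
  also have "\<dots> = id_off I"
    by (simp only: matrix_transpose_mul[symmetric] J) (rule Jt)
  finally have "transpose P ** (A + id_off I) ** P = A' + id_off I"
    by (simp add: A' matrix_add_ldistrib matrix_add_rdistrib)
  then show "minor_det I A' = minor_det I A"
    using det_congruent[OF inv(1), of "A + id_off I"] by (simp add: minor_det_def)
qed

text \<open>The block diagonal matrix is the product of its two blocks, each completed by ones, so
  multiplicativity of \<open>det\<close> replaces an expansion over permutations.\<close>

lemma det_block_factor:
  fixes B C :: "int^'n^'n"
  assumes "K \<subseteq> I" "supp_on K B" "supp_on (I - K) C"
  shows "det (B + C + id_off I) = minor_det K B * minor_det (I - K) C"
proof -
  have "(B + id_off K) ** (C + id_off (I - K)) = B + C + id_off I"
  proof -
    have "B $ k $ x * C $ x $ l = 0" for k x l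
      using assms by (cases "x \<in> K") (auto simp: supp_on_def)
    then have 1: "B ** C = 0" by (rule matrix_mult_eq_0)
    have "B $ k $ x * id_off (I - K) $ x $ l = (if x = l then B $ k $ l else 0)" for k x l
      using assms by (auto simp: supp_on_def id_off_def)
    then have 2: "B ** id_off (I - K) = B" by (simp add: matrix_matrix_mult_def vec_eq_iff)
    have "id_off K $ k $ x * C $ x $ l = (if x = k then C $ k $ l else 0)" for k x l
      using assms by (auto simp: supp_on_def id_off_def)
    then have 3: "id_off K ** C = C" by (simp add: matrix_matrix_mult_def vec_eq_iff)
    have "(id_off K $ k $ x :: int) * id_off (I - K) $ x $ l = (if x
        = k then id_off I $ k $ l else 0)" for k x l
      using assms by (auto simp: id_off_def)
    then have 4: "id_off K ** id_off (I - K) = (id_off I :: int^'n^'n)"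
      by (simp add: matrix_matrix_mult_def vec_eq_iff)
    show ?thesis
      by (simp add: matrix_add_ldistrib matrix_add_rdistrib 1 2 3 4)
  qed
  then show ?thesis by (simp add: minor_det_def det_mul[symmetric])
qed

lemma vdot_supp_on:
  fixes A :: "int^'n^'n"
  assumes "supp_on I A"
  shows "vdot v (A *v v) = (\<Sum>k\<in>I. \<Sum>l\<in>I. A $ k $ l * v $ k * v $ l)"
proof -
  have "(\<Sum>l\<in>UNIV. A $ k $ l * v $ k * v $ l) = (\<Sum>l\<in>I. A $ k $ l * v $ k * v $ l)" for k
    by (rule sum.mono_neutral_right) (use assms in \<open>auto simp: supp_on_def\<close>)
  moreover have "(\<Sum>k\<in>UNIV. \<Sum>l\<in>I. A $ k $ l * v $ k * v $ l) = (\<Sum>k\<in>I. \<Sum>l\<in>I. A $ k $ l * v $ k * v $ l)"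
    by (rule sum.mono_neutral_right) (use assms in \<open>auto simp: supp_on_def\<close>)
  ultimately show ?thesis by (simp add: vdot_matrix)
qed

lemma form_sum_block_add:
  fixes B C :: "int^'n^'n"
  assumes "supp_on K B" "supp_on J C" "K \<inter> J = {}"
  shows "form_sum B c * form_sum C c = of_nat (c ^ CARD('n)) * form_sum (B + C) c"
proof -
  let ?f = "\<lambda>A v. unit_e (of_int (vdot v (A *v v)) / (2 * real c))"
  have "form_sum B c * form_sum C c = of_nat (c ^ CARD('n)) * (\<Sum>v\<in>residue_box c. ?f B v * ?f C v)"
    unfolding form_sum_def
  proof (rule sum_box_merge[where K = K])
    fix u v :: "int^'n" assume "\<And>i. i \<in> K \<Longrightarrow> u $ i = v $ i"
    then show "?f B u = ?f B v" unfolding vdot_supp_on[OF assms(1)] by simp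
  next
    fix u v :: "int^'n" assume "\<And>i. i \<notin> K \<Longrightarrow> u $ i = v $ i"
    then have "\<And>i. i \<in> J \<Longrightarrow> u $ i = v $ i" using assms(3) by blast
    then show "?f C u = ?f C v" unfolding vdot_supp_on[OF assms(2)] by simp
  qed
  also have "(\<Sum>v\<in>residue_box c. ?f B v * ?f C v) = form_sum (B + C) c"
    unfolding form_sum_def
    by (simp add: unit_e_add[symmetric] add_divide_distrib[symmetric]
        matrix_vector_mult_add_rdistrib vdot_add_right)
  finally show ?thesis .
qed

text \<open>Block elimination modulo \<open>m\<close>. \<open>R\<close> inverts the block on
  \<open>K\<close> modulo \<open>m\<close>, and the transvection \<open>T\<close>, which is minus
  \<open>R\<close> times the part of \<open>A\<close> with rows in \<open>K\<close> and columns in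
  \<open>I - K\<close>, clears that part. It is cleared only modulo \<open>m\<close>: dropping the
  remainder changes the minor by a multiple of \<open>m\<close> and, by the condition on
  \<open>m\<close>, leaves the sum unchanged. The block on \<open>K\<close> itself is
  untouched.\<close>

lemma split_block:
  fixes A :: "int^'n^'n" and R :: "'n \<Rightarrow> 'n \<Rightarrow> int"
  assumes A: "even_form A" "supp_on I A" and K: "K \<subseteq> I"
    and R: "\<And>k l. k \<in> K \<Longrightarrow> l \<in> K \<Longrightarrow> [(\<Sum>j\<in>K. A $ k $ j * R j l) = (if k = l then 1 else 0)] (mod m)"
    and c: "c > 0" and m: "\<And>x. even x \<Longrightarrow> m dvd x \<Longrightarrow> 2 * int c dvd x"
  obtains B C where "even_form B" "supp_on K B" "\<And>k l. k \<in> K \<Longrightarrow> l \<in> K \<Longrightarrow> B $ k $ l = A $ k $ l"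
    "even_form C" "supp_on (I - K) C"
    "[minor_det I A = minor_det K B * minor_det (I - K) C] (mod m)"
    "form_sum B c * form_sum C c = of_nat (c ^ CARD('n)) * form_sum A c"
proof -
  define T :: "int^'n^'n" where
    "T = (\<chi> k l. if k \<in> K \<and> l \<in> I - K then - (\<Sum>j\<in>K. R k j * A $ j $ l) else 0)"
  have T0: "T $ k $ l = 0" if "k \<notin> K \<or> l \<notin> I - K" for k l
    using that by (auto simp: T_def)
  have suppT: "supp_on I T" using K by (auto simp: supp_on_def T_def)
  have "T $ k $ x * T $ x $ l = 0" for k x l
    by (cases "x \<in> K") (auto simp: T0)
  then have TT: "T ** T = 0" by (rule matrix_mult_eq_0)
  define A' where "A' = transpose (mat 1 + T) ** A ** (mat 1 + T)"
  note tr = transvection[OF A suppT TT c, folded A'_def]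
  have row: "A' $ k $ l = A $ k $ l + (\<Sum>y\<in>K. A $ k $ y * T $ y $ l)" if "k \<in> K" for k l
  proof -
    have "(\<Sum>y\<in>UNIV. A $ k $ y * T $ y $ l) = (\<Sum>y\<in>K. A $ k $ y * T $ y $ l)"
      by (rule sum.mono_neutral_right) (auto simp: T0)
    then show ?thesis
      using that unfolding A'_def transvection_component by (simp add: T0)
  qed
  have KK: "A' $ k $ l = A $ k $ l" if "k \<in> K" "l \<in> K" for k l
    using that by (simp add: row T0)
  have KJ: "[A' $ k $ l = 0] (mod m)" if "k \<in> K" "l \<in> I - K" for k l
  proof -
    have "(\<Sum>y\<in>K. A $ k $ y * T $ y $ l) = - (\<Sum>y\<in>K. \<Sum>j\<in>K. A $ k $ y * R y j * A $ j $ l)"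
      using that by (simp add: T_def sum_negf sum_distrib_left mult.assoc)
    also have "(\<Sum>y\<in>K. \<Sum>j\<in>K. A $ k $ y * R y j * A $ j $ l)
        = (\<Sum>j\<in>K. (\<Sum>y\<in>K. A $ k $ y * R y j) * A $ j $ l)"
      by (subst sum.swap) (simp add: sum_distrib_right)
    finally have eq: "A' $ k $ l = A $ k $ l - (\<Sum>j\<in>K. (\<Sum>y\<in>K. A $ k $ y * R y j) * A $ j $ l)"
      using that by (simp add: row)
    have "[(\<Sum>j\<in>K. (\<Sum>y\<in>K. A $ k $ y * R y j) * A $ j $ l)
        = (\<Sum>j\<in>K. (if k = j then 1 else 0) * A $ j $ l)] (mod m)"
      using that by (intro cong_sum cong_scalar_right R)
    also have "(\<Sum>j\<in>K. (if k = j then 1 else 0) * A $ j $ l) = (\<Sum>j\<in>K. if k = j then A $ k $ l else 0)"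
      by (rule sum.cong) auto
    also have "\<dots> = A $ k $ l"
      using that by simp
    finally show ?thesis
      unfolding eq by (simp add: cong_iff_dvd_diff dvd_diff_commute)
  qed
  define B where "B = (\<chi> k l. if k \<in> K \<and> l \<in> K then A' $ k $ l else 0)"
  define C where "C = (\<chi> k l. if k \<in> I - K \<and> l \<in> I - K then A' $ k $ l else 0)"
  have even: "even_form B" "even_form C"
    unfolding B_def C_def by (rule even_form_restrict[OF tr(1)])+
  have supp: "supp_on K B" "supp_on (I - K) C" by (simp_all add: supp_on_def B_def C_def)
  have cong: "mat_cong m A' (B + C)"
    unfolding mat_cong_def
  proof (intro allI)
    fix k l
    consider "k \<notin> I \<or> l \<notin> I" | "k \<in> K" "l \<in> K" | "k \<in> I - K" "l \<in> I - K"
      | "k \<in> K" "l \<in> I - K" | "l \<in> K" "k \<in> I - K"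
      using K by blast
    then show "[A' $ k $ l = (B + C) $ k $ l] (mod m)"
    proof cases
      case 1
      then have "A' $ k $ l = 0" "(B + C) $ k $ l = 0"
        using tr(2) K by (auto simp: supp_on_def B_def C_def)
      then show ?thesis by simp
    next
      case 4
      then show ?thesis using KJ by (simp add: B_def C_def)
    next
      case 5
      then show ?thesis using KJ[of l k] even_form_sym[OF tr(1), of k l] by (simp add: B_def C_def)
    qed (simp_all add: B_def C_def)
  qed
  have "mat_cong m (A' + id_off I) (B + C + id_off I)"
    using cong by (auto simp: mat_cong_def intro: cong_add)
  then have "[minor_det I A' = det (B + C + id_off I)] (mod m)"
    unfolding minor_det_def by (rule mat_cong_det)
  then have det: "[minor_det I A = minor_det K B * minor_det (I - K) C] (mod m)"
    unfolding det_block_factor[OF K supp] tr(3) .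
  have "form_sum A c = form_sum (B + C) c"
    unfolding tr(4)[symmetric]
    by (rule form_sum_cong[OF tr(1) even_form_add[OF even] cong m])
  then have "form_sum B c * form_sum C c = of_nat (c ^ CARD('n)) * form_sum A c"
    using form_sum_block_add[OF supp] by simp
  moreover have "B $ k $ l = A $ k $ l" if "k \<in> K" "l \<in> K" for k l
    using that KK by (simp add: B_def)
  ultimately show ?thesis using even supp det by (intro that) auto
qed

lemma dvd_det_row:
  fixes M :: "int^'n^'n"
  assumes "\<And>l. d dvd M $ i $ l"
  shows "d dvd det M"
  unfolding det_def
proof (intro dvd_sum dvd_mult)
  fix p
  have "(\<Prod>i\<in>UNIV. M $ i $ p i) = M $ i $ p i * (\<Prod>i\<in>UNIV - {i}. M $ i $ p i)"
    by (rule prod.remove) auto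
  then show "d dvd (\<Prod>i\<in>UNIV. M $ i $ p i)" using assms by simp
qed

lemma minor_det_row_nonzero:
  assumes "\<not> d dvd minor_det I A" "i \<in> I" "supp_on I A"
  obtains j where "j \<in> I" "\<not> d dvd A $ i $ j"
proof -
  have "\<exists>j. \<not> d dvd (A + id_off I) $ i $ j"
    using assms(1) dvd_det_row unfolding minor_det_def by blast
  then obtain j where "\<not> d dvd A $ i $ j"
    using assms(2) by (auto simp: id_off_def)
  moreover from this have "j \<in> I" using supp_onD(2)[OF assms(3)] by (metis dvd_0_right)
  ultimately show ?thesis by (intro that)
qed

lemma minor_det_singleton:
  fixes A :: "int^'n^'n"
  assumes "supp_on {i} A"
  shows "minor_det {i} A = A $ i $ i"
proof -
  have "minor_det {i} A = (\<Prod>k\<in>UNIV. (A + id_off {i}) $ k $ k)"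
    unfolding minor_det_def
    by (rule det_diagonal) (use supp_onD[OF assms] in \<open>force simp: id_off_def\<close>)
  also have "\<dots> = (\<Prod>k\<in>UNIV. if k = i then A $ i $ i else 1)"
    by (rule prod.cong) (use assms in \<open>auto simp: supp_on_def id_off_def\<close>)
  finally show ?thesis by simp
qed

text \<open>The rows off the pair are basis vectors, so a permutation moving any other index
  contributes zero and only the identity and the transposition remain.\<close>

lemma minor_det_pair:
  fixes A :: "int^'n^'n"
  assumes supp: "supp_on {i, j} A" and ij: "i \<noteq> j"
  shows "minor_det {i, j} A = A $ i $ i * A $ j $ j - A $ i $ j * A $ j $ i"
proof -
  let ?M = "A + id_off {i, j}"
  let ?t = "\<lambda>p. of_int (sign p) * (\<Prod>k\<in>UNIV. ?M $ k $ p k)"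
  have M: "?M $ i $ i = A $ i $ i" "?M $ i $ j = A $ i $ j" "?M $ j $ i = A $ j $ i" "?M $ j $ j
      = A $ j $ j"
    by (simp_all add: id_off_def)
  have off: "?M $ k $ k = 1" "k \<noteq> l \<Longrightarrow> ?M $ k $ l = 0" if "k \<notin> {i, j}" for k l
    using that supp by (auto simp: id_off_def supp_on_def)
  have split: "(\<Prod>k\<in>UNIV. f k) = f i * (f j * (\<Prod>k\<in>- {i, j}. f k))" for f :: "'n \<Rightarrow> int"
  proof -
    have "UNIV = insert i (insert j (- {i, j}))" by auto
    then have "(\<Prod>k\<in>UNIV. f k) = (\<Prod>k\<in>insert i (insert j (- {i, j})). f k)" by simp
    also have "\<dots> = f i * (f j * (\<Prod>k\<in>- {i, j}. f k))" using ij by simp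
    finally show ?thesis .
  qed
  have "minor_det {i, j} A = (\<Sum>p\<in>{p. p permutes UNIV}. ?t p)"
    by (simp add: minor_det_def det_def)
  also have "\<dots> = (\<Sum>p\<in>{p. p permutes {i, j}}. ?t p)"
  proof (rule sum.mono_neutral_right)
    show "{p. p permutes {i, j}} \<subseteq> {p. p permutes UNIV}"
      by (auto intro: permutes_subset)
    show "\<forall>p\<in>{p. p permutes UNIV} - {p. p permutes {i, j}}. ?t p = 0"
    proof
      fix p assume p: "p \<in> {p. p permutes UNIV} - {p. p permutes {i, j}}"
      then obtain k where "k \<notin> {i, j}" "p k \<noteq> k"
        by (auto simp: permutes_def)
      then have "?M $ k $ p k = 0" using off(2)[of k "p k"] by simp
      then have "(\<Prod>k\<in>UNIV. ?M $ k $ p k) = 0" by (intro prod_zero) auto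
      then show "?t p = 0" by simp
    qed
  qed (simp add: finite_permutations)
  also have "{p. p permutes {i, j}} = {id, Transposition.transpose i j}"
    by (auto simp: permutes_doubleton_iff)
  also have "(\<Sum>p\<in>{id, Transposition.transpose i j}. ?t p)
      = ?t id + ?t (Transposition.transpose i j)"
    using ij by (subst sum.insert) (auto simp: transpose_eq_id_iff eq_commute[of id])
  also have "?t id = A $ i $ i * A $ j $ j"
  proof -
    have "(\<Prod>k\<in>- {i, j}. ?M $ k $ k) = 1"
      by (rule prod.neutral) (auto simp: off simp del: vector_add_component)
    then show ?thesis
      unfolding split by (simp add: M del: vector_add_component)
  qed
  also have "?t (Transposition.transpose i j) = - (A $ i $ j * A $ j $ i)"
  proof -
    have "(\<Prod>k\<in>- {i, j}. ?M $ k $ Transposition.transpose i j k) = 1"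
      by (rule prod.neutral) (auto simp: Transposition.transpose_def off simp del: vector_add_component)
    then show ?thesis
      unfolding split using ij by (simp add: M sign_swap_id del: vector_add_component)
  qed
  finally show ?thesis by simp
qed

subsection \<open>Evaluation of the complete sum\<close>

lemma form_sum_zero: "form_sum (0 :: int^'n^'n) c = of_nat (c ^ CARD('n))"
  by (simp add: form_sum_def card_box)

text \<open>The other coordinates are free. The factor \<open>c\<close> on the left avoids the
  exponent \<open>CARD('n) - 1\<close>.\<close>

lemma form_sum_singleton:
  fixes B :: "int^'n^'n"
  assumes B: "supp_on {i} B" "B $ i $ i = 2 * b"
  shows "of_nat c * form_sum B c
    = of_nat (c ^ CARD('n)) * (\<Sum>x\<in>{0..<int c}. unit_e (of_int (b * x\<^sup>2) / real c))"
proof -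
  let ?g = "\<Sum>x\<in>{0..<int c}. unit_e (of_int (b * x\<^sup>2) / real c)"
  let ?f = "\<lambda>j x. if j = i then unit_e (of_int (b * x\<^sup>2) / real c) else 1"
  have "form_sum B c = (\<Sum>v\<in>residue_box c. \<Prod>j\<in>UNIV. ?f j (v $ j))"
    unfolding form_sum_def vdot_supp_on[OF B(1)] by (simp add: B(2) power2_eq_square mult.assoc)
  also have "\<dots> = (\<Prod>j\<in>UNIV. \<Sum>x\<in>{0..<int c}. ?f j x)"
    by (rule sum_box_prod)
  also have "\<dots> = (\<Sum>x\<in>{0..<int c}. ?f i x) * (\<Prod>j\<in>UNIV - {i}. \<Sum>x\<in>{0..<int c}. ?f j x)"
    by (rule prod.remove) auto
  also have "(\<Prod>j\<in>UNIV - {i}. \<Sum>x\<in>{0..<int c}. ?f j x) = (\<Prod>j\<in>UNIV - {i}. of_nat c)"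
    by (rule prod.cong) auto
  also have "\<dots> = of_nat (c ^ (CARD('n) - 1))"
    by (simp add: card_Diff_singleton)
  finally have "of_nat c * form_sum B c = of_nat (c * c ^ (CARD('n) - 1)) * ?g"
    by (simp add: mult_ac)
  also have "c * c ^ (CARD('n) - 1) = c ^ CARD('n)"
    by (simp add: power_eq_if[of c "CARD('n)"])
  finally show ?thesis .
qed

text \<open>If all diagonal entries on \<open>I\<close> are divisible by \<open>p\<close>, some A_ij
  in row \<open>i\<close> is not. Adding basis vector \<open>j\<close> to basis vector
  \<open>i\<close> then produces the diagonal entry A_ii + 2 A_ij + A_jj, which is a unit because
  \<open>p\<close> is odd.\<close>

lemma exists_unit_diagonal:
  fixes A :: "int^'n^'n" and p :: nat
  assumes A: "even_form A" "supp_on I A" and I: "I \<noteq> {}" and p: "prime p" "p > 2"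
    and det: "\<not> int p dvd minor_det I A"
  obtains B i where "even_form B" "supp_on I B" "minor_det I B = minor_det I A"
    "form_sum B p = form_sum A p" "i \<in> I" "\<not> int p dvd B $ i $ i"
proof (cases "\<exists>i\<in>I. \<not> int p dvd A $ i $ i")
  case True
  then show ?thesis using A that by blast
next
  case False
  then have diag: "int p dvd A $ i $ i" if "i \<in> I" for i using that by blast
  obtain i where i: "i \<in> I" using I by blast
  obtain j where j: "j \<in> I" "\<not> int p dvd A $ i $ j"
    using minor_det_row_nonzero[OF det i A(2)] by blast
  have ij: "i \<noteq> j" using diag i j by blast
  define T :: "int^'n^'n" where "T = (\<chi> k l. if k = j \<and> l = i then 1 else 0)"
  have "T $ k $ x * T $ x $ l = 0" for k x l using ij by (simp add: T_def)
  then have TT: "T ** T = 0" by (rule matrix_mult_eq_0)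
  have supp: "supp_on I T" using i j by (auto simp: supp_on_def T_def)
  define B where "B = transpose (mat 1 + T) ** A ** (mat 1 + T)"
  have "p > 0" using p by simp
  note tr = transvection[OF A supp TT this, folded B_def]
  have col: "(\<Sum>y\<in>UNIV. f y * T $ y $ i) = f j" for f :: "'n \<Rightarrow> int"
    by (simp add: T_def if_distrib cong: if_cong)
  have "B $ i $ i = A $ i $ i + A $ i $ j + A $ j $ i + A $ j $ j"
    unfolding B_def transvection_component mult.commute[of "T $ _ $ _"] col by simp
  also have "\<dots> = A $ i $ i + (2 * A $ i $ j + A $ j $ j)"
    using even_form_sym[OF A(1), of j i] by simp
  finally have Bii: "B $ i $ i = A $ i $ i + (2 * A $ i $ j + A $ j $ j)" .
  have "\<not> int p dvd B $ i $ i"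
  proof
    assume "int p dvd B $ i $ i"
    then have "int p dvd 2 * A $ i $ j"
      using diag[OF i] diag[OF j(1)] unfolding Bii by (simp add: dvd_add_right_iff dvd_add_left_iff)
    moreover have "coprime (int p) 2"
      using p prime_odd_nat[of p] by simp
    ultimately show False using j by (simp add: coprime_dvd_mult_right_iff)
  qed
  with tr i show ?thesis by (intro that)
qed

text \<open>Diagonalisation, one variable at a time. A variable with diagonal entry 2b contributes
  (b/p) g to the sum but (2b/p) to the symbol of the minor, whence one factor (2/p) per variable.
  The powers of \<open>p\<close> on the two sides balance the free coordinates and keep the
  induction free of division.\<close>

lemma form_sum_odd_prime_aux:
  fixes A :: "int^'n^'n" and p :: nat
  assumes p: "prime p" "p > 2"
    and A: "even_form A" "supp_on I A" and det: "\<not> int p dvd minor_det I A"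
  defines "g \<equiv> \<Sum>x\<in>{0..<int p}. unit_e (of_int (x\<^sup>2) / real p)"
  shows "form_sum A p * of_int (Legendre 2 (int p)) ^ card I * of_nat p ^ card I
    = of_int (Legendre (minor_det I A) (int p)) * g ^ card I * of_nat (p ^ CARD('n))"
  using A det
proof (induction "card I" arbitrary: I A)
  case 0
  then have I: "I = {}" by simp
  have "Legendre 1 (int p) = 1"
    using p by (auto simp: Legendre_def QuadRes_def cong_def intro: exI[of _ 1])
  then show ?case
    using minor_det_empty[of A] 0 by (simp add: I form_sum_zero)
next
  case (Suc m)
  have p0: "p > 0" using p by simp
  have "I \<noteq> {}" using Suc by auto
  then obtain B i where B: "even_form B" "supp_on I B" "minor_det I B = minor_det I A"
    "form_sum B p = form_sum A p" "i \<in> I" "\<not> int p dvd B $ i $ i"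
    using exists_unit_diagonal[OF Suc.prems(1,2) _ p Suc.prems(3)] by blast
  have "coprime (B $ i $ i) (int p)"
    using p B(6) by (metis coprime_commute prime_imp_coprime prime_nat_int_transfer)
  then obtain r where r: "[B $ i $ i * r = 1] (mod int p)"
    using cong_solve_coprime_int by blast
  have m: "2 * int p dvd x" if "even x" "int p dvd x" for x
    using that prime_odd_nat[OF p] by (intro divides_mult) (auto simp: coprime_commute)
  obtain B0 C where split: "even_form B0" "supp_on {i} B0" "B0 $ i $ i = B $ i $ i"
    "even_form C" "supp_on (I - {i}) C"
    "[minor_det I B = minor_det {i} B0 * minor_det (I - {i}) C] (mod int p)"
    "form_sum B0 p * form_sum C p = of_nat (p ^ CARD('n)) * form_sum B p"
    by (rule split_block[OF B(1,2), of "{i}" "\<lambda>_ _. r" "int p" p]) (use B(5) r p0 m in auto)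
  have det_cong: "[minor_det I A = B $ i $ i * minor_det (I - {i}) C] (mod int p)"
    using split(6) unfolding B(3) minor_det_singleton[OF split(2)] split(3) .
  obtain b where b: "B $ i $ i = 2 * b" using even_formD(2)[OF B(1)] by blast
  have nb: "\<not> int p dvd b" using B(6) b by auto
  have "\<not> int p dvd minor_det (I - {i}) C"
    using Suc.prems(3) cong_dvd_iff[OF det_cong] by auto
  moreover have card: "m = card (I - {i})" using Suc.hyps(2) B(5) by simp
  ultimately have IH: "form_sum C p * of_int (Legendre 2 (int p)) ^ m * of_nat p ^ m
    = of_int (Legendre (minor_det (I - {i}) C) (int p)) * g ^ m * of_nat (p ^ CARD('n))"
    using Suc.hyps(1)[OF card split(4,5)] by simp
  have B0: "of_nat p * form_sum B0 p = of_nat (p ^ CARD('n)) * (of_int (Legendre b (int p)) * g)"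
    using form_sum_singleton[OF split(2) split(3)[unfolded b], of p] quadratic_gauss_sum_twist[OF p nb]
    by (simp add: g_def)
  have L: "Legendre (minor_det I A) (int p)
      = Legendre 2 (int p) * Legendre b (int p) * Legendre (minor_det (I - {i}) C) (int p)"
    using Legendre_cong[OF det_cong] by (simp add: b Legendre_mult[OF p])
  let ?L2 = "complex_of_int (Legendre 2 (int p))" and ?Lb = "complex_of_int (Legendre b (int p))"
  let ?LC = "complex_of_int (Legendre (minor_det (I - {i}) C) (int p))"
  let ?pn = "of_nat (p ^ CARD('n)) :: complex"
  have "?pn * (form_sum A p * ?L2 ^ Suc m * of_nat p ^ Suc m)
      = (form_sum B0 p * form_sum C p) * ?L2 ^ Suc m * of_nat p ^ Suc m"
    unfolding split(7) B(4) by (simp only: mult_ac)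
  also have "\<dots> = (of_nat p * form_sum B0 p) * ?L2 * (form_sum C p * ?L2 ^ m * of_nat p ^ m)"
    by (simp add: mult_ac)
  also have "\<dots> = ?pn * ((?L2 * ?Lb * ?LC) * g ^ Suc m * ?pn)"
    unfolding B0 IH by (simp add: mult_ac)
  finally have "form_sum A p * ?L2 ^ Suc m * of_nat p ^ Suc m = (?L2 * ?Lb * ?LC) * g ^ Suc m * ?pn"
    using p0 by simp
  then show ?case
    unfolding L using Suc.hyps(2) by simp
qed

lemma form_sum_odd_prime:
  fixes A :: "int^'n^'n" and p :: nat
  assumes p: "prime p" "p > 2" and A: "even_form A" and det: "\<not> int p dvd det A"
  shows "form_sum A p * of_int (Legendre 2 (int p)) ^ CARD('n)
    = of_int (Legendre (det A) (int p)) * (\<Sum>x\<in>{0..<int p}. unit_e (of_int (x\<^sup>2) / real p)) ^ CARD('n)"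
proof -
  have "supp_on UNIV A" by (simp add: supp_on_def)
  from form_sum_odd_prime_aux[OF p A this] det p show ?thesis
    by (simp add: minor_det_UNIV)
qed

section \<open>The prime 2\<close>

lemma odd_square_cong_1:
  assumes "odd (x :: int)"
  shows "[x\<^sup>2 = 1] (mod 8)"
proof -
  obtain k where k: "x = 2 * k + 1" using assms by (elim oddE)
  have "even (k * (k + 1))" by simp
  then obtain m where m: "k * (k + 1) = 2 * m" by blast
  have "x\<^sup>2 - 1 = 4 * (k * (k + 1))" by (simp add: k power2_eq_square algebra_simps)
  also have "\<dots> = 8 * m" unfolding m by simp
  finally show ?thesis by (simp add: cong_iff_dvd_diff)
qed

text \<open>The form is a x^2 + b x y + d y^2 with \<open>b\<close> odd. If a d is even, three of
  its four values modulo 2 are even, otherwise only one is; this is the Arf invariant. The minor is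
  4 a d - b^2, hence 7 or 3 modulo 8 in these two cases, and the symbol at 2 takes the same
  sign.\<close>

lemma form_sum_pair_2:
  fixes B :: "int^'n^'n"
  assumes B: "even_form B" "supp_on {i, j} B" and ij: "i \<noteq> j" and b: "odd (B $ i $ j)"
  shows "2 * form_sum B 2 = of_nat (2 ^ CARD('n)) * of_int (kronecker_prime (minor_det {i, j} B) 2)"
proof -
  obtain a where a: "B $ i $ i = 2 * a" using even_formD(2)[OF B(1)] by blast
  obtain d where d: "B $ j $ j = 2 * d" using even_formD(2)[OF B(1)] by blast
  define b where "b = B $ i $ j"
  have b': "B $ j $ i = b" "odd b" using even_form_sym[OF B(1)] b by (simp_all add: b_def)
  have half: "unit_e (of_int z / 2) = (if even z then 1 else - 1)" for z
  proof (cases "even z")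
    case True
    then obtain m where "z = 2 * m" by blast
    then show ?thesis by (simp add: unit_e_Ints)
  next
    case False
    then obtain m where "z = 2 * m + 1" by (elim oddE)
    then have "unit_e (of_int z / 2) = unit_e (of_int m) * unit_e (1 / 2)"
      unfolding unit_e_add[symmetric] by (simp add: add_divide_distrib)
    then show ?thesis using False by (simp add: unit_e_Ints) (simp add: unit_e_cis)
  qed
  define F where "F = (\<lambda>v :: int^'n. unit_e (of_int (vdot v (B *v v)) / (2 * real 2)))"
  have F: "F v = (if even (a * (v $ i)\<^sup>2 + b * v $ i * v $ j + d * (v $ j)\<^sup>2) then 1 else - 1)" for v
  proof -
    have "vdot v (B *v v) = 2 * (a * (v $ i)\<^sup>2 + b * v $ i * v $ j + d * (v $ j)\<^sup>2)"
      unfolding vdot_supp_on[OF B(2)] using ij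
      by (simp add: a d b' b_def[symmetric] power2_eq_square algebra_simps)
    then have "of_int (vdot v (B *v v)) / (2 * real 2)
        = of_int (a * (v $ i)\<^sup>2 + b * v $ i * v $ j + d * (v $ j)\<^sup>2) / 2"
      by simp
    then show ?thesis unfolding F_def half[symmetric] by (simp only:)
  qed
  have per: "periodic 2 F" unfolding F_def by (rule periodic_form[OF B(1)])
  let ?\<chi> = "complex_of_int (kronecker_prime (minor_det {i, j} B) 2)"
  have shift: "(\<Sum>v\<in>residue_box 2. F (v + t)) = form_sum B 2" for t
    using sum_box_translate[OF _ per, of t] by (simp add: form_sum_def F_def)
  have four: "F v + F (v + axis i 1) + F (v + axis j 1) + F (v + (axis i 1 + axis j 1))
      = (if even a \<or> even d then 2 else - 2)" for v
    unfolding F using ij b'(2) by (auto simp: axis_def)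
  \<comment> \<open>Averaging over the four translates in the plane of \<open>i\<close> and
    \<open>j\<close> makes the summand constant.\<close>
  have "4 * form_sum B 2 = (\<Sum>v\<in>residue_box 2. F v + F (v + axis i 1) + F (v + axis j 1)
      + F (v + (axis i 1 + axis j 1)))"
    by (simp only: sum.distrib shift) (simp add: form_sum_def F_def)
  also have "\<dots> = of_nat (2 ^ CARD('n)) * (if even a \<or> even d then 2 else - 2)"
    unfolding four by (simp add: card_box)
  also have "(if even a \<or> even d then 2 else - 2) = 2 * ?\<chi>"
  proof -
    have "[minor_det {i, j} B = 4 * (a * d) - b\<^sup>2] (mod 8)"
      by (simp add: minor_det_pair[OF B(2) ij] a d b' b_def[symmetric] power2_eq_square mult_ac)
    also have "[4 * (a * d) - b\<^sup>2 = 4 * (a * d) - 1] (mod 8)"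
      by (intro cong_diff cong_refl odd_square_cong_1 b')
    finally have "kronecker_prime (minor_det {i, j} B) 2 = kronecker_prime (4 * (a * d) - 1) 2"
      by (rule kronecker_prime_2_cong)
    moreover have "kronecker_prime (4 * (a * d) - 1) 2 = (if even (a * d) then 1 else - 1)"
    proof (cases "even (a * d)")
      case True
      then obtain m where "a * d = 2 * m" by blast
      then have "[4 * (a * d) - 1 = 7] (mod 8)"
        by (simp add: cong_iff_dvd_diff)
      from kronecker_prime_2_cong[OF this] True show ?thesis
        by (simp add: kronecker_prime_def)
    next
      case False
      then obtain m where "a * d = 2 * m + 1" by (elim oddE)
      then have "[4 * (a * d) - 1 = 3] (mod 8)"
        by (simp add: cong_iff_dvd_diff)
      from kronecker_prime_2_cong[OF this] False show ?thesis
        by (simp add: kronecker_prime_def)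
    qed
    ultimately show ?thesis by auto
  qed
  finally show ?thesis by (simp add: mult_ac)
qed

text \<open>Diagonal entries are even, so an odd minor forces an odd entry off the diagonal and the
  variables leave in pairs; this also shows that their number is even. The splitting is done modulo
  8 so that the symbols at 2 of the blocks multiply to that of the whole.\<close>

lemma form_sum_2_aux:
  fixes A :: "int^'n^'n"
  assumes "even_form A" "supp_on I A" "odd (minor_det I A)"
  shows "even (card I) \<and> form_sum A 2 * of_real (sqrt 2) ^ card I
    = of_nat (2 ^ CARD('n)) * of_int (kronecker_prime (minor_det I A) 2)"
  using assms
proof (induction "card I" arbitrary: I A rule: less_induct)
  case (less I A)
  note A = less.prems
  show ?case
  proof (cases "I = {}")
    case True
    then show ?thesis
      using minor_det_empty[of A] A by (simp add: form_sum_zero kronecker_prime_def)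
  next
    case False
    then obtain i where i: "i \<in> I" by blast
    obtain j where j: "j \<in> I" "odd (A $ i $ j)"
      using minor_det_row_nonzero[OF A(3) i A(2)] by blast
    have ij: "i \<noteq> j" using even_formD(2)[OF A(1)] j by blast
    define \<Delta> where "\<Delta> = A $ i $ i * A $ j $ j - (A $ i $ j)\<^sup>2"
    have "odd \<Delta>" using j even_formD(2)[OF A(1)] by (simp add: \<Delta>_def)
    then have \<Delta>: "[\<Delta>\<^sup>2 = 1] (mod 8)" by (rule odd_square_cong_1)
    have sym: "A $ j $ i = A $ i $ j" by (rule even_form_sym[OF A(1)])
    \<comment> \<open>The adjugate of the 2 by 2 block times its determinant \<Delta>. It inverts
      the block modulo 8, because the square of the odd number \<Delta> is 1 modulo 8.\<close>
    define R where "R = (\<lambda>k l. \<Delta> * (if k = l then (if k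
        = i then A $ j $ j else A $ i $ i) else - A $ i $ j))"
    have R: "[(\<Sum>y\<in>{i, j}. A $ k $ y * R y l) = (if k = l then 1 else 0)] (mod 8)"
      if "k \<in> {i, j}" "l \<in> {i, j}" for k l
    proof -
      have "(\<Sum>y\<in>{i, j}. A $ k $ y * R y l) = (if k = l then \<Delta>\<^sup>2 else 0)"
        using that ij
        by (auto simp: R_def sym) (simp_all add: \<Delta>_def power2_eq_square algebra_simps)
      then show ?thesis using \<Delta> by simp
    qed
    obtain B C where split: "even_form B" "supp_on {i, j} B" "B $ i $ j = A $ i $ j"
      "even_form C" "supp_on (I - {i, j}) C"
      "[minor_det I A = minor_det {i, j} B * minor_det (I - {i, j}) C] (mod 8)"
      "form_sum B 2 * form_sum C 2 = of_nat (2 ^ CARD('n)) * form_sum A 2"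
    proof (rule split_block[OF A(1,2) _ R, of 2])
      show "{i, j} \<subseteq> I" using i j by simp
      show "2 * int 2 dvd x" if "8 dvd x" for x using that by presburger
    qed auto
    have "odd (minor_det {i, j} B * minor_det (I - {i, j}) C)"
      using A(3) split(6) by (metis cong_dvd_iff cong_dvd_modulus even_numeral)
    then have odd: "odd (minor_det (I - {i, j}) C)" by simp
    have "finite I" by simp
    then have card: "card I = card (I - {i, j}) + 2"
      using i j ij card_Diff_subset[of "{i, j}" I] card_mono[of I "{i, j}"] by simp
    have IH: "even (card (I - {i, j}))" "form_sum C 2 * of_real (sqrt 2) ^ card (I - {i, j})
        = of_nat (2 ^ CARD('n)) * of_int (kronecker_prime (minor_det (I - {i, j}) C) 2)"
      using less.hyps[OF _ split(4,5) odd] card by auto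
    have B: "2 * form_sum B 2 = of_nat (2 ^ CARD('n)) * of_int (kronecker_prime (minor_det {i, j} B) 2)"
      using form_sum_pair_2[OF split(1,2) ij] split(3) j by simp
    have \<chi>: "kronecker_prime (minor_det I A) 2
        = kronecker_prime (minor_det {i, j} B) 2 * kronecker_prime (minor_det (I - {i, j}) C) 2"
      using kronecker_prime_2_cong[OF split(6)] kronecker_prime_mult[OF two_is_prime_nat] by simp
    have sq: "complex_of_real (sqrt 2) ^ (m + 2) = 2 * of_real (sqrt 2) ^ m" for m
    proof -
      have "complex_of_real (sqrt 2) ^ 2 = 2"
        by (simp add: of_real_power[symmetric] del: of_real_power)
      then show ?thesis by (simp add: power_add power2_eq_square)
    qed
    let ?n = "of_nat (2 ^ CARD('n)) :: complex"
    have "?n * (form_sum A 2 * of_real (sqrt 2) ^ card I)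
        = (form_sum B 2 * form_sum C 2) * (2 * of_real (sqrt 2) ^ card (I - {i, j}))"
      unfolding split(7) card sq by (simp only: mult_ac)
    also have "\<dots> = (2 * form_sum B 2) * (form_sum C 2 * of_real (sqrt 2) ^ card (I - {i, j}))"
      by (simp only: mult_ac)
    also have "\<dots> = ?n * (?n * of_int (kronecker_prime (minor_det I A) 2))"
      unfolding B IH \<chi> by (simp add: mult_ac)
    finally have "form_sum A 2 * of_real (sqrt 2) ^ card I
        = ?n * of_int (kronecker_prime (minor_det I A) 2)"
      by simp
    then show ?thesis using IH(1) card by simp
  qed
qed

lemma form_sum_2:
  fixes A :: "int^'n^'n"
  assumes A: "even_form A" "odd (det A)"
  shows "even (CARD('n))"
    and "form_sum A 2 = of_real (sqrt 2) ^ CARD('n) * of_int (kronecker_prime (det A) 2)"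
proof -
  have "supp_on UNIV A" by (simp add: supp_on_def)
  note aux = form_sum_2_aux[OF A(1) this, unfolded minor_det_UNIV, OF A(2)]
  show "even (CARD('n))" using aux by simp
  have "complex_of_real (sqrt 2) * of_real (sqrt 2) = 2"
    by (simp only: of_real_mult[symmetric] real_sqrt_mult_self) simp
  then have "of_nat (2 ^ CARD('n)) = complex_of_real (sqrt 2) ^ CARD('n) * of_real (sqrt 2) ^ CARD('n)"
    by (simp add: power_mult_distrib[symmetric])
  then show "form_sum A 2 = of_real (sqrt 2) ^ CARD('n) * of_int (kronecker_prime (det A) 2)"
    using aux by (simp add: mult_ac)
qed

text \<open>The descent lowers the exponent by two, so there are two base cases; the symbol is a
  sign and is not affected by such a step.\<close>

lemma form_sum_power_of_2:
  fixes A :: "int^'n^'n"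
  assumes A: "even_form A" "odd (det A)"
  shows "form_sum A (2 ^ k) = of_real (sqrt (real (2 ^ k))) ^ CARD('n) * of_int (kronecker_prime
      (det A) 2 ^ k)"
proof (induction k rule: induct_nat_012)
  case 0
  then show ?case by (simp add: form_sum_1)
next
  case 1
  then show ?case using form_sum_2(2)[OF A] by simp
next
  case (ge2 k)
  have "coprime (det A) (int 2)" using A(2) by simp
  from form_sum_prime_power[OF A(1) two_is_prime_nat this, of k]
  have "form_sum A (2 ^ Suc (Suc k)) = of_nat (2 ^ CARD('n)) * form_sum A (2 ^ k)" by simp
  moreover have "complex_of_real (sqrt (real (2 ^ Suc (Suc k)))) = 2 * of_real (sqrt (real (2 ^ k)))"
  proof -
    have "sqrt (real (2 ^ Suc (Suc k))) = sqrt (2\<^sup>2 * real (2 ^ k))" by (simp add: power2_eq_square)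
    also have "\<dots> = 2 * sqrt (real (2 ^ k))" by (simp add: real_sqrt_mult)
    finally show ?thesis by simp
  qed
  moreover have "kronecker_prime (det A) 2 * kronecker_prime (det A) 2 = 1"
    using A(2) by (simp add: kronecker_prime_def)
  then have "kronecker_prime (det A) 2 ^ Suc (Suc k) = kronecker_prime (det A) 2 ^ k"
    by (simp add: mult.assoc[symmetric])
  ultimately show ?case using ge2.IH(1) by (simp add: power_mult_distrib del: power_Suc)
qed

text \<open>Up to the Kronecker symbol of the determinant, the sum of an even form to an odd modulus
  depends only on the modulus. Stating this as a relation between two forms makes it
  multiplicative in the modulus without any appeal to quadratic reciprocity.\<close>

definition det_governed :: "'n::finite itself \<Rightarrow> nat \<Rightarrow> bool" where
  "det_governed _ c \<longleftrightarrow> (\<forall>(A :: int^'n^'n) (B :: int^'n^'n). even_form A \<longrightarrow> even_form B \<longrightarrow>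
     coprime (det A) (int c) \<longrightarrow> coprime (det B) (int c) \<longrightarrow>
     form_sum A c * of_int (kronecker (det B) (int c))
         = form_sum B c * of_int (kronecker (det A) (int c)))"

text \<open>For exponent 1 both sums are the symbol of the determinant times quantities that depend
  on \<open>p\<close> and the dimension only. The nonzero factor (2/p)^n is cancelled at the end;
  higher exponents reduce by two.\<close>

lemma det_governed_prime_power:
  fixes p :: nat
  assumes p: "prime p" "p > 2"
  shows "det_governed TYPE('n::finite) (p ^ k)"
  unfolding det_governed_def
proof (intro allI impI)
  fix A B :: "int^'n^'n"
  assume AB: "even_form A" "even_form B" "coprime (det A) (int (p ^ k))" "coprime (det B) (int (p ^ k))"
  show "form_sum A (p ^ k) * of_int (kronecker (det B) (int (p ^ k)))
      = form_sum B (p ^ k) * of_int (kronecker (det A) (int (p ^ k)))"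
  proof (cases "k = 0")
    case True
    then show ?thesis by (simp add: form_sum_1)
  next
    case False
    then have cop: "coprime (det A) (int p)" "coprime (det B) (int p)" using AB by simp_all
    then have ndvd: "\<not> int p dvd det A" "\<not> int p dvd det B"
      using p by (metis coprime_absorb_left coprime_commute not_prime_unit prime_nat_int_transfer)+
    have K: "kronecker_prime a (int p) = Legendre a (int p)" for a
      using p by (simp add: kronecker_prime_def)
    have "form_sum A (p ^ k) * of_int (Legendre (det B) (int p) ^ k)
        = form_sum B (p ^ k) * of_int (Legendre (det A) (int p) ^ k)"
    proof (induction k rule: induct_nat_012)
      case 0
      then show ?case by (simp add: form_sum_1)
    next
      case 1
      let ?L = "\<lambda>a. complex_of_int (Legendre a (int p))"
      have "coprime 2 (int p)" using prime_odd_nat[OF p] by simp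
      then have "Legendre 2 (int p) \<noteq> 0"
        using p by (metis Legendre_eq_0_iff coprime_absorb_right not_prime_unit prime_nat_int_transfer)
      then have L2: "?L 2 ^ CARD('n) \<noteq> 0" by simp
      have "form_sum A p * ?L (det B) * ?L 2 ^ CARD('n) = ?L (det B) * (form_sum A p * ?L 2 ^ CARD('n))"
        by (simp only: mult_ac)
      also have "\<dots> = ?L (det A) * (form_sum B p * ?L 2 ^ CARD('n))"
        unfolding form_sum_odd_prime[OF p AB(1) ndvd(1)] form_sum_odd_prime[OF p AB(2) ndvd(2)]
        by (simp only: mult_ac)
      also have "\<dots> = form_sum B p * ?L (det A) * ?L 2 ^ CARD('n)"
        by (simp only: mult_ac)
      finally have "form_sum A p * ?L (det B) * ?L 2 ^ CARD('n)
          = form_sum B p * ?L (det A) * ?L 2 ^ CARD('n)" .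
      then show ?case using L2 by simp
    next
      case (ge2 k)
      have "Legendre (det A) (int p) ^ Suc (Suc k) = Legendre (det A) (int p) ^ k"
        "Legendre (det B) (int p) ^ Suc (Suc k) = Legendre (det B) (int p) ^ k"
        using Legendre_square[OF ndvd(1)] Legendre_square[OF ndvd(2)]
        by (simp_all add: mult.assoc[symmetric])
      moreover have "form_sum A (p ^ Suc (Suc k)) = of_nat (p ^ CARD('n)) * form_sum A (p ^ k)"
        "form_sum B (p ^ Suc (Suc k)) = of_nat (p ^ CARD('n)) * form_sum B (p ^ k)"
        using form_sum_prime_power[OF AB(1) p(1) cop(1), of k]
          form_sum_prime_power[OF AB(2) p(1) cop(2), of k] by simp_all
      ultimately show ?case by (simp only: mult.assoc ge2.IH(1))
    qed
    then show ?thesis by (simp only: kronecker_prime_power[OF p(1)] K)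
  qed
qed

text \<open>The splitting twists both forms by the same unit \<open>d\<close>, which multiplies both
  determinants by \<open>d ^ CARD('n)\<close>. The resulting symbol is a common nonzero factor and
  cancels from the relation.\<close>

lemma det_governed_coprime:
  assumes c: "det_governed TYPE('n::finite) c" and d: "det_governed TYPE('n) d"
    and pos: "c > 0" "d > 0" and cop: "coprime c d"
  shows "det_governed TYPE('n) (c * d)"
  unfolding det_governed_def
proof (intro allI impI)
  fix A B :: "int^'n^'n"
  assume AB: "even_form A" "even_form B" "coprime (det A) (int (c * d))" "coprime (det B) (int (c * d))"
  have twist: "form_sum (smat (int d) A) c * of_int (kronecker (det B) (int c))
      = form_sum (smat (int d) B) c * of_int (kronecker (det A) (int c))"
    if c: "det_governed TYPE('n) c" "c > 0" "coprime d c"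
      and cA: "coprime (det A) (int c)" and cB: "coprime (det B) (int c)" for c d
  proof -
    let ?k = "complex_of_int (kronecker (int d) (int c))"
    have "coprime (int d) (int c)" using c by simp
    from kronecker_square[OF c(2) this] have "kronecker (int d) (int c) \<noteq> 0" by auto
    then have k: "?k ^ CARD('n) \<noteq> 0" by simp
    have "coprime (det (smat (int d) A)) (int c)" "coprime (det (smat (int d) B)) (int c)"
      using c cA cB by (simp_all add: det_smat)
    then have "form_sum (smat (int d) A) c * of_int (kronecker (det (smat (int d) B)) (int c))
      = form_sum (smat (int d) B) c * of_int (kronecker (det (smat (int d) A)) (int c))"
      using c(1) even_form_smat[OF AB(1), of "int d"] even_form_smat[OF AB(2), of "int d"]
      unfolding det_governed_def by blast
    then have "?k ^ CARD('n) * (form_sum (smat (int d) A) c * of_int (kronecker (det B) (int c)))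
        = ?k ^ CARD('n) * (form_sum (smat (int d) B) c * of_int (kronecker (det A) (int c)))"
      using c by (simp add: det_smat kronecker_mult_left kronecker_power_left mult_ac)
    then show ?thesis using k by simp
  qed
  have 1: "form_sum (smat (int d) A) c * of_int (kronecker (det B) (int c))
      = form_sum (smat (int d) B) c * of_int (kronecker (det A) (int c))"
    by (rule twist) (use c pos cop AB in \<open>simp_all add: coprime_commute\<close>)
  have 2: "form_sum (smat (int c) A) d * of_int (kronecker (det B) (int d))
      = form_sum (smat (int c) B) d * of_int (kronecker (det A) (int d))"
    by (rule twist) (use d pos cop AB in \<open>simp_all add: coprime_commute\<close>)
  have "form_sum A (c * d) * of_int (kronecker (det B) (int (c * d)))
      = (form_sum (smat (int d) A) c * of_int (kronecker (det B) (int c)))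
        * (form_sum (smat (int c) A) d * of_int (kronecker (det B) (int d)))"
    unfolding form_sum_coprime[OF AB(1) pos cop] kronecker_mult_right[OF pos cop] by (simp add: mult_ac)
  also have "\<dots> = (form_sum (smat (int d) B) c * of_int (kronecker (det A) (int c)))
        * (form_sum (smat (int c) B) d * of_int (kronecker (det A) (int d)))"
    by (simp only: 1 2)
  also have "\<dots> = form_sum B (c * d) * of_int (kronecker (det A) (int (c * d)))"
    unfolding form_sum_coprime[OF AB(2) pos cop] kronecker_mult_right[OF pos cop] by (simp add: mult_ac)
  finally show "form_sum A (c * d) * of_int (kronecker (det B) (int (c * d)))
      = form_sum B (c * d) * of_int (kronecker (det A) (int (c * d)))" .
qed

text \<open>The full power of one prime is split off at each step, so that the cofactor is coprime
  to it.\<close>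

lemma det_governed_odd:
  assumes "odd c"
  shows "det_governed TYPE('n::finite) c"
  using assms
proof (induction c rule: less_induct)
  case (less c)
  show ?case
  proof (cases "c = 1")
    case True
    then show ?thesis by (simp add: det_governed_def form_sum_1)
  next
    case False
    then obtain p where p: "prime p" "p dvd c" using prime_factor_nat by blast
    have c0: "c > 0" using less.prems by (cases c) auto
    have "p \<noteq> 2" using p less.prems by auto
    then have p2: "p > 2" using prime_ge_2_nat[OF p(1)] by simp
    obtain d where d: "c = p ^ multiplicity p c * d" "\<not> p dvd d"
      using multiplicity_decompose'[of c p] c0 p(1) not_prime_unit by blast
    have m: "multiplicity p c > 0" using p c0 by (simp add: prime_multiplicity_gt_zero_iff)
    have d0: "d > 0" using d c0 by (cases d) auto
    have "1 < p ^ multiplicity p c" using m prime_gt_1_nat[OF p(1)] by (intro one_less_power)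
    then have "d * 1 < d * p ^ multiplicity p c" using d0 by (intro mult_strict_left_mono)
    also have "d * p ^ multiplicity p c = c" using d(1) by (metis mult.commute)
    finally have "d < c" by simp
    moreover have "odd d" using less.prems d(1) by (metis even_mult_iff)
    ultimately have "det_governed TYPE('n) d" by (rule less.IH)
    moreover have "coprime (p ^ multiplicity p c) d"
      using p(1) d(2) by (simp add: prime_imp_coprime)
    ultimately show ?thesis
      using det_governed_coprime[OF det_governed_prime_power[OF p(1) p2]] d0 prime_gt_0_nat[OF p(1)] d(1)
      by (metis zero_less_power)
  qed
qed

text \<open>For even \<open>c\<close>, a congruence modulo \<open>c\<close> need not fix the residue
  modulo 8 that the symbol at 2 reads.\<close>

lemma kronecker_odd_cong:
  assumes "odd c" "[a = b] (mod int c)"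
  shows "kronecker a (int c) = kronecker b (int c)"
proof -
  have c: "c > 0" using assms(1) by (cases c) auto
  have "kronecker_prime a (int p) = kronecker_prime b (int p)" if "p \<in> prime_factors c" for p
  proof -
    have p: "prime p" "p dvd c" using that by (auto simp: in_prime_factors_iff)
    then have "p \<noteq> 2" using assms(1) by auto
    moreover have "[a = b] (mod int p)" using assms(2) p(2) by (auto intro: cong_dvd_modulus)
    ultimately show ?thesis by (simp add: kronecker_prime_def Legendre_cong)
  qed
  then show ?thesis using c by (simp add: kronecker_eq_prod)
qed

lemma form_sum_odd:
  fixes A :: "int^'n^'n"
  assumes A: "even_form A" and c: "odd c" and cop: "coprime (det A) (int c)"
  shows "form_sum A c = of_int (kronecker (det A) (int c)) * of_real (sqrt (real c)) ^ CARD('n)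
    * unit_e (real CARD('n) * (1 - real c) / 8)"
proof -
  have c0: "c > 0" using c by (cases c) auto
  \<comment> \<open>The comparison form. For odd \<open>c\<close> the factor \<open>c + 1\<close> is
    even and is 1 modulo \<open>c\<close>, so the form is even, its determinant has symbol 1, and
    its sum is a power of \<open>half_gauss c\<close>.\<close>
  define E :: "int^'n^'n" where "E = smat (int c + 1) (mat 1)"
  have E: "even_form E"
    using c by (auto simp: E_def even_form_def transpose_eq_iff smat_def mat_def)
  have detE: "det E = (int c + 1) ^ CARD('n)" by (simp add: E_def det_smat)
  have cong1: "[int c + 1 = 1] (mod int c)" by (simp add: cong_iff_dvd_diff)
  have copE: "coprime (det E) (int c)"
    by (simp add: detE)
  have kE: "kronecker (det E) (int c) = 1"
    unfolding detE kronecker_power_left[OF c0] kronecker_odd_cong[OF c cong1]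
    by (simp add: kronecker_one_left c0)
  have "form_sum E c = (\<Sum>v\<in>(residue_box c :: (int^'n) set). \<Prod>i\<in>UNIV. unit_e (of_int (int ((c + 1)
      div 2) * (v $ i)\<^sup>2) / real c))"
    unfolding form_sum_def
  proof (rule sum.cong[OF refl])
    fix v :: "int^'n"
    have h: "int c + 1 = 2 * int ((c + 1) div 2)" using c by presburger
    have "vdot v (E *v v) = 2 * (int ((c + 1) div 2) * (\<Sum>i\<in>UNIV. (v $ i)\<^sup>2))"
      unfolding E_def smat_one_mult_vec vdot_scale_right h
      by (simp add: vdot_def power2_eq_square)
    then have "of_int (vdot v (E *v v)) / (2 * real c)
        = (\<Sum>i\<in>UNIV. of_int (int ((c + 1) div 2) * (v $ i)\<^sup>2) / real c)"
      by (simp only: of_int_mult of_int_numeral) (simp add: sum_divide_distrib sum_distrib_left)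
    then show "unit_e (of_int (vdot v (E *v v)) / (2 * real c))
        = (\<Prod>i\<in>UNIV. unit_e (of_int (int ((c + 1) div 2) * (v $ i)\<^sup>2) / real c))"
      by (simp only: unit_e_sum[OF finite])
  qed
  also have "\<dots> = half_gauss c ^ CARD('n)"
    using sum_box_prod[of "\<lambda>(_ :: 'n) x. unit_e (of_int (int ((c + 1) div 2) * x\<^sup>2) / real c)" c]
    by (simp add: half_gauss_def)
  also have "\<dots> = of_real (sqrt (real c)) ^ CARD('n) * unit_e (real CARD('n) * ((1 - real c) / 8))"
    unfolding half_gauss_eq[OF c] unit_e_of_nat_mult by (rule power_mult_distrib)
  finally have "form_sum E c = of_real (sqrt (real c)) ^ CARD('n) * unit_e (real CARD('n) * (1 -
      real c) / 8)"
    by simp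
  moreover have "form_sum A c * of_int (kronecker (det E) (int c))
      = form_sum E c * of_int (kronecker (det A) (int c))"
    using det_governed_odd[OF c, where 'n = 'n] A E cop copE unfolding det_governed_def by blast
  ultimately show ?thesis by (simp add: kE mult_ac)
qed

text \<open>For even \<open>c\<close> the determinant is odd, so the dimension is even. The twist by
  \<open>c\<^sub>0\<close> multiplies the determinant by an even power of an odd number, which is 1
  modulo 8, and the twist by \<open>2 ^ k\<close> brings in an even power of a sign. Thus neither
  twist shows, and the eighth root of unity comes from the odd part alone.\<close>

lemma form_sum_eq:
  fixes A :: "int^'n^'n"
  assumes A: "even_form A" and c: "c = 2 ^ k * c\<^sub>0" "odd c\<^sub>0" and cop: "coprime (det A) (int c)"
  shows "form_sum A c = of_int (kronecker (det A) (int c)) * of_real (sqrt (real c)) ^ CARD('n)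
    * unit_e (real CARD('n) * (1 - real c\<^sub>0) / 8)"
proof (cases "k = 0")
  case True
  then show ?thesis using form_sum_odd[OF A c(2)] cop c(1) by simp
next
  case False
  have c0: "c\<^sub>0 > 0" using c(2) by (cases c\<^sub>0) auto
  have odd: "odd (det A)" using cop c(1) False by simp
  have cop0: "coprime (det A) (int c\<^sub>0)" using cop c(1) by simp
  obtain n where n: "CARD('n) = 2 * n" using form_sum_2(1)[OF A odd] by blast
  have cop2: "coprime (2 ^ k) c\<^sub>0" using c(2) by simp
  have k1: "kronecker_prime (det (smat (int c\<^sub>0) A)) 2 = kronecker_prime (det A) 2"
  proof -
    have sq: "kronecker_prime (x ^ (2 * m)) 2 = 1" if "odd x" for x m
    proof -
      have "[(x\<^sup>2) ^ m = 1 ^ m] (mod 8)" by (intro cong_pow odd_square_cong_1 that)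
      from kronecker_prime_2_cong[OF this] show ?thesis
        by (simp add: power_mult kronecker_prime_def)
    qed
    show ?thesis
      using sq[of "int c\<^sub>0" n] c(2) kronecker_prime_mult[OF two_is_prime_nat]
      by (simp add: det_smat n)
  qed
  have k2: "kronecker (det (smat (int (2 ^ k)) A)) (int c\<^sub>0) = kronecker (det A) (int c\<^sub>0)"
  proof -
    have "kronecker (int (2 ^ k)) (int c\<^sub>0) * kronecker (int (2 ^ k)) (int c\<^sub>0) = 1"
      by (rule kronecker_square[OF c0]) (use c(2) in simp)
    then have "kronecker (int (2 ^ k)) (int c\<^sub>0) ^ (2 * n) = 1"
      by (simp add: power_mult power2_eq_square)
    then show ?thesis
      by (simp add: det_smat kronecker_mult_left[OF c0] kronecker_power_left[OF c0] n
          del: of_nat_power)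
  qed
  have 1: "form_sum (smat (int c\<^sub>0) A) (2 ^ k)
      = of_real (sqrt (real (2 ^ k))) ^ CARD('n) * of_int (kronecker_prime (det A) 2 ^ k)"
    using form_sum_power_of_2[OF even_form_smat[OF A], of "int c\<^sub>0" k] odd c(2) k1
    by (simp add: det_smat)
  have 2: "form_sum (smat (int (2 ^ k)) A) c\<^sub>0 = of_int (kronecker (det A) (int c\<^sub>0))
      * of_real (sqrt (real c\<^sub>0)) ^ CARD('n) * unit_e (real CARD('n) * (1 - real c\<^sub>0) / 8)"
    using form_sum_odd[OF even_form_smat[OF A, of "int (2 ^ k)"] c(2)] cop0 c(2)
    unfolding k2 by (simp add: det_smat)
  have kron: "kronecker (det A) (int c) = kronecker_prime (det A) 2 ^ k * kronecker (det A) (int c\<^sub>0)"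
    unfolding c(1) using kronecker_mult_right[OF _ c0 cop2] kronecker_prime_power[OF
        two_is_prime_nat, of _ k]
    by simp
  have "form_sum A c = form_sum (smat (int c\<^sub>0) A) (2 ^ k) * form_sum (smat (int (2 ^ k)) A) c\<^sub>0"
    unfolding c(1) by (rule form_sum_coprime[OF A _ c0 cop2]) simp
  then show ?thesis
    unfolding 1 2 kron unfolding c(1) by (simp add: real_sqrt_mult power_mult_distrib mult_ac)
qed

lemma form_sum_negate: "form_sum (smat (- 1) A) c = cnj (form_sum A c)"
proof -
  have "vdot v (smat (- 1) A *v v) = - vdot v (A *v v)" for v
    by (simp add: smat_mult_vec vdot_scale_right)
  then show ?thesis
    by (simp add: form_sum_def unit_e_minus[symmetric])
qed

text \<open>The sum for negative \<open>a\<close> is the conjugate of that for its absolute value.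
  Symbols and square roots are real, so only the sign in the exponent changes; this is the origin of
  \<open>sgn a\<close>.\<close>

lemma form_sum_scaled_eq:
  fixes A :: "int^'n^'n"
  assumes A: "even_form A" and c: "c = 2 ^ k * c\<^sub>0" "odd c\<^sub>0" "c > 0"
    and cop: "coprime (det A) (int c)" and a: "coprime a (int c)" "a \<noteq> 0"
  shows "form_sum (smat a A) c = of_int (kronecker \<bar>a\<bar> (int c)) ^ CARD('n) * of_int (kronecker
      (det A) (int c))
    * of_real (sqrt (real c)) ^ CARD('n) * unit_e (real CARD('n) * of_int (sgn a) * (1 - real c\<^sub>0) / 8)"
proof -
  have pos: "form_sum (smat \<bar>a\<bar> A) c = of_int (kronecker \<bar>a\<bar> (int c)) ^ CARD('n)
      * of_int (kronecker (det A) (int c)) * of_real (sqrt (real c)) ^ CARD('n)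
      * unit_e (real CARD('n) * (1 - real c\<^sub>0) / 8)"
    using form_sum_eq[OF even_form_smat[OF A, of "\<bar>a\<bar>"] c(1,2)] cop a c(3)
    by (simp add: det_smat kronecker_mult_left kronecker_power_left)
  show ?thesis
  proof (cases "a > 0")
    case True
    then show ?thesis using pos by simp
  next
    case False
    then have "smat a A = smat (- 1) (smat \<bar>a\<bar> A)" by (simp add: smat_def vec_eq_iff)
    then have "form_sum (smat a A) c = cnj (form_sum (smat \<bar>a\<bar> A) c)"
      by (simp only: form_sum_negate)
    then show ?thesis
      unfolding pos using False a by (simp add: unit_e_minus[symmetric])
  qed
qed

subsection \<open>Poisson summation over a subgroup\<close>

lemma complete_square:
  fixes A B :: "int^'n^'n"
  assumes A: "even_form A" and B: "even_form B" and AB: "A ** B = smat N (mat 1)"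
    and c: "c > 0" and a': "[a' * a * N = - 1] (mod int c)"
  shows "(\<Sum>v\<in>residue_box c. unit_e (of_int (a * vdot v (A *v v) + 2 * vdot z v) / (2 * real c)))
    = unit_e (of_int (a' * vdot z (B *v z)) / (2 * real c)) * form_sum (smat a A) c"
proof -
  define M where "M = smat a A"
  have M: "even_form M" unfolding M_def by (rule even_form_smat[OF A])
  \<comment> \<open>The shift that completes the square: a A y = -(a' a N) z is \<open>z\<close>
    modulo \<open>c\<close>. The leftover value at \<open>y\<close> is then -a' z^T B z, and as z^T
    B z is even this holds modulo 2c.\<close>
  define y where "y = (- a') *s (B *v z)"
  have My: "M *v y = (- (a' * a * N)) *s z"
    unfolding M_def y_def matrix_scale_vector matrix_vector_mul_assoc smat_mult_left AB
    by (simp add: smat_mult_vec vector_smult_assoc mult_ac)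
  obtain m where m: "vdot z (B *v z) = 2 * m" using even_quadratic[OF B] by blast
  obtain k where k: "a' * a * N = - 1 + int c * k"
    using a' by (metis cong_iff_lin cong_sym)
  let ?F = "\<lambda>v. unit_e (of_int (vdot v (M *v v)) / (2 * real c))"
  have term_eq: "unit_e (of_int (a * vdot v (A *v v) + 2 * vdot z v) / (2 * real c))
      = unit_e (of_int (a' * vdot z (B *v z)) / (2 * real c)) * ?F (v + y)" for v
  proof -
    have yMy: "vdot y (M *v y) = a' * (a' * a * N) * (2 * m)"
      unfolding My by (simp add: y_def vdot_scale_left vdot_scale_right vdot_commute[of "B *v z"]
          m mult_ac)
    have vMy: "vdot v (M *v y) = - (a' * a * N) * vdot z v"
      unfolding My by (simp add: vdot_scale_right vdot_commute)
    have "vdot (v + y) (M *v (v + y)) = vdot y (M *v y) + 2 * vdot v (M *v y) + vdot v (M *v v)"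
      unfolding add.commute[of v y] by (rule vdot_quadratic_add[OF even_formD(1)[OF M]])
    also have "\<dots> = a * vdot v (A *v v) + 2 * vdot z v - a' * (2 * m)
        + 2 * int c * (a' * k * m - k * vdot z v)"
      unfolding yMy vMy k by (simp add: M_def smat_mult_vec vdot_scale_right algebra_simps)
    finally have "a * vdot v (A *v v) + 2 * vdot z v
        - (a' * vdot z (B *v z) + vdot (v + y) (M *v (v + y))) = 2 * int c * (k * vdot z v - a' * k * m)"
      unfolding m by (simp add: algebra_simps)
    then have "unit_e (of_int (a * vdot v (A *v v) + 2 * vdot z v) / (2 * real c))
        = unit_e (of_int (a' * vdot z (B *v z) + vdot (v + y) (M *v (v + y))) / (2 * real c))"
      by (intro unit_e_cong_half) simp
    then show ?thesis by (simp add: add_divide_distrib unit_e_add)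
  qed
  have "(\<Sum>v\<in>residue_box c. ?F (v + y)) = form_sum M c"
    unfolding form_sum_def by (rule sum_box_translate[OF c periodic_form[OF M]])
  then show ?thesis
    unfolding term_eq M_def[symmetric] by (simp add: sum_distrib_left[symmetric])
qed

text \<open>Representatives of a subgroup of the residue group; closure under negation follows by
  finiteness.\<close>

definition box_subgroup :: "nat \<Rightarrow> (int^'n) set \<Rightarrow> bool" where
  "box_subgroup c H \<longleftrightarrow> H \<subseteq> residue_box c \<and> 0 \<in> H \<and> (\<forall>u\<in>H. \<forall>v\<in>H. vec_mod c (u + v) \<in> H)"

definition box_perp :: "nat \<Rightarrow> (int^'n) set \<Rightarrow> (int^'n) set" where
  "box_perp c H = {u \<in> residue_box c. \<forall>h\<in>H. int c dvd vdot u h}"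

text \<open>Translation by an element \<open>t\<close> on which the character is nontrivial, reduced
  modulo \<open>c\<close>, is an injective map of the finite set \<open>H\<close> to itself, hence a
  permutation.\<close>

lemma sum_subgroup_character:
  fixes H :: "(int^'n) set"
  assumes H: "box_subgroup c H" and c: "c > 0"
  shows "(\<Sum>h\<in>H. unit_e (of_int (vdot u h) / real c))
    = (if \<forall>h\<in>H. int c dvd vdot u h then of_nat (card H) else 0)"
proof (cases "\<forall>h\<in>H. int c dvd vdot u h")
  case True
  have "unit_e (of_int (vdot u h) / real c) = 1" if "h \<in> H" for h
    using unit_e_cong[of "vdot u h" 0 c] True that by (simp add: cong_0_iff)
  then show ?thesis using True by simp
next
  case False
  then obtain t where t: "t \<in> H" "\<not> int c dvd vdot u t" by blast
  have fin: "finite H" using H by (auto simp: box_subgroup_def intro: finite_subset)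
  have sub: "H \<subseteq> residue_box c" and closed: "\<And>h. h \<in> H \<Longrightarrow> vec_mod c (h + t) \<in> H"
    using H t by (auto simp: box_subgroup_def)
  let ?f = "\<lambda>h. unit_e (of_int (vdot u h) / real c)"
  have per: "?f (vec_mod c h) = ?f h" for h
    by (intro unit_e_cong vec_cong_vdot) simp
  have "inj_on (\<lambda>h. vec_mod c (h + t)) H"
  proof (rule inj_onI)
    fix h h' assume hh: "h \<in> H" "h' \<in> H" "vec_mod c (h + t) = vec_mod c (h' + t)"
    then have "vec_cong c (h + t) (h' + t)" by (simp add: vec_mod_eq_iff)
    then have "vec_cong c (h + t + - t) (h' + t + - t)" by (rule vec_cong_add) simp
    then have "vec_cong c h h'" by simp
    then show "h = h'" using hh sub by (intro box_vec_cong_eq) auto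
  qed
  moreover have "(\<lambda>h. vec_mod c (h + t)) ` H = H"
    using closed fin calculation by (intro card_subset_eq) (auto simp: card_image)
  ultimately have "(\<Sum>h\<in>H. ?f h) = (\<Sum>h\<in>H. ?f (vec_mod c (h + t)))"
    by (metis (no_types, lifting) sum.reindex_cong)
  also have "\<dots> = (\<Sum>h\<in>H. ?f h * ?f t)"
    unfolding per by (simp add: vdot_add_right add_divide_distrib unit_e_add)
  also have "\<dots> = (\<Sum>h\<in>H. ?f h) * ?f t" by (rule sum_distrib_right[symmetric])
  finally have "(\<Sum>h\<in>H. ?f h) * (1 - ?f t) = 0" by (simp add: right_diff_distrib)
  moreover have "?f t \<noteq> 1"
  proof
    assume "?f t = 1"
    then obtain m :: int where "of_int (vdot u t) / real c = of_int m"
      by (auto simp only: unit_e_eq_1_iff elim: Ints_cases)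
    then have "of_int (vdot u t) = (of_int (m * int c) :: real)"
      using c by (simp add: field_simps)
    then have "vdot u t = m * int c" by (simp only: of_int_eq_iff)
    then show False using t by simp
  qed
  ultimately have "(\<Sum>h\<in>H. ?f h) = 0" by simp
  then show ?thesis by (simp only: False if_False)
qed

text \<open>The indicator of \<open>box_perp c H\<close> is a character sum over \<open>H\<close>,
  so \<open>u\<close> may run over the whole box, where orthogonality singles out
  \<open>v = h\<close>.\<close>

lemma poisson_subgroup:
  fixes H :: "(int^'n) set" and f :: "int^'n \<Rightarrow> complex"
  assumes H: "box_subgroup c H" and c: "c > 0"
  shows "of_nat (card H) * (\<Sum>u\<in>box_perp c H. \<Sum>v\<in>residue_box c. f v * unit_e (of_int (- vdot u v) /
      real c))
    = of_nat (c ^ CARD('n)) * (\<Sum>h\<in>H. f h)"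
proof -
  let ?e = "\<lambda>k. unit_e (of_int k / real c)"
  let ?F = "\<lambda>u. \<Sum>v\<in>residue_box c. f v * ?e (- vdot u v)"
  have sub: "H \<subseteq> residue_box c" using H by (simp add: box_subgroup_def)
  have "of_nat (card H) * (\<Sum>u\<in>box_perp c H. ?F u)
      = (\<Sum>u\<in>residue_box c. if \<forall>h\<in>H. int c dvd vdot u h then of_nat (card H) * ?F u else 0)"
    unfolding box_perp_def by (subst sum.inter_filter[symmetric]) (simp_all add: sum_distrib_left)
  also have "\<dots> = (\<Sum>u\<in>residue_box c. (\<Sum>h\<in>H. ?e (vdot u h)) * ?F u)"
    unfolding sum_subgroup_character[OF H c] by (rule sum.cong) auto
  also have "\<dots> = (\<Sum>u\<in>residue_box c. \<Sum>h\<in>H. \<Sum>v\<in>residue_box c. f v * ?e (vdot u (h - v)))"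
  proof (rule sum.cong[OF refl])
    fix u :: "int^'n"
    have "?e (vdot u h) * (f v * ?e (- vdot u v)) = f v * ?e (vdot u (h - v))" for h v
    proof -
      have "vdot u (h - v) = vdot u h + - vdot u v"
        using vdot_add_right[of u h "- v"] by (simp add: vdot_minus_right)
      then have "?e (vdot u (h - v)) = ?e (vdot u h) * ?e (- vdot u v)"
        by (simp only: of_int_add add_divide_distrib unit_e_add)
      then show ?thesis by simp
    qed
    then show "(\<Sum>h\<in>H. ?e (vdot u h)) * ?F u
        = (\<Sum>h\<in>H. \<Sum>v\<in>residue_box c. f v * ?e (vdot u (h - v)))"
      by (simp only: sum_product)
  qed
  also have "\<dots> = (\<Sum>h\<in>H. \<Sum>u\<in>residue_box c. \<Sum>v\<in>residue_box c. f v * ?e (vdot u (h - v)))"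
    by (rule sum.swap)
  also have "\<dots> = (\<Sum>h\<in>H. of_nat (c ^ CARD('n)) * f h)"
  proof (rule sum.cong[OF refl])
    fix h assume "h \<in> H"
    then have h: "h \<in> residue_box c" using sub by blast
    have "(\<Sum>u\<in>residue_box c. \<Sum>v\<in>residue_box c. f v * ?e (vdot u (h - v)))
        = (\<Sum>v\<in>residue_box c. f v * (\<Sum>u\<in>residue_box c. ?e (vdot u (h - v))))"
      by (subst sum.swap) (simp only: sum_distrib_left)
    also have "\<dots> = (\<Sum>v\<in>residue_box c. if v = h then of_nat (c ^ CARD('n)) * f h else 0)"
    proof (rule sum.cong[OF refl])
      fix v :: "int^'n" assume v: "v \<in> residue_box c"
      have "vec_cong c (h - v) 0 \<longleftrightarrow> vec_cong c v h"
        by (auto simp: vec_cong_def cong_iff_dvd_diff dvd_diff_commute)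
      also have "\<dots> \<longleftrightarrow> v = h" using box_vec_cong_eq[OF v h] by auto
      finally show "f v * (\<Sum>u\<in>residue_box c. ?e (vdot u (h - v)))
          = (if v = h then of_nat (c ^ CARD('n)) * f h else 0)"
        unfolding sum_box_character[OF c] by simp
    qed
    also have "\<dots> = of_nat (c ^ CARD('n)) * f h" using h by simp
    finally show "(\<Sum>u\<in>residue_box c. \<Sum>v\<in>residue_box c. f v * ?e (vdot u (h - v)))
        = of_nat (c ^ CARD('n)) * f h" .
  qed
  finally show ?thesis by (simp only: sum_distrib_left)
qed

text \<open>Poisson summation for the indicator of the zero vector, whose transform is constantly
  1.\<close>

lemma card_box_perp:
  fixes H :: "(int^'n) set"
  assumes H: "box_subgroup c H" and c: "c > 0"
  shows "card H * card (box_perp c H) = c ^ CARD('n)"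
proof -
  let ?f = "\<lambda>v :: int^'n. if v = 0 then 1 else 0 :: complex"
  have 0: "(0 :: int^'n) \<in> residue_box c" "0 \<in> H" "finite H"
    using H finite_subset[OF _ finite_box, of H c] unfolding box_subgroup_def by auto
  have "(\<Sum>v\<in>residue_box c. ?f v * unit_e (of_int (- vdot u v) / real c)) = 1" for u
  proof -
    have "(\<Sum>v\<in>residue_box c. ?f v * unit_e (of_int (- vdot u v) / real c))
        = (\<Sum>v\<in>residue_box c. if v = (0 :: int^'n) then 1 else 0)"
      by (rule sum.cong) auto
    then show ?thesis using 0 by simp
  qed
  moreover have "(\<Sum>h\<in>H. ?f h) = 1" using 0 by simp
  ultimately have "complex_of_nat (card H * card (box_perp c H)) = of_nat (c ^ CARD('n))"
    using poisson_subgroup[OF H c, of ?f] by simp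
  then show ?thesis by (simp only: of_nat_eq_iff)
qed

text \<open>The duality in terms of integers: \<open>x\<close> stands for G w, the phase of w^T G w
  common to all terms has been removed, and \<sigma> is the normalised complete sum.\<close>

lemma subgroup_duality:
  fixes A B :: "int^'n^'n" and H :: "(int^'n) set"
  assumes A: "even_form A" and B: "even_form B" and AB: "A ** B = smat N (mat 1)"
    and c: "c > 0" and a': "[a' * a * N = - 1] (mod int c)"
    and H: "box_subgroup c H"
    and S: "form_sum (smat a A) c = \<sigma> * of_real (sqrt (real c)) ^ CARD('n)"
  shows "1 / of_real (sqrt (real (card H)))
      * (\<Sum>h\<in>H. unit_e (of_int (a * vdot h (A *v h) + 2 * vdot (a *s x) h) / (2 * real c)))
    = \<sigma> * (1 / of_real (sqrt (real (card (box_perp c H))))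
      * (\<Sum>u\<in>box_perp c H. unit_e (of_int (a' * vdot (u - a *s x) (B *v (u - a *s x))) / (2 * real c))))"
proof -
  let ?f = "\<lambda>v. unit_e (of_int (a * vdot v (A *v v) + 2 * vdot (a *s x) v) / (2 * real c))"
  let ?F = "\<lambda>u. unit_e (of_int (a' * vdot (u - a *s x) (B *v (u - a *s x))) / (2 * real c))"
  let ?h = "card H" and ?k = "card (box_perp c H)"
  define r where "r = complex_of_real (sqrt (real c)) ^ CARD('n)"
  have transform: "(\<Sum>v\<in>residue_box c. ?f v * unit_e (of_int (- vdot u v) / real c))
      = ?F u * (\<sigma> * r)" for u
  proof -
    \<comment> \<open>The total linear coefficient: a x from the shift of the form and -u from the
      character. The form of \<open>B\<close> takes the same value at \<open>z\<close> and
      \<open>-z\<close>.\<close>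
    define z where "z = - (u - a *s x)"
    have "?f v * unit_e (of_int (- vdot u v) / real c)
        = unit_e (of_int (a * vdot v (A *v v) + 2 * vdot z v) / (2 * real c))" for v
    proof -
      have z: "vdot z v = vdot (a *s x) v + - vdot u v"
        using vdot_add_left[of "a *s x" "- u" v] by (simp add: z_def vdot_minus_left)
      have "of_int (a * vdot v (A *v v) + 2 * vdot z v) / (2 * real c)
          = of_int (a * vdot v (A *v v) + 2 * vdot (a *s x) v) / (2 * real c) + of_int (- vdot u
              v) / real c"
        unfolding z using c by (simp add: field_simps)
      then show ?thesis by (simp only: unit_e_add)
    qed
    moreover have "vdot z (B *v z) = vdot (u - a *s x) (B *v (u - a *s x))"
    proof -
      have Bz: "B *v z = - (B *v (u - a *s x))"
        by (simp add: z_def matrix_vector_mult_diff_distrib)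
      show ?thesis
        unfolding Bz unfolding z_def vdot_minus_left vdot_minus_right by simp
    qed
    ultimately show ?thesis
      using complete_square[OF A B AB c a', of z] by (simp add: S r_def)
  qed
  have P: "of_nat ?h * ((\<Sum>u\<in>box_perp c H. ?F u) * (\<sigma> * r)) = of_nat (c ^ CARD('n)) * (\<Sum>h\<in>H. ?f h)"
    using poisson_subgroup[OF H c, of ?f] unfolding transform by (simp only: sum_distrib_right)
  have rr: "r * r = of_nat (c ^ CARD('n))"
    by (simp add: r_def power_mult_distrib[symmetric] of_real_mult[symmetric] del: of_real_mult)
  have r0: "r \<noteq> 0" using c by (simp add: r_def)
  have card: "?h * ?k = c ^ CARD('n)" by (rule card_box_perp[OF H c])
  then have pos: "?h > 0" "?k > 0" using c
      by (metis gr0I mult_0 mult_0_right power_not_zero less_numeral_extra(3))+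
  \<comment> \<open>The symmetric normalisation arises here: the complete sum has the factor
    \<open>sqrt c ^ CARD('n)\<close>, and \<open>c ^ CARD('n)\<close> is the product of the orders
    of \<open>H\<close> and its orthogonal.\<close>
  have rhk: "r = of_real (sqrt (real ?h)) * of_real (sqrt (real ?k))"
  proof -
    have "sqrt (real c) ^ CARD('n) = sqrt (real (c ^ CARD('n)))" by (simp add: real_sqrt_power)
    also have "\<dots> = sqrt (real ?h) * sqrt (real ?k)" by (simp add: card[symmetric] real_sqrt_mult)
    finally have "complex_of_real (sqrt (real c) ^ CARD('n))
        = of_real (sqrt (real ?h) * sqrt (real ?k))" by simp
    then show ?thesis by (simp add: r_def)
  qed
  define s where "s = complex_of_real (sqrt (real ?h))"
  define t where "t = complex_of_real (sqrt (real ?k))"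
  have st: "s \<noteq> 0" "t \<noteq> 0" "s * s = of_nat ?h" "r = s * t"
    using pos by (simp_all add: s_def t_def rhk of_real_mult[symmetric] del: of_real_mult)
  have "r * (of_nat ?h * (\<sigma> * (\<Sum>u\<in>box_perp c H. ?F u))) = r * (r * (\<Sum>h\<in>H. ?f h))"
    using P unfolding rr[symmetric] by (simp only: mult_ac)
  then have "s * s * (\<sigma> * (\<Sum>u\<in>box_perp c H. ?F u)) = s * t * (\<Sum>h\<in>H. ?f h)"
    using r0 st by simp
  then have "(\<Sum>h\<in>H. ?f h) = s * (\<sigma> * (\<Sum>u\<in>box_perp c H. ?F u)) / t"
    using st(1,2) by (simp add: field_simps)
  then show ?thesis
    unfolding s_def[symmetric] t_def[symmetric] using st(1) by simp
qed

section \<open>Residue classes and their representatives in the box\<close>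

definition residue_class :: "nat \<Rightarrow> int^'n \<Rightarrow> (int^'n) set" where
  "residue_class c x = {v. vec_cong c v x}"

lemma residue_class_eq_iff: "residue_class c x = residue_class c y \<longleftrightarrow> vec_cong c x y"
  unfolding residue_class_def
  by (auto intro: vec_cong_trans vec_cong_sym dest: equalityD1 elim: vec_cong_trans)

lemma residue_class_coset: "(\<Union>h\<in>multiples_lattice c. {h + x}) = residue_class c x"
proof (intro equalityI subsetI)
  fix v assume "v \<in> residue_class c x"
  then have "v - x \<in> multiples_lattice c"
    by (simp add: residue_class_def vec_cong_def multiples_lattice_def cong_iff_dvd_diff)
  then show "v \<in> (\<Union>h\<in>multiples_lattice c. {h + x})"
    by (intro UN_I[of "v - x"]) auto
qed (auto simp: residue_class_def vec_cong_def multiples_lattice_def cong_iff_dvd_diff)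

lemma carrier_residue_group: "carrier (residue_group c) = range (residue_class c)"
  by (simp add: residue_group_def FactGroup_def RCOSETS_def r_coset_def int_vec_group_def
      residue_class_coset) blast

lemma one_residue_group: "\<one>\<^bsub>residue_group c\<^esub> = residue_class c 0"
  using residue_class_coset[of 0 c] by (simp add: residue_group_def FactGroup_def)

lemma mult_residue_group:
  "residue_class c x \<otimes>\<^bsub>residue_group c\<^esub> residue_class c y = residue_class c (x + y)"
proof -
  have "(\<Union>h\<in>residue_class c x. \<Union>k\<in>residue_class c y. {h + k}) = residue_class c (x + y)"
  proof (intro equalityI subsetI)
    fix v assume "v \<in> residue_class c (x + y)"
    then have "v - y \<in> residue_class c x"
      by (simp add: residue_class_def vec_cong_def cong_iff_dvd_diff algebra_simps)
    moreover have "y \<in> residue_class c y" by (simp add: residue_class_def)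
    ultimately show "v \<in> (\<Union>h\<in>residue_class c x. \<Union>k\<in>residue_class c y. {h + k})"
      by (intro UN_I[of "v - y"] UN_I[of y]) auto
  qed (auto simp: residue_class_def intro: vec_cong_add)
  then show ?thesis
    by (simp add: residue_group_def FactGroup_def set_mult_def int_vec_group_def)
qed

lemma bij_betw_residue_class:
  assumes H: "H \<subseteq> carrier (residue_group c)" and c: "c > 0"
  shows "bij_betw (residue_class c) {v \<in> residue_box c. residue_class c v \<in> H} H"
  unfolding bij_betw_def
proof (intro conjI equalityI subsetI)
  show "inj_on (residue_class c) {v \<in> residue_box c. residue_class c v \<in> H}"
    by (auto simp: inj_on_def residue_class_eq_iff intro: box_vec_cong_eq)
  fix V assume V: "V \<in> H"
  then obtain x where x: "V = residue_class c x" using H by (auto simp: carrier_residue_group)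
  also have "\<dots> = residue_class c (vec_mod c x)" by (simp add: residue_class_eq_iff)
  finally have eq: "V = residue_class c (vec_mod c x)" .
  show "V \<in> residue_class c ` {v \<in> residue_box c. residue_class c v \<in> H}"
    using V c unfolding eq by (intro imageI) simp
qed auto

text \<open>Exchanges the representatives picked by \<open>SOME\<close> for those in the box, which
  is where Poisson summation takes place.\<close>

lemma gauss_sum_box:
  fixes M :: "real^'n^'n"
  assumes M: "even_integral M" "transpose M = M" and u: "\<And>i. (M *v u) $ i \<in> \<int>"
    and c: "c > 0" and S: "S \<subseteq> carrier (residue_group c)"
  shows "gauss_sum M S (of_int a / real c) u = (\<Sum>v\<in>{v \<in> residue_box c. residue_class c v \<in> S}.
    unit_e (of_int a / real c * (1/2 * ((real_vec v + u) \<bullet> (M *v (real_vec v + u))))))"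
proof -
  let ?T = "{v \<in> residue_box c. residue_class c v \<in> S}"
  define s where "s = inv_into ?T (residue_class c)"
  note bij = bij_betw_residue_class[OF S c]
  have s: "s (residue_class c v) = v" if "v \<in> ?T" for v
    unfolding s_def using that bij by (intro inv_into_f_f) (auto simp: bij_betw_def)
  have mem: "s V \<in> V" if V: "V \<in> S" for V
  proof -
    obtain v where "v \<in> ?T" "V = residue_class c v"
      using V bij by (auto simp: bij_betw_def)
    then show ?thesis using s by (simp add: residue_class_def)
  qed
  have "gauss_sum M S (of_int a / real c) u = (\<Sum>V\<in>S.
      unit_e (of_int a / real c * (1/2 * ((real_vec (s V) + u) \<bullet> (M *v (real_vec (s V) + u))))))"
    unfolding unit_e_def by (rule gauss_sum_eq_representatives[OF M u c S mem])
  also have "\<dots> = (\<Sum>v\<in>?T. unit_e (of_int a / real c * (1/2 *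
      ((real_vec (s (residue_class c v)) + u) \<bullet> (M *v (real_vec (s (residue_class c v)) + u))))))"
    by (rule sum.reindex_bij_betw[OF bij, symmetric])
  also have "\<dots> = (\<Sum>v\<in>?T. unit_e (of_int a / real c * (1/2 * ((real_vec v + u) \<bullet> (M *v (real_vec v
      + u))))))"
    by (rule sum.cong) (simp_all only: s)
  finally show ?thesis .
qed

lemma box_subgroup_residue:
  fixes H :: "(int^'n) set set"
  assumes H: "subgroup H (residue_group c)" and c: "c > 0"
  shows "box_subgroup c {v \<in> residue_box c. residue_class c v \<in> H}"
proof -
  have "residue_class c (vec_mod c (u + v)) \<in> H"
    if "residue_class c u \<in> H" "residue_class c v \<in> H" for u v :: "int^'n"
  proof -
    have "residue_class c (vec_mod c (u + v)) = residue_class c (u + v)"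
      by (simp add: residue_class_eq_iff)
    then show ?thesis
      using subgroup.m_closed[OF H that] by (simp add: mult_residue_group)
  qed
  moreover have "residue_class c 0 \<in> H"
    using subgroup.one_closed[OF H] by (simp add: one_residue_group)
  moreover have "(0 :: int^'n) \<in> residue_box c" using c by (simp add: residue_box_def)
  ultimately show ?thesis using c by (auto simp: box_subgroup_def)
qed

text \<open>\<open>perp\<close> quantifies over all representatives of both classes; divisibility by
  \<open>c\<close> depends on the classes alone, so one representative of each suffices.\<close>

lemma box_perp_residue:
  fixes H :: "(int^'n) set set"
  assumes H: "H \<subseteq> carrier (residue_group c)" and c: "c > 0"
  shows "{v \<in> residue_box c. residue_class c v \<in> perp c H}
    = box_perp c {v \<in> residue_box c. residue_class c v \<in> H}"
proof -
  have "residue_class c u \<in> perp c H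
      \<longleftrightarrow> (\<forall>h\<in>{v \<in> residue_box c. residue_class c v \<in> H}. int c dvd vdot u h)"
    (is "?l \<longleftrightarrow> ?r") for u :: "int^'n"
  proof
    assume ?l
    then show ?r
      by (auto simp: perp_def vdot_def residue_class_def cong_0_iff)
  next
    assume r: ?r
    have "[vdot v h = 0] (mod int c)" if "U \<in> H" "v \<in> residue_class c u" "h \<in> U" for U v h
    proof -
      obtain x where "x \<in> {v \<in> residue_box c. residue_class c v \<in> H}" "U = residue_class c x"
        using bij_betw_residue_class[OF H c] \<open>U \<in> H\<close> by (auto simp: bij_betw_def)
      then have x: "int c dvd vdot u x" "vec_cong c h x" using r \<open>h \<in> U\<close>
          by (auto simp: residue_class_def)
      have "[vdot v h = vdot v x] (mod int c)" by (rule vec_cong_vdot[OF x(2)])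
      also have "[vdot v x = vdot u x] (mod int c)"
        unfolding vdot_commute[of _ x]
        by (rule vec_cong_vdot) (use \<open>v \<in> residue_class c u\<close> in \<open>simp add: residue_class_def\<close>)
      also have "[vdot u x = 0] (mod int c)" using x(1) by (simp add: cong_0_iff)
      finally show ?thesis .
    qed
    then show ?l by (auto simp: perp_def carrier_residue_group vdot_def)
  qed
  then show ?thesis by (auto simp: box_perp_def)
qed

section \<open>From real matrices to integer matrices; the level\<close>

lemma even_integral_imp_real_mat:
  fixes G :: "real^'n^'n"
  assumes "even_integral G" "transpose G = G"
  obtains A where "G = real_mat A" "even_form A"
proof -
  define A :: "int^'n^'n" where "A = (\<chi> i j. \<lfloor>G $ i $ j\<rfloor>)"
  have entries: "G $ i $ j = of_int (A $ i $ j)" for i j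
    using assms(1) by (simp add: A_def even_integral_def)
  then have G: "G = real_mat A" by (simp add: real_mat_def vec_eq_iff)
  have "A $ i $ j = A $ j $ i" for i j
  proof -
    have "G $ i $ j = G $ j $ i" using assms(2) by (metis transpose_def vec_lambda_beta)
    then show ?thesis by (simp add: A_def)
  qed
  moreover have "even (A $ i $ i)" for i
  proof -
    obtain k :: int where "G $ i $ i = 2 * of_int k"
      using assms(1) unfolding even_integral_def by blast
    then have "of_int (A $ i $ i) = (of_int (2 * k) :: real)" by (simp add: entries)
    then have "A $ i $ i = 2 * k" by (simp only: of_int_eq_iff)
    then show ?thesis by simp
  qed
  ultimately have "even_form A" by (simp add: even_form_def transpose_eq_iff)
  with G show ?thesis by (rule that)
qed

lemma real_mat_mult: "real_mat A ** real_mat B = real_mat (A ** B)"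
  by (simp add: real_mat_def matrix_matrix_mult_def vec_eq_iff)

lemma real_mat_inject: "real_mat A = real_mat B \<longleftrightarrow> A = B"
  by (simp add: real_mat_def vec_eq_iff)

lemma real_mat_scalar: "k *\<^sub>R mat 1 = real_mat (smat m (mat 1))" if "k = of_int m"
  using that by (simp add: real_mat_def smat_def mat_def vec_eq_iff)

text \<open>\<open>LEAST\<close> is informative only once an admissible number is known. Twice the
  absolute value of the determinant is one: the determinant times the inverse is the integral
  adjugate, and the factor 2 makes the diagonal even.\<close>

lemma level_correct:
  fixes A :: "int^'n^'n"
  assumes inv: "invertible (real_mat A)"
  shows "level (real_mat A) > 0"
    "even_integral (real (level (real_mat A)) *\<^sub>R matrix_inv (real_mat A))"
proof -
  let ?G = "real_mat A"
  have GI: "matrix_inv ?G ** ?G = mat 1"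
    using someI_ex[OF inv[unfolded invertible_def]] by (simp add: matrix_inv_def)
  have D: "det A \<noteq> 0"
    using inv by (simp add: invertible_det_nz det_real_mat)
  then obtain B where AB: "A ** B = smat (det A) (mat 1)" by (rule int_adjugate)
  have "real_mat B = matrix_inv ?G ** (?G ** real_mat B)"
    by (simp add: matrix_mul_assoc GI)
  also have "?G ** real_mat B = of_int (det A) *\<^sub>R mat 1"
    by (simp add: real_mat_mult AB real_mat_scalar)
  also have "matrix_inv ?G ** (of_int (det A) *\<^sub>R mat 1) = of_int (det A) *\<^sub>R matrix_inv ?G"
    by (simp add: matrix_scalar_ac scalar_matrix_assoc[symmetric])
  finally have B: "of_int (det A) *\<^sub>R matrix_inv ?G = real_mat B" by simp
  have "even_integral (real (nat (2 * \<bar>det A\<bar>)) *\<^sub>R matrix_inv ?G)"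
  proof -
    have entry: "(real (nat (2 * \<bar>det A\<bar>)) *\<^sub>R matrix_inv ?G) $ i $ j
        = 2 * of_int (sgn (det A) * B $ i $ j)" for i j
    proof -
      have "of_int (det A) * matrix_inv ?G $ i $ j = of_int (B $ i $ j)"
        using B[unfolded vec_eq_iff, rule_format, of i j] by (simp add: real_mat_def)
      moreover have "real (nat (2 * \<bar>det A\<bar>)) = 2 * (of_int (sgn (det A)) * of_int (det A))"
      proof -
        have "\<bar>det A\<bar> = sgn (det A) * det A" by (simp add: abs_sgn mult.commute)
        then show ?thesis by (simp flip: of_int_mult)
      qed
      ultimately show ?thesis by simp
    qed
    show ?thesis
      unfolding even_integral_def entry by (metis Ints_mult Ints_numeral Ints_of_int)
  qed
  then have "nat (2 * \<bar>det A\<bar>) > 0 \<and> even_integral (real (nat (2 * \<bar>det A\<bar>)) *\<^sub>R matrix_inv ?G)"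
    using D by simp
  from LeastI[of "\<lambda>N. N > 0 \<and> even_integral (real N *\<^sub>R matrix_inv ?G)", OF this]
  show "level ?G > 0" "even_integral (real (level ?G) *\<^sub>R matrix_inv ?G)"
    by (simp_all add: level_def)
qed

lemma matrix_scaleR_mult:
  fixes A B :: "real^'n^'n"
  shows "A ** (k *\<^sub>R B) = k *\<^sub>R (A ** B)" "(k *\<^sub>R A) ** B = k *\<^sub>R (A ** B)"
  by (simp_all add: matrix_matrix_mult_def vec_eq_iff sum_distrib_left mult_ac)

theorem theorem1p3:
  fixes G G_perp :: "real^'n^'n" and w :: "real^'n"
    and N c c\<^sub>0 k :: nat and D a a_perp :: int
    and H :: "(int^'n) set set" and \<gamma> :: complex
  assumes "even_integral G" and "transpose G = G" and "invertible G"
    and "of_int D = det G"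
    and "N = level G"
    and "G_perp = real N *\<^sub>R matrix_inv G"
    and "c > 0" and "a \<noteq> 0" and "coprime a (int c)"
    and "c = 2 ^ k * c\<^sub>0" and "odd c\<^sub>0"
    and "\<forall>i. w $ i \<in> \<rat>" and "\<forall>i. (G *v w) $ i \<in> \<int>"
    and "subgroup H (residue_group c)"
    and "coprime N c"
    and "[a_perp * a * int N = -1] (mod int c)"
    and "\<gamma> = of_int (kronecker \<bar>a\<bar> (int c)) ^ CARD('n) * of_int (kronecker D (int c))
           * ee (of_real (real CARD('n) * of_int (sgn a) * (1 - real c\<^sub>0) / 8))
           * ee (of_real (of_int a / (2 * real c) * (w \<bullet> (G *v w))))"
  shows "1 / of_real (sqrt (real (card H))) * gauss_sum G H (of_int a / real c) w
       = \<gamma> * (1 / of_real (sqrt (real (card (perp c H))))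
           * gauss_sum G_perp (perp c H) (of_int a_perp / real c) (- (of_int a *\<^sub>R (G *v w))))"
proof -
  note G = \<open>even_integral G\<close> \<open>transpose G = G\<close>
  note c = \<open>c > 0\<close>
  obtain A where A: "G = real_mat A" "even_form A"
    using even_integral_imp_real_mat[OF G] .
  have inv: "G ** matrix_inv G = mat 1" "matrix_inv G ** G = mat 1"
    using someI_ex[OF \<open>invertible G\<close>[unfolded invertible_def]] by (simp_all add: matrix_inv_def)
  have N: "N > 0" and Gp: "even_integral G_perp"
    using level_correct[of A] assms by (simp_all add: A(1))
  have GGp: "G ** G_perp = real N *\<^sub>R mat 1" "G_perp ** G = real N *\<^sub>R mat 1"
    by (simp_all add: \<open>G_perp = _\<close> matrix_scaleR_mult inv)
  \<comment> \<open>Transposing G G_perp = N shows that the transpose of \<open>G_perp\<close> is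
    also N times a left inverse of \<open>G\<close>, and this is unique.\<close>
  have tGp: "transpose G_perp = G_perp"
  proof -
    have "transpose G_perp ** G = real N *\<^sub>R mat 1"
      using arg_cong[OF GGp(1), of transpose] by (simp add: matrix_transpose_mul G(2) transpose_scalar)
    then have "(transpose G_perp ** G) ** matrix_inv G = (real N *\<^sub>R mat 1) ** matrix_inv G"
      by simp
    then show ?thesis
      by (simp add: matrix_mul_assoc[symmetric] inv matrix_scaleR_mult \<open>G_perp = _\<close>)
  qed
  obtain B where B: "G_perp = real_mat B" "even_form B"
    using even_integral_imp_real_mat[OF Gp tGp] .
  have AB: "A ** B = smat (int N) (mat 1)"
    using GGp(1) real_mat_scalar[of "real N" "int N", where 'a = 'n]
    by (simp add: A(1) B(1) real_mat_mult real_mat_inject)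
  have D: "det A = D"
    using \<open>of_int D = det G\<close> by (simp add: A(1) det_real_mat)
  \<comment> \<open>Taking determinants in A B = N shows that \<open>det A\<close> divides a power
    of \<open>N\<close>, so coprimality to \<open>c\<close> passes from the level to the
    determinant.\<close>
  have cop: "coprime (det A) (int c)"
  proof -
    have "det A * det B = int N ^ CARD('n)"
      using arg_cong[OF AB, of det] by (simp add: det_mul det_smat)
    then have "det A dvd int N ^ CARD('n)" by (metis dvd_triv_left)
    moreover have "coprime (int N ^ CARD('n)) (int c)" using \<open>coprime N c\<close> by simp
    ultimately show ?thesis by (rule coprime_divisors[OF _ dvd_refl])
  qed
  define x :: "int^'n" where "x = (\<chi> i. \<lfloor>(G *v w) $ i\<rfloor>)"
  have x: "G *v w = real_vec x"
    using \<open>\<forall>i. (G *v w) $ i \<in> \<int>\<close> by (simp add: x_def real_vec_def vec_eq_iff)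
  define H' where "H' = {v \<in> residue_box c. residue_class c v \<in> H}"
  have Hsub: "H \<subseteq> carrier (residue_group c)"
    using \<open>subgroup H (residue_group c)\<close> by (rule subgroup.subset)
  have H': "box_subgroup c H'"
    unfolding H'_def by (rule box_subgroup_residue[OF \<open>subgroup H _\<close> c])
  have Psub: "perp c H \<subseteq> carrier (residue_group c)" by (auto simp: perp_def)
  have P': "{v \<in> residue_box c. residue_class c v \<in> perp c H} = box_perp c H'"
    unfolding H'_def by (rule box_perp_residue[OF Hsub c])
  have cards: "card H = card H'" "card (perp c H) = card (box_perp c H')"
    using bij_betw_same_card[OF bij_betw_residue_class[OF Hsub c]]
      bij_betw_same_card[OF bij_betw_residue_class[OF Psub c]] by (simp_all add: P' H'_def)
  let ?q = "w \<bullet> (G *v w)"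
  define \<theta> where "\<theta> = unit_e (of_int a / (2 * real c) * ?q)"
  define \<sigma> where "\<sigma> = of_int (kronecker \<bar>a\<bar> (int c)) ^ CARD('n) * of_int (kronecker D (int c))
    * unit_e (real CARD('n) * of_int (sgn a) * (1 - real c\<^sub>0) / 8)"
  have \<gamma>: "\<gamma> = \<sigma> * \<theta>"
    using \<open>\<gamma> = _\<close> by (simp add: \<sigma>_def \<theta>_def unit_e_def)
  have S: "form_sum (smat a A) c = \<sigma> * of_real (sqrt (real c)) ^ CARD('n)"
    using form_sum_scaled_eq[OF A(2) \<open>c = _\<close> \<open>odd c\<^sub>0\<close> c cop \<open>coprime a _\<close> \<open>a \<noteq> 0\<close>]
    by (simp add: \<sigma>_def D mult_ac)
  \<comment> \<open>Since \<open>G\<close> is symmetric, expanding at v + w gives the cross term 2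
    x^T v, with integer coefficients, and the constant w^T G w, which is the phase \<theta>.\<close>
  have left: "gauss_sum G H (of_int a / real c) w = \<theta> * (\<Sum>h\<in>H'.
      unit_e (of_int (a * vdot h (A *v h) + 2 * vdot (a *s x) h) / (2 * real c)))"
  proof -
    have "unit_e (of_int a / real c * (1/2 * ((real_vec v + w) \<bullet> (G *v (real_vec v + w)))))
        = \<theta> * unit_e (of_int (a * vdot v (A *v v) + 2 * vdot (a *s x) v) / (2 * real c))" for v
    proof -
      have "w \<bullet> (G *v real_vec v) = (G *v w) \<bullet> real_vec v"
        using dot_lmul_matrix[of w G "real_vec v"] transpose_matrix_vector[of G w] by (simp add: G(2))
      then have 1: "w \<bullet> (G *v real_vec v) = of_int (vdot x v)"
        by (simp add: x inner_real_vec)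
      have 2: "real_vec v \<bullet> (G *v w) = of_int (vdot x v)"
        by (simp add: x inner_real_vec vdot_commute)
      have 3: "real_vec v \<bullet> (G *v real_vec v) = of_int (vdot v (A *v v))"
        by (simp add: A(1) real_mat_mult_vec inner_real_vec)
      have "(real_vec v + w) \<bullet> (G *v (real_vec v + w))
          = of_int (vdot v (A *v v)) + 2 * of_int (vdot x v) + ?q"
        using 1 2 3 by (simp add: matrix_vector_right_distrib inner_add_left inner_add_right)
      then have "of_int a / real c * (1/2 * ((real_vec v + w) \<bullet> (G *v (real_vec v + w))))
          = of_int a / (2 * real c) * ?q
            + of_int (a * vdot v (A *v v) + 2 * vdot (a *s x) v) / (2 * real c)"
        using c by (simp add: vdot_scale_left field_simps)
      then show ?thesis by (simp only: unit_e_add \<theta>_def)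
    qed
    then show ?thesis
      using \<open>\<forall>i. (G *v w) $ i \<in> \<int>\<close>
      by (subst gauss_sum_box[OF G _ c Hsub]) (simp_all add: H'_def sum_distrib_left)
  qed
  have right: "gauss_sum G_perp (perp c H) (of_int a_perp / real c) (- (of_int a *\<^sub>R (G *v w)))
      = (\<Sum>u\<in>box_perp c H'. unit_e (of_int (a_perp * vdot (u - a *s x) (B *v (u - a *s x))) / (2 *
          real c)))"
  proof -
    have arg: "- (of_int a *\<^sub>R (G *v w)) = real_vec (- (a *s x))"
      by (simp add: x real_vec_def vec_eq_iff)
    have int: "(G_perp *v real_vec (- (a *s x))) $ i \<in> \<int>" for i
      unfolding B(1) real_mat_mult_vec by (simp add: real_vec_def)
    have "real_vec u + real_vec (- (a *s x)) = real_vec (u - a *s x)" for u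
      by (simp add: real_vec_def vec_eq_iff)
    then show ?thesis
      unfolding arg gauss_sum_box[OF Gp tGp int c Psub] P'
      by (simp add: B(1) real_mat_mult_vec inner_real_vec mult.commute[of "real c" 2])
  qed
  have "1 / of_real (sqrt (real (card H'))) * (\<Sum>h\<in>H'.
        unit_e (of_int (a * vdot h (A *v h) + 2 * vdot (a *s x) h) / (2 * real c)))
      = \<sigma> * (1 / of_real (sqrt (real (card (box_perp c H')))) * (\<Sum>u\<in>box_perp c H'.
        unit_e (of_int (a_perp * vdot (u - a *s x) (B *v (u - a *s x))) / (2 * real c))))"
    by (rule subgroup_duality[OF A(2) B(2) AB c \<open>[_ = -1] (mod int c)\<close> H' S])
  then show ?thesis
    unfolding left right cards \<gamma> by (simp add: mult_ac)
qed

end
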